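(* Let $L$ be a Lie ring, $\gamma: L \to L$ an endomorphism of the Lie ring, and $r(t) = \sum_{i=0}^d a_i t^i \in \mathbb{Z}[t]$ a good polynomial of degree $d$ with $r(\gamma) = 0_L$, i.e. $\sum_i a_i \gamma^i(v) = 0$ for all $v\in L$. Suppose $(L,+)$ has no $(\operatorname{Discr}_\ast(r(t)) \cdot \operatorname{Prod}_\ast(r(t)))$-torsion. Then $L$ is nilpotent of class $\operatorname{c}(L) \le d^{2^d}$.
   Context: With $\mathbb{N}=\{1,2,\dots\}$, $r(t)\in\mathbb{Z}[t]$ is bad if there exist $u\in\mathbb{N}$ and $s(t)\in\mathbb{Z}[t]\setminus\mathbb{Z}$ with $s(t^{u+1})\mid r(0)r(1)r(t)$ in $\mathbb{Z}[t]$; otherwise good. If $r$ is constant, $\operatorname{Discr}_\ast(r) := r$, $\operatorname{Prod}_\ast(r) := 1$. Otherwise with $d=\deg r$, leading coefficient $a$, distinct roots $\lambda_1,\dots,\lambda_l\in\overline{\mathbb{Q}}$ of multiplicities $m_1,\dots,m_l$, $m=\max m_i$: $\operatorname{Discr}_\ast(r) := a^{1+2d^2}(m-1)!\prod_{i\ne j}(\lambda_i-\lambda_j)^m$ and $\operatorname{Prod}_\ast(r) := a^{2d^3}\prod_{1\le i,j\le l,\ r(\lambda_i\lambda_j)\ne0} r(\lambda_i\lambda_j)$. An abelian group $(A,+)$ has $n$-torsion if some nonzero $v$ satisfies $n v = 0$. *)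

theory Defs
  imports Complex_Main "HOL-Computational_Algebra.Polynomial"
begin

definition lie_ring :: "('a::ab_group_add \<Rightarrow> 'a \<Rightarrow> 'a) \<Rightarrow> bool" where
  "lie_ring br \<longleftrightarrow>
     (\<forall>x y z. br (x + y) z = br x z + br y z) \<and>
     (\<forall>x y z. br x (y + z) = br x y + br x z) \<and>
     (\<forall>x. br x x = 0) \<and>
     (\<forall>x y z. br x (br y z) + br y (br z x) + br z (br x y) = 0)"

definition lie_ring_endo :: "('a::ab_group_add \<Rightarrow> 'a \<Rightarrow> 'a) \<Rightarrow> ('a \<Rightarrow> 'a) \<Rightarrow> bool" where
  "lie_ring_endo br g \<longleftrightarrow>
     (\<forall>x y. g (x + y) = g x + g y) \<and> (\<forall>x y. g (br x y) = br (g x) (g y))"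

definition zsmult :: "int \<Rightarrow> 'a::ab_group_add \<Rightarrow> 'a" where
  "zsmult k x = (if 0 \<le> k then (((+) x) ^^ nat k) 0 else - ((((+) x) ^^ nat (- k)) 0))"

definition has_torsion :: "int \<Rightarrow> 'a::ab_group_add itself \<Rightarrow> bool" where
  "has_torsion n _ \<longleftrightarrow> (\<exists>v::'a. v \<noteq> 0 \<and> zsmult n v = 0)"

inductive_set add_span :: "'a::ab_group_add set \<Rightarrow> 'a set" for S where
  zero: "0 \<in> add_span S"
| base: "x \<in> S \<Longrightarrow> x \<in> add_span S"
| diff: "x \<in> add_span S \<Longrightarrow> y \<in> add_span S \<Longrightarrow> x - y \<in> add_span S"

fun lcs :: "('a::ab_group_add \<Rightarrow> 'a \<Rightarrow> 'a) \<Rightarrow> nat \<Rightarrow> 'a set" where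
  "lcs br 0 = UNIV"
| "lcs br (Suc 0) = UNIV"
| "lcs br (Suc (Suc k)) = add_span {br x y | x y. x \<in> lcs br (Suc k)}"

definition nilpotent_class_le :: "('a::ab_group_add \<Rightarrow> 'a \<Rightarrow> 'a) \<Rightarrow> nat \<Rightarrow> bool" where
  "nilpotent_class_le br c \<longleftrightarrow> lcs br (Suc c) = {0}"

definition bad_poly :: "int poly \<Rightarrow> bool" where
  "bad_poly r \<longleftrightarrow> (\<exists>(u::nat) (s::int poly). u \<ge> 1 \<and> degree s > 0 \<and>
      pcompose s (monom 1 (u + 1)) dvd smult (poly r 0 * poly r 1) r)"

definition good_poly :: "int poly \<Rightarrow> bool" where
  "good_poly r \<longleftrightarrow> \<not> bad_poly r"

text \<open>Roots are taken in the complex numbers (an algebraically closed field containing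
the algebraic closure of Q), which gives the same values.\<close>
definition Discr_star :: "int poly \<Rightarrow> complex" where
  "Discr_star r =
    (if degree r = 0 then of_int (coeff r 0) else
     (let p = map_poly (of_int :: int \<Rightarrow> complex) r;
          R = {z. poly p z = 0};
          d = degree r;
          a = (of_int (lead_coeff r) :: complex);
          m = Max ((\<lambda>z. order z p) ` R)
      in a ^ (1 + 2 * d ^ 2) * of_nat (fact (m - 1)) *
         (\<Prod>(x, y) \<in> {(x, y). x \<in> R \<and> y \<in> R \<and> x \<noteq> y}. (x - y) ^ m)))"

definition Prod_star :: "int poly \<Rightarrow> complex" where
  "Prod_star r =
    (if degree r = 0 then 1 else
     (let p = map_poly (of_int :: int \<Rightarrow> complex) r;
          R = {z. poly p z = 0};
          d = degree r;
          a = (of_int (lead_coeff r) :: complex)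
      in a ^ (2 * d ^ 3) *
         (\<Prod>(x, y) \<in> {(x, y). x \<in> R \<and> y \<in> R \<and> poly p (x * y) \<noteq> 0}. poly p (x * y))))"

end

theory Submission
  imports Defs
    "HOL-Analysis.Analysis"
    "HOL-Library.Function_Algebras"
    "HOL-Library.List_Lexorder"
    "HOL-Library.Multiset"
    "HOL-Computational_Algebra.Field_as_Ring"
    "HOL-Computational_Algebra.Fundamental_Theorem_Algebra"
    "HOL-Computational_Algebra.Polynomial_Factorial"
begin

text \<open>
  Let \<open>a\<close> be the leading coefficient of \<open>r\<close> and let \<open>R\<close> be the ring generated by the algebraic
  integers \<open>a * z\<close>, where \<open>z\<close> runs through the complex roots of \<open>r\<close>.  It is a free abelian group of
  finite rank, so the Lie ring embeds into its extension of scalars to \<open>R\<close>.  The number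
  \<open>Discr_star r * Prod_star r\<close> is an integer divisible in \<open>R\<close> by \<open>a\<close>, by all differences
  \<open>a * x - a * y\<close> of distinct roots and by all nonzero values \<open>a ^ (2 * d) * r (x * y)\<close>.  In the
  absence of torsion these elements act injectively on the extension, and therefore, up to a regular
  factor, the extension is the sum of the generalised eigenspaces of the endomorphism, which
  multiply like the roots: the Lie ring is graded by the set of roots.

  Goodness of \<open>r\<close> says that this set \<open>X\<close> contains neither 0 nor 1 nor a full geometric progression
  \<open>x * y ^ k\<close>.  The multiplicative group of the complex numbers is circularly ordered, so Kreknin's
  argument bounds the derived length by \<open>2 ^ card X - 1\<close>, and a collection argument along the
  derived series turns this into the bound for the nilpotency class.  The bracket enters
  only through the Leibniz identity.
\<close>

section \<open>Graded Leibniz rings\<close>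

text \<open>The torsion hypothesis speaks only of an integer equal to the complex number
  \<open>Discr_star r * Prod_star r\<close>, so it is void until that number is known to be an
  integer. No Galois theory is used for this: rationality comes from resultants, integrality from
  the fact that a rational element of \<open>R\<close> is an ordinary integer. Roots need not be
  algebraic integers and regular elements need not be invertible. Hence the operators are
  \<open>a * g - a * x\<close> rather than \<open>g - x\<close>, and nothing is ever divided: each
  factor of a commutator is multiplied by a power of the discriminant of the numbers
  \<open>a * x\<close> to move it into the sum of the eigenspaces, and these powers are cancelled
  once, at the very end. Directness of that sum is never established; it is enough that degrees
  multiply and that pieces outside the set of roots vanish. The Leibniz identity is multilinear, so
  it passes to the extension by a check on pure tensors, whereas \<open>br x x = 0\<close> is
  quadratic.\<close>

definition subgrp :: "'a::ab_group_add set \<Rightarrow> bool" where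
  "subgrp S \<longleftrightarrow> 0 \<in> S \<and> (\<forall>x\<in>S. \<forall>y\<in>S. x - y \<in> S)"

lemma subgrp_zero: "subgrp S \<Longrightarrow> 0 \<in> S"
  and subgrp_diff: "subgrp S \<Longrightarrow> x \<in> S \<Longrightarrow> y \<in> S \<Longrightarrow> x - y \<in> S"
  by (auto simp: subgrp_def)

lemma subgrp_uminus: "subgrp S \<Longrightarrow> x \<in> S \<Longrightarrow> - x \<in> S"
  using subgrp_diff[of S 0 x] subgrp_zero[of S] by simp

lemma subgrp_add: "subgrp S \<Longrightarrow> x \<in> S \<Longrightarrow> y \<in> S \<Longrightarrow> x + y \<in> S"
  using subgrp_diff[of S x "- y"] subgrp_uminus[of S y] by simp

lemma subgrp_sum: "subgrp S \<Longrightarrow> (\<And>i. i \<in> I \<Longrightarrow> f i \<in> S) \<Longrightarrow> sum f I \<in> S"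
  by (induction I rule: infinite_finite_induct) (auto intro: subgrp_zero subgrp_add)

lemma subgrp_add_span: "subgrp (add_span S)"
  by (auto simp: subgrp_def intro: add_span.intros)

lemma add_span_minimal:
  assumes "subgrp T" "S \<subseteq> T" shows "add_span S \<subseteq> T"
proof
  fix x assume "x \<in> add_span S"
  then show "x \<in> T"
    by induction (use assms in \<open>auto simp: subgrp_def\<close>)
qed

lemma add_span_mono: "S \<subseteq> T \<Longrightarrow> add_span S \<subseteq> add_span T"
  by (rule add_span_minimal[OF subgrp_add_span]) (auto intro: add_span.base)

lemma subgrp_singleton_zero: "subgrp {0}"
  by (simp add: subgrp_def)

lemma subgrp_vimage:
  assumes "subgrp T" "\<And>x y. f (x + y) = f x + f y"
  shows "subgrp {x. f x \<in> T}"
proof -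
  have 0: "f 0 = 0" using assms(2)[of 0 0] by simp
  have "f (x - y) = f x - f y" for x y
    using assms(2)[of "x - y" y] by (simp add: algebra_simps)
  then show ?thesis using assms(1) 0 by (auto simp: subgrp_def)
qed

text \<open>Stated for an arbitrary biadditive map, so that it serves for brackets as well as for
  multiplication of complex numbers.\<close>

lemma biadditive_span_closed:
  assumes "subgrp T" and add: "\<And>u v w. f (u + v) w = f u w + f v w" "\<And>u v w. f u (v + w) = f u v + f u w"
    and gen: "\<And>u v. u \<in> S \<Longrightarrow> v \<in> S' \<Longrightarrow> f u v \<in> T"
    and "u \<in> add_span S" "v \<in> add_span S'"
  shows "f u v \<in> T"
proof -
  have *: "f u v \<in> T" if "v \<in> S'" for v
  proof -
    have "add_span S \<subseteq> {u. f u v \<in> T}"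
      by (intro add_span_minimal subgrp_vimage assms(1) add) (use gen that in auto)
    then show ?thesis using assms by auto
  qed
  have "add_span S' \<subseteq> {v. f u v \<in> T}"
    by (intro add_span_minimal subgrp_vimage assms(1) add) (use * in auto)
  then show ?thesis using assms by auto
qed

text \<open>The recursion is the cost of one more derived step in
  \<open>lower_subset_derived\<close>: reaching the \<open>k\<close>-th derived ring takes
  \<open>c\<close>, and \<open>(s - 1) * c + 1\<close> further factors push into the next
  one.\<close>

fun class_bound :: "nat \<Rightarrow> nat \<Rightarrow> nat" where
  "class_bound s 0 = 0"
| "class_bound s (Suc k) = s * class_bound s k + 1"

lemma class_bound_le:
  assumes "1 \<le> s" "s \<le> d"
  shows "class_bound s (2 ^ s - 1) \<le> d ^ (2 ^ d)"
\<comment> \<open>The geometric estimate \<open>class_bound s k + 1 \<le> s ^ k\<close> needs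
  \<open>s \<ge> 2\<close>; for \<open>s = 1\<close> the value is 1.\<close>
proof (cases "s = 1")
  case True
  then show ?thesis using assms by simp
next
  case False
  have "class_bound s k + 1 \<le> s ^ k" for k
  proof (induction k)
    case (Suc k)
    have "class_bound s (Suc k) + 1 \<le> s * (class_bound s k + 1)" using False assms by simp
    also have "\<dots> \<le> s ^ Suc k" using mult_le_mono2[OF Suc] by simp
    finally show ?case .
  qed simp
  then have "class_bound s (2 ^ s - 1) \<le> s ^ (2 ^ s - 1)" by (meson add_leD1)
  also have "\<dots> \<le> s ^ (2 ^ d)"
    using assms by (intro power_increasing) (auto intro: le_trans[OF diff_le_self] power_increasing)
  also have "\<dots> \<le> d ^ (2 ^ d)" using assms by (intro power_mono) auto
  finally show ?thesis .
qed

text \<open>A right Leibniz ring: \<open>leibniz_swap\<close> says that right multiplications are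
  derivations, and \<open>leibniz\<close> rewrites any product of products in left-normed
  form.\<close>

locale leibniz_ring =
  fixes br :: "'b::ab_group_add \<Rightarrow> 'b \<Rightarrow> 'b"
  assumes br_add_left: "br (u + v) w = br u w + br v w"
    and br_add_right: "br u (v + w) = br u v + br u w"
    and leibniz: "br u (br v w) = br (br u v) w - br (br u w) v"
begin

lemma br_zero_left [simp]: "br 0 w = 0" using br_add_left[of 0 0 w] by simp
lemma br_zero_right [simp]: "br u 0 = 0" using br_add_right[of u 0 0] by simp

lemma br_diff_left: "br (u - v) w = br u w - br v w"
  using br_add_left[of "u - v" v w] by (simp add: algebra_simps)

lemma br_diff_right: "br u (v - w) = br u v - br u w"
  using br_add_right[of u "v - w" w] by (simp add: algebra_simps)

lemma leibniz_swap: "br (br u v) w = br (br u w) v + br u (br v w)"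
  using leibniz[of u v w] by (simp add: algebra_simps)

lemmas br_span_closed = biadditive_span_closed[OF _ br_add_left br_add_right]

end

text \<open>In the residues \<open>1, ..., n - 1\<close> modulo \<open>n\<close>, a sum of two of
  them either exceeds both or, after subtracting \<open>n\<close>, lies below both.
  \<open>key_mult\<close> keeps exactly this dichotomy, which is all that Kreknin's argument needs
  from the cyclic order. \<open>arith_free\<close> is needed only for the passage from solubility to
  nilpotency.\<close>

locale graded_leibniz_ring = leibniz_ring br
  for br :: "'b::ab_group_add \<Rightarrow> 'b \<Rightarrow> 'b" +
  fixes X :: "'g::comm_monoid_mult set" and key :: "'g \<Rightarrow> 'o::linorder"
  assumes finite_X: "finite X"
    and inj_key: "inj_on key X"
    and key_mult: "x \<in> X \<Longrightarrow> y \<in> X \<Longrightarrow> x * y \<in> X \<Longrightarrow>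
      (key (x * y) < key x \<and> key (x * y) < key y) \<or> (key x < key (x * y) \<and> key y < key (x * y))"
    and arith_free: "x \<in> X \<Longrightarrow> y \<in> X \<Longrightarrow> \<exists>k::nat. x * y ^ k \<notin> X"
begin

definition grading :: "('g \<Rightarrow> 'b set) \<Rightarrow> bool" where
  "grading H \<longleftrightarrow> (\<forall>x. subgrp (H x)) \<and> (\<forall>x. x \<notin> X \<longrightarrow> H x = {0}) \<and>
     (\<forall>x y u v. u \<in> H x \<longrightarrow> v \<in> H y \<longrightarrow> br u v \<in> H (x * y))"

lemma grading_subgrp: "grading H \<Longrightarrow> subgrp (H x)"
  and grading_outside: "grading H \<Longrightarrow> x \<notin> X \<Longrightarrow> u \<in> H x \<Longrightarrow> u = 0"
  and grading_br: "grading H \<Longrightarrow> u \<in> H x \<Longrightarrow> v \<in> H y \<Longrightarrow> br u v \<in> H (x * y)"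
  by (auto simp: grading_def)

section \<open>The derived series and Kreknin's theorem\<close>

definition derived :: "('g \<Rightarrow> 'b set) \<Rightarrow> 'g \<Rightarrow> 'b set" where
  "derived H x = add_span {br u v | u v i j. u \<in> H i \<and> v \<in> H j \<and> i * j = x}"

lemma derivedI: "u \<in> H i \<Longrightarrow> v \<in> H j \<Longrightarrow> br u v \<in> derived H (i * j)"
  unfolding derived_def by (rule add_span.base) blast

lemma derived_minimal:
  assumes "subgrp T" "\<And>u v i j. u \<in> H i \<Longrightarrow> v \<in> H j \<Longrightarrow> i * j = x \<Longrightarrow> br u v \<in> T"
  shows "derived H x \<subseteq> T"
  unfolding derived_def by (rule add_span_minimal) (use assms in auto)

lemma derived_subset: "grading H \<Longrightarrow> derived H x \<subseteq> H x"
  by (rule derived_minimal) (auto intro: grading_subgrp grading_br)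

lemma grading_derived:
  assumes "grading H" shows "grading (derived H)"
  unfolding grading_def
proof (intro conjI allI impI)
  show "subgrp (derived H x)" for x
    by (simp add: derived_def subgrp_add_span)
  then show "derived H x = {0}" if "x \<notin> X" for x
    using derived_subset[OF assms, of x] grading_outside[OF assms that] subgrp_zero by blast
  show "br u v \<in> derived H (x * y)" if "u \<in> derived H x" "v \<in> derived H y" for x y u v
    using that derived_subset[OF assms] by (intro derivedI) auto
qed

lemma grading_derived_funpow: "grading H \<Longrightarrow> grading ((derived ^^ n) H)"
  by (induction n) (auto intro: grading_derived)

lemma derived_funpow_subset: "grading H \<Longrightarrow> (derived ^^ n) H x \<subseteq> H x"
proof (induction n)
  case (Suc n)
  then show ?case
    using derived_subset[OF grading_derived_funpow[OF Suc.prems, of n], of x] by auto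
qed simp

text \<open>Right multiplication by \<open>v\<close> is a derivation, so if it preserves a term of
  the series, up to the shift of degree, it also preserves the products of two elements of that
  term.\<close>

lemma derived_funpow_ideal:
  assumes "grading H" "u \<in> (derived ^^ n) H x" "v \<in> H y"
  shows "br u v \<in> (derived ^^ n) H (x * y)"
  using assms(2,3)
proof (induction n arbitrary: u v x y)
  case 0
  then show ?case using assms(1) by (auto intro: grading_br)
next
  case (Suc n)
  let ?M = "(derived ^^ n) H"
  have g: "grading (derived ?M)" by (intro grading_derived grading_derived_funpow assms)
  have "derived ?M x \<subseteq> {u. br u v \<in> derived ?M (x * y)}"
  proof (rule derived_minimal)
    show "subgrp {u. br u v \<in> derived ?M (x * y)}"
      by (rule subgrp_vimage[OF grading_subgrp[OF g]]) (rule br_add_left)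
    fix p q i j assume pq: "p \<in> ?M i" "q \<in> ?M j" "i * j = x"
    have "br (br p v) q \<in> derived ?M (x * y)"
      using derivedI[OF Suc.IH[OF pq(1) Suc.prems(2)] pq(2)] by (simp add: pq(3)[symmetric] mult_ac)
    moreover have "br p (br q v) \<in> derived ?M (x * y)"
      using derivedI[OF pq(1) Suc.IH[OF pq(2) Suc.prems(2)]] by (simp add: pq(3)[symmetric] mult_ac)
    ultimately show "br p q \<in> {u. br u v \<in> derived ?M (x * y)}"
      by (simp add: leibniz_swap[of p q v] subgrp_add[OF grading_subgrp[OF g]])
  qed
  then show ?case using Suc.prems by auto
qed

text \<open>Sums of left-normed products of homogeneous elements with degrees in \<open>Y\<close>,
  with the total degree recorded. By \<open>lgen_br\<close> this is already the whole subring
  generated by these elements, while the left-normed form leaves a single last factor to argue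
  about.\<close>

inductive lgen :: "('g \<Rightarrow> 'b set) \<Rightarrow> 'g set \<Rightarrow> 'g \<Rightarrow> 'b \<Rightarrow> bool" for H Y where
  zero: "lgen H Y x 0"
| base: "y \<in> Y \<Longrightarrow> u \<in> H y \<Longrightarrow> lgen H Y y u"
| diff: "lgen H Y x u \<Longrightarrow> lgen H Y x v \<Longrightarrow> lgen H Y x (u - v)"
| step: "lgen H Y x w \<Longrightarrow> y \<in> Y \<Longrightarrow> z \<in> H y \<Longrightarrow> lgen H Y (x * y) (br w z)"

lemma subgrp_lgen: "subgrp {u. lgen H Y x u}"
  by (auto simp: subgrp_def intro: lgen.intros)

lemma lgen_br: "lgen H Y j v \<Longrightarrow> lgen H Y i u \<Longrightarrow> lgen H Y (i * j) (br u v)"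
proof (induction arbitrary: i u rule: lgen.induct)
  case (diff x u v)
  then show ?case by (simp add: br_diff_right lgen.diff)
next
  case (step x w y z)
  have "lgen H Y (i * x * y) (br (br u w) z)"
    using step by (intro lgen.step[of _ _ "i * x"]) auto
  moreover have "lgen H Y (i * y * x) (br (br u z) w)"
    using step.hyps step.prems by (intro step.IH lgen.step[of _ _ i]) auto
  ultimately show ?case
    using lgen.diff[of H Y "i * x * y"] by (simp add: leibniz[of u w z] mult_ac)
qed (auto intro: lgen.intros)

lemma lgen_subset:
  assumes "grading H" "lgen H Y x u" shows "u \<in> H x"
  using assms(2)
  by induction (use assms(1) in \<open>auto intro: subgrp_zero subgrp_diff grading_subgrp grading_br\<close>)

text \<open>One step of Kreknin's argument: a product landing in the degree \<open>b\<close> just below \<open>Y\<close>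
  can be written without using degree \<open>b\<close>, because both factors of a product of degree \<open>b\<close>
  lie on the same side of \<open>b\<close>.\<close>

lemma br_lgen_insert:
  assumes H: "grading H" and b: "b \<in> X" "b \<notin> Y" and Y: "Y \<subseteq> X"
    and up: "\<And>x y. x \<in> X \<Longrightarrow> x \<notin> Y \<Longrightarrow> y \<in> Y \<Longrightarrow> key x < key y"
    and max: "\<And>x. x \<in> X \<Longrightarrow> x \<notin> Y \<Longrightarrow> key x \<le> key b"
    and v: "lgen H (insert b Y) j v" and u: "u \<in> H i" and "i * j = b"
  shows "lgen H Y b (br u v)"
proof -
  have products: "lgen H Y b (br u z)" if "u \<in> H i" "z \<in> H y" "y \<in> insert b Y" "i * y = b" for u z i y
  proof (cases "i \<in> X")
    case True
    have "y \<in> X" using that b Y by auto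
    have "key b \<le> key y" using that up[of b y] b by (auto intro: less_imp_le)
    then have *: "key b < key i \<and> key b < key y"
      using key_mult[OF True \<open>y \<in> X\<close>] that b by auto
    then have "i \<in> Y" "y \<in> Y" using max[of i] max[of y] True \<open>y \<in> X\<close> by force+
    then have "lgen H Y (i * y) (br u z)"
      using that by (intro lgen.step lgen.base) auto
    then show ?thesis using that by simp
  next
    case False
    then have "u = 0" using grading_outside[OF H False] that by blast
    then show ?thesis by (simp add: lgen.zero)
  qed
  from v u \<open>i * j = b\<close> show ?thesis
  proof (induction arbitrary: i u rule: lgen.induct)
    case (base y u)
    then show ?case by (intro products)
  next
    case (diff x u v)
    then show ?case by (simp add: br_diff_right lgen.diff)
  next
    case (step x w y z)
    \<comment> \<open>The Leibniz identity isolates the last factor: in one term \<open>z\<close> is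
      a single generator multiplying \<open>br u w\<close>, in the other the shorter product
      \<open>w\<close> is left for the induction.\<close>
    have "lgen H Y b (br (br u w) z)"
      using step grading_br[OF H step.prems(1) lgen_subset[OF H step.hyps(1)]]
      by (intro products[of _ "i * x" _ y]) (auto simp: mult_ac)
    moreover have "lgen H Y b (br (br u z) w)"
      using step.prems grading_br[OF H step.prems(1) step.hyps(3)]
      by (intro step.IH[of _ "i * y"]) (auto simp: mult_ac)
    ultimately show ?case by (simp add: leibniz[of u w z] lgen.diff)
  qed (auto intro: lgen.zero)
qed

text \<open>Induction on the number \<open>n + 1\<close> of degrees outside \<open>Y\<close>.
  Dropping one more degree \<open>b\<close> doubles the price, since
  \<open>2 ^ (n + 1) - 1 = (2 ^ n - 1) + 2 ^ n\<close>: the first \<open>2 ^ n\<close> steps make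
  every element of degree \<open>b\<close> expressible without degree \<open>b\<close>, the
  remaining ones express everything through degrees in \<open>Y\<close> and
  \<open>b\<close>.\<close>

lemma derived_lgen:
  assumes "grading H" "Y \<subseteq> X"
    and "\<And>x y. x \<in> X \<Longrightarrow> x \<notin> Y \<Longrightarrow> y \<in> Y \<Longrightarrow> key x < key y"
    and "u \<in> (derived ^^ (2 ^ card (X - Y) - 1)) H x"
  shows "lgen H Y x u"
  using assms
proof (induction "card (X - Y)" arbitrary: H Y x u)
  case 0
  then have "X = Y" using finite_X by auto
  moreover have "u \<in> H x" using 0 by simp
  moreover have "u = 0" if "x \<notin> X" using grading_outside[OF 0(2) that \<open>u \<in> H x\<close>] .
  ultimately show ?case by (cases "x \<in> X") (auto intro: lgen.intros)
next
  case (Suc n)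
  have ne: "X - Y \<noteq> {}" using Suc.hyps(2) by (metis card.empty nat.distinct(1))
  then have "Max (key ` (X - Y)) \<in> key ` (X - Y)" using finite_X by (intro Max_in) auto
  \<comment> \<open>Taking the largest key outside \<open>Y\<close> keeps the set of permitted
    degrees closed upwards.\<close>
  then obtain b where b: "b \<in> X" "b \<notin> Y" and bM: "key b = Max (key ` (X - Y))" by auto
  have max: "key x \<le> key b" if "x \<in> X" "x \<notin> Y" for x
    unfolding bM using that finite_X by (intro Max_ge) auto
  let ?Y = "insert b Y" let ?N = "2 ^ n :: nat"
  have "X - Y = insert b (X - ?Y)" using b by auto
  then have "card (X - Y) = Suc (card (X - ?Y))"
    using finite_X card_insert_disjoint[of "X - ?Y" b] by (metis DiffE finite_Diff insertI1)
  then have c: "card (X - ?Y) = n" using Suc.hyps(2) by simp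
  have up: "key x < key y" if "x \<in> X" "x \<notin> ?Y" "y \<in> ?Y" for x y
  proof (cases "y = b")
    case True
    have "key x \<noteq> key b" using that b inj_key by (auto dest: inj_onD)
    then show ?thesis using max[of x] that True by auto
  next
    case False
    then show ?thesis using Suc.prems(3) that by auto
  qed
  have IH: "lgen H' ?Y x u" if "grading H'" "u \<in> (derived ^^ (?N - 1)) H' x" for H' x u
    using Suc.hyps(1)[OF c[symmetric] that(1)] that(2) up b Suc.prems(2) c by auto
  \<comment> \<open>Elements of \<open>H' b\<close> are sums of products of two elements of the term
    \<open>2 ^ n - 1\<close>, to which the induction hypothesis applies;
    \<open>br_lgen_insert\<close> then removes \<open>b\<close>.\<close>
  define H' where "H' = (derived ^^ ?N) H"
  have gH': "grading H'" unfolding H'_def by (rule grading_derived_funpow) fact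
  have H'_sub: "z \<in> H y" if "z \<in> H' y" for z y
    using that derived_funpow_subset[OF Suc.prems(1)] unfolding H'_def by blast
  have H'b: "lgen H Y b z" if "z \<in> H' b" for z
  proof -
    have "H' b = derived ((derived ^^ (?N - 1)) H) b"
      unfolding H'_def by (cases ?N) simp_all
    also have "\<dots> \<subseteq> {u. lgen H Y b u}"
    proof (rule derived_minimal[OF subgrp_lgen])
      fix u v i j
      assume "u \<in> (derived ^^ (?N - 1)) H i" "v \<in> (derived ^^ (?N - 1)) H j" "i * j = b"
      then show "br u v \<in> {u. lgen H Y b u}"
        using br_lgen_insert[OF Suc.prems(1) b Suc.prems(2,3) max IH[OF Suc.prems(1)], of v j u i]
          derived_funpow_subset[OF Suc.prems(1)] by auto
    qed
    finally show ?thesis using that by auto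
  qed
  have "u \<in> (derived ^^ (?N - 1)) H' x"
  proof -
    have "2 ^ card (X - Y) - 1 = (?N - 1) + ?N"
      unfolding Suc.hyps(2)[symmetric] by simp
    then show ?thesis using Suc.prems(4) by (simp only: H'_def funpow_add o_def)
  qed
  from IH[OF gH' this] show ?case
  proof (induction rule: lgen.induct)
    case (base y u)
    then show ?case using H'b H'_sub lgen.base by blast
  next
    case (step x w y z)
    have "lgen H Y y z"
      using step.hyps H'b H'_sub lgen.base by blast
    then show ?case using step by (intro lgen_br)
  qed (auto intro: lgen.intros)
qed

lemma derived_trivial:
  assumes "grading H" shows "(derived ^^ (2 ^ card X - 1)) H x = {0}"
proof -
  have "u = 0" if "lgen H {} x u" for u x
    using that by induction auto
  then show ?thesis
    using derived_lgen[OF assms, of "{}"] subgrp_zero[OF grading_subgrp[OF grading_derived_funpow[OF assms]]]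
    by fastforce
qed

section \<open>The lower central series of a graded ring\<close>

fun lower :: "('g \<Rightarrow> 'b set) \<Rightarrow> nat \<Rightarrow> 'g \<Rightarrow> 'b set" where
  "lower H 0 x = H x"
| "lower H (Suc n) x = add_span {br u v | u v i j. u \<in> lower H n i \<and> v \<in> H j \<and> i * j = x}"

declare lower.simps(2) [simp del]

lemma subgrp_lower: "grading H \<Longrightarrow> subgrp (lower H n x)"
  by (cases n) (auto simp: lower.simps intro: grading_subgrp subgrp_add_span)

lemma lower_SucI: "u \<in> lower H n i \<Longrightarrow> v \<in> H j \<Longrightarrow> br u v \<in> lower H (Suc n) (i * j)"
  unfolding lower.simps by (rule add_span.base) blast

lemma lower_Suc_minimal:
  assumes "subgrp T" "\<And>u v i j. u \<in> lower H n i \<Longrightarrow> v \<in> H j \<Longrightarrow> i * j = x \<Longrightarrow> br u v \<in> T"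
  shows "lower H (Suc n) x \<subseteq> T"
  unfolding lower.simps by (rule add_span_minimal) (use assms in auto)

lemma lower_Suc_subset: "grading H \<Longrightarrow> lower H (Suc n) x \<subseteq> lower H n x"
proof (induction n arbitrary: x)
  case 0
  then show ?case by (intro lower_Suc_minimal) (auto intro: grading_subgrp grading_br)
next
  case (Suc n)
  show ?case
  proof (rule lower_Suc_minimal[OF subgrp_lower[OF Suc.prems]])
    fix u v i j assume "u \<in> lower H (Suc n) i" "v \<in> H j" "i * j = x"
    then show "br u v \<in> lower H (Suc n) x"
      using Suc lower_SucI[of u H n i v j] by blast
  qed
qed

lemma lower_antimono: "grading H \<Longrightarrow> m \<le> n \<Longrightarrow> lower H n x \<subseteq> lower H m x"
  by (rule lift_Suc_antimono_le[of "\<lambda>n. lower H n x"]) (auto intro: lower_Suc_subset[THEN subsetD])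

lemma lower_subset: "grading H \<Longrightarrow> u \<in> lower H n x \<Longrightarrow> u \<in> H x"
  using lower_antimono[of H 0 n x] by auto

text \<open>The index is the commutator weight minus one, so adding the weights \<open>m + 1\<close>
  and \<open>n + 1\<close> gives the index \<open>m + n + 1\<close>.\<close>

lemma lower_br:
  assumes "grading H" "u \<in> lower H m i" "v \<in> lower H n j"
  shows "br u v \<in> lower H (m + n + 1) (i * j)"
  using assms(2,3)
proof (induction n arbitrary: u v m i j)
  case 0
  then show ?case using lower_SucI by simp
next
  case (Suc n)
  let ?T = "lower H (m + Suc n + 1) (i * j)"
  have T: "subgrp ?T" by (rule subgrp_lower[OF assms(1)])
  have "lower H (Suc n) j \<subseteq> {v. br u v \<in> ?T}"
  proof (rule lower_Suc_minimal)
    show "subgrp {v. br u v \<in> ?T}" by (rule subgrp_vimage[OF T]) (rule br_add_right)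
    fix w z p q assume *: "w \<in> lower H n p" "z \<in> H q" "p * q = j"
    have "br (br u w) z \<in> ?T"
      using lower_SucI[OF Suc.IH[OF Suc.prems(1) *(1)] *(2)]
      by (simp add: *(3)[symmetric] mult_ac)
    moreover have "br (br u z) w \<in> ?T"
      using Suc.IH[OF lower_SucI[OF Suc.prems(1) *(2)] *(1)]
      by (simp add: *(3)[symmetric] mult_ac)
    ultimately show "br w z \<in> {v. br u v \<in> ?T}"
      using subgrp_diff[OF T] by (simp add: leibniz[of u w z])
  qed
  then show ?case using Suc.prems by auto
qed

section \<open>From derived length to nilpotency class\<close>

definition hspan :: "('g \<Rightarrow> 'b set) \<Rightarrow> 'b set" where
  "hspan H = add_span (\<Union>x. H x)"

lemma subgrp_hspan: "subgrp (hspan H)"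
  by (simp add: hspan_def subgrp_add_span)

lemma hspanI: "u \<in> H x \<Longrightarrow> u \<in> hspan H"
  unfolding hspan_def by (rule add_span.base) auto

lemma hspan_br_homogeneous:
  assumes "grading H" "u \<in> hspan ((derived ^^ n) H)" "v \<in> H y"
  shows "br u v \<in> hspan ((derived ^^ n) H)"
proof (rule br_span_closed[OF subgrp_hspan _ assms(2)[unfolded hspan_def] add_span.base])
  fix u w assume "u \<in> (\<Union>x. (derived ^^ n) H x)" "w \<in> {v}"
  then show "br u w \<in> hspan ((derived ^^ n) H)"
    using derived_funpow_ideal[OF assms(1) _ assms(3)] by (auto intro: hspanI)
qed simp

lemma hspan_br_hspan:
  assumes "u \<in> hspan H" "v \<in> hspan H"
  shows "br u v \<in> hspan (derived H)"
  using assms unfolding hspan_def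
  by (rule br_span_closed[OF subgrp_add_span, rotated]) (auto intro!: add_span.base derivedI)

text \<open>A triple \<open>(n, b, y)\<close> records an element \<open>y\<close> of degree \<open>b\<close> in the \<open>n\<close>-th term of the
  lower central series (so of commutator weight \<open>n + 1\<close>), acting by right multiplication.\<close>

definition rmul :: "'b \<Rightarrow> (nat \<times> 'g \<times> 'b) list \<Rightarrow> 'b" where
  "rmul m ts = foldl (\<lambda>u t. br u (snd (snd t))) m ts"

lemma rmul_simps [simp]: "rmul m [] = m" "rmul m (t # ts) = rmul (br m (snd (snd t))) ts"
  "rmul m (ss @ ts) = rmul (rmul m ss) ts"
  by (simp_all add: rmul_def)

lemma rmul_add: "rmul (u + v) ts = rmul u ts + rmul v ts"
  by (induction ts arbitrary: u v) (simp_all add: br_add_left)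

lemma rmul_zero: "rmul 0 ts = 0"
  by (induction ts) simp_all

definition triples :: "('g \<Rightarrow> 'b set) \<Rightarrow> (nat \<times> 'g \<times> 'b) set" where
  "triples H = {(n, b, y). y \<in> lower H n b}"

definition weight :: "(nat \<times> 'g \<times> 'b) list \<Rightarrow> nat" where
  "weight ts = (\<Sum>t\<leftarrow>ts. fst t + 1)"

definition comb :: "nat \<times> 'g \<times> 'b \<Rightarrow> nat \<times> 'g \<times> 'b \<Rightarrow> nat \<times> 'g \<times> 'b" where
  "comb s t = (fst s + fst t + 1, fst (snd s) * fst (snd t), br (snd (snd s)) (snd (snd t)))"

lemma comb_triples: "grading H \<Longrightarrow> s \<in> triples H \<Longrightarrow> t \<in> triples H \<Longrightarrow> comb s t \<in> triples H"
  using lower_br by (auto simp: triples_def comb_def)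

text \<open>Since right multiplications are derivations, exchanging two neighbours costs one term in
  which they are merged into their bracket: one factor fewer, same total weight.\<close>

lemma rmul_swap:
  "rmul m (ss @ s # t # ts) = rmul m (ss @ t # s # ts) + rmul m (ss @ comb s t # ts)"
  by (simp add: comb_def leibniz_swap[of "rmul m ss" "snd (snd s)" "snd (snd t)"] rmul_add)

lemma rmul_move_front:
  assumes I: "subgrp I"
    and Q: "\<And>as p q bs. mset (as @ p # q # bs) = A \<Longrightarrow> rmul m (as @ comb p q # bs) \<in> I"
    and "mset (as @ t # bs) = A"
  shows "rmul m (as @ t # bs) \<in> I \<longleftrightarrow> rmul m (t # as @ bs) \<in> I"
  using assms(3)
proof (induction as arbitrary: bs rule: rev_induct)
  case (snoc p as)
  have "rmul m (as @ p # t # bs) = rmul m (as @ t # p # bs) + rmul m (as @ comb p t # bs)"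
    by (rule rmul_swap)
  moreover have "rmul m (as @ comb p t # bs) \<in> I"
    using snoc.prems by (intro Q) auto
  ultimately have "rmul m (as @ p # t # bs) \<in> I \<longleftrightarrow> rmul m (as @ t # p # bs) \<in> I"
    using subgrp_add[OF I] subgrp_diff[OF I] by (metis add_diff_cancel_right')
  also have "\<dots> \<longleftrightarrow> rmul m (t # as @ p # bs) \<in> I"
    using snoc.prems by (intro snoc.IH) auto
  finally show ?case by simp
qed simp

text \<open>The merged terms are assumed to lie in \<open>I\<close> for every arrangement of the
  same factors, because sorting passes through many intermediate arrangements.\<close>

lemma rmul_perm:
  assumes I: "subgrp I" and "mset xs = mset ys"
    and "\<And>as p q bs. mset (as @ p # q # bs) = mset xs \<Longrightarrow> rmul m (as @ comb p q # bs) \<in> I"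
  shows "rmul m xs \<in> I \<longleftrightarrow> rmul m ys \<in> I"
  using assms(2,3)
proof (induction xs arbitrary: m ys)
  case (Cons x xs)
  then have "x \<in> set ys" by (metis list.set_intros(1) set_mset_mset)
  then obtain as bs where ys: "ys = as @ x # bs" by (auto dest: split_list)
  have "rmul (br m (snd (snd x))) xs \<in> I \<longleftrightarrow> rmul (br m (snd (snd x))) (as @ bs) \<in> I"
  proof (rule Cons.IH)
    fix as p q bs assume "mset (as @ p # q # bs) = mset xs"
    then show "rmul (br m (snd (snd x))) (as @ comb p q # bs) \<in> I"
      using Cons.prems(2)[of "x # as" p q bs] by simp
  qed (use Cons.prems ys in auto)
  also have "\<dots> \<longleftrightarrow> rmul m (as @ x # bs) \<in> I"
    using rmul_move_front[OF I Cons.prems(2), where as = as and t = x and bs = bs] Cons.prems(1) ys by simp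
  finally show ?case by (simp add: ys)
qed simp

text \<open>Every new factor enlarges the set of subproducts: if multiplication by
  \<open>f t\<close> mapped the old set into itself, the set would contain
  \<open>a * f t ^ k\<close> for all \<open>k\<close>, against \<open>arith_free\<close>.
  Consequently, among \<open>card X\<close> factors some subproduct must leave
  \<open>X\<close>.\<close>

lemma subset_products_card:
  assumes "a \<in> X" "\<And>t. t \<in># T \<Longrightarrow> f t \<in> X"
    and "\<And>N. N \<subseteq># T \<Longrightarrow> a * prod_mset (image_mset f N) \<in> X"
  shows "size T < card {a * prod_mset (image_mset f N) |N. N \<subseteq># T}"
  using assms(2,3)
proof (induction T)
  case empty
  then show ?case by simp
next
  case (add t T)
  define S where "S = {a * prod_mset (image_mset f N) |N. N \<subseteq># T}"
  define S' where "S' = {a * prod_mset (image_mset f N) |N. N \<subseteq># add_mset t T}"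
  have T: "N \<subseteq># add_mset t T" if "N \<subseteq># T" for N
    using that by (simp add: subset_mset.add_increasing2 subset_mset.order_trans[of N T "add_mset t T"])
  have IH: "size T < card S"
    unfolding S_def using add.prems T by (intro add.IH) auto
  have "S' \<subseteq> X" using add.prems unfolding S'_def by auto
  then have fin: "finite S'" using finite_X finite_subset by blast
  have SS': "S \<subseteq> S'" unfolding S_def S'_def using T by blast
  have mS': "z * f t \<in> S'" if "z \<in> S" for z
  proof -
    from that obtain N where "N \<subseteq># T" "z = a * prod_mset (image_mset f N)" unfolding S_def by auto
    then show ?thesis unfolding S'_def
      by (intro CollectI exI[of _ "add_mset t N"]) (auto simp: mult_ac)
  qed
  have "\<exists>z\<in>S. z * f t \<notin> S"
  proof (rule ccontr)
    assume "\<not> ?thesis"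
    then have *: "z * f t \<in> S" if "z \<in> S" for z using that by auto
    have "a \<in> S" unfolding S_def by (intro CollectI exI[of _ "{#}"]) simp
    then have "a * f t ^ k \<in> S" for k
      by (induction k) (auto dest: * simp: mult_ac)
    moreover have "f t \<in> X" using add.prems by simp
    ultimately show False using arith_free[OF assms(1), of "f t"] SS' \<open>S' \<subseteq> X\<close> by blast
  qed
  then obtain z where z: "z \<in> S" "z * f t \<notin> S" by auto
  have "finite S" using SS' fin finite_subset by blast
  then have "card (insert (z * f t) S) = card S + 1" using z by simp
  moreover have "card (insert (z * f t) S) \<le> card S'"
    using SS' mS' z fin by (intro card_mono) auto
  ultimately show ?case using IH unfolding S'_def by simp
qed

lemma rmul_degree:
  assumes "grading H" "m \<in> H a" "set ts \<subseteq> triples H"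
  shows "rmul m ts \<in> H (a * prod_mset (image_mset (\<lambda>t. fst (snd t)) (mset ts)))"
  using assms(2,3)
proof (induction ts arbitrary: m a)
  case (Cons t ts)
  have "snd (snd t) \<in> H (fst (snd t))"
    using Cons.prems lower_subset[OF assms(1)] by (auto simp: triples_def)
  then have "br m (snd (snd t)) \<in> H (a * fst (snd t))"
    using grading_br[OF assms(1)] Cons.prems by blast
  from Cons.IH[OF this] Cons.prems show ?case by (simp add: mult_ac)
qed simp

lemma rmul_zero_mem:
  assumes "t \<in> set ts" "snd (snd t) = 0" shows "rmul m ts = 0"
  using assms by (auto dest!: split_list simp: rmul_zero)

lemma rmul_ideal:
  assumes "grading H" "m \<in> hspan ((derived ^^ n) H)" "set ts \<subseteq> triples H"
  shows "rmul m ts \<in> hspan ((derived ^^ n) H)"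
  using assms(2,3)
proof (induction ts arbitrary: m)
  case (Cons t ts)
  have "snd (snd t) \<in> H (fst (snd t))"
    using Cons.prems lower_subset[OF assms(1)] by (auto simp: triples_def)
  from hspan_br_homogeneous[OF assms(1) Cons.prems(1) this] Cons show ?case by auto
qed simp

lemma weight_mset: "weight ts = (\<Sum>t\<in>#mset ts. fst t + 1)"
  by (induction ts) (auto simp: weight_def)

lemma weight_le: "(\<And>t. t \<in> set ts \<Longrightarrow> fst t + 1 \<le> c) \<Longrightarrow> weight ts \<le> length ts * c"
proof (induction ts)
  case (Cons t ts)
  then have "fst t + 1 \<le> c" "weight ts \<le> length ts * c" by auto
  then show ?case by (simp add: weight_def)
qed (simp add: weight_def)

text \<open>Collection process modulo \<open>[M, M]\<close>, where \<open>M\<close> is the \<open>k\<close>-th derived ring: swapping two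
  adjacent factors produces a product with fewer factors of the same total weight.  A product
  with few factors has a factor in \<open>M\<close>; a product with at least \<open>card X\<close> factors
  can be rearranged so that a partial product leaves \<open>X\<close>.\<close>

lemma rmul_collect:
  assumes H: "grading H"
    and low: "\<And>n b. n \<ge> c \<Longrightarrow> lower H n b \<subseteq> hspan ((derived ^^ k) H)"
    and "m \<in> hspan ((derived ^^ k) H)" "set ts \<subseteq> triples H" "weight ts > (card X - 1) * c"
  shows "rmul m ts \<in> hspan ((derived ^^ Suc k) H)"
  using assms(3-5)
proof (induction "length ts" arbitrary: m ts rule: less_induct)
  case less
  let ?M = "(derived ^^ k) H" let ?I = "hspan ((derived ^^ Suc k) H)"
  have I: "subgrp ?I" by (rule subgrp_hspan)
  show ?case
  proof (cases "\<exists>t\<in>set ts. fst t \<ge> c")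
    case True
    then obtain as t bs where ts: "ts = as @ t # bs" and t: "fst t \<ge> c" by (metis split_list)
    have "rmul m as \<in> hspan ?M" using rmul_ideal[OF H] less.prems ts by auto
    moreover have "snd (snd t) \<in> hspan ?M"
      using low[OF t, of "fst (snd t)"] less.prems ts by (auto simp: triples_def split_beta)
    ultimately have "br (rmul m as) (snd (snd t)) \<in> ?I" by (auto intro: hspan_br_hspan)
    then show ?thesis using rmul_ideal[OF H, of _ "Suc k" bs] less.prems ts by simp
  next
    case False
    \<comment> \<open>Now every factor has weight at most \<open>c\<close>, so the total weight
      forces at least \<open>card X\<close> factors.\<close>
    then have "weight ts \<le> length ts * c" by (intro weight_le) (auto simp: not_le Suc_le_eq)
    then have "(card X - 1) * c < length ts * c" using less.prems by linarith
    then have len: "card X \<le> length ts" by (auto simp: mult_less_cancel2)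
    have hom: "rmul m ts \<in> ?I" if m: "m \<in> ?M a" for m a
    proof (cases "a \<in> X \<and> (\<forall>t\<in>set ts. fst (snd t) \<in> X)")
      case False
      then consider "a \<notin> X" | t where "t \<in> set ts" "fst (snd t) \<notin> X" by blast
      then have "rmul m ts = 0"
      proof cases
        case 1
        then have "m = 0" using grading_outside[OF grading_derived_funpow[OF H]] m by blast
        then show ?thesis by (simp add: rmul_zero)
      next
        case 2
        then have "snd (snd t) \<in> H (fst (snd t))"
          using less.prems lower_subset[OF H] by (auto simp: triples_def)
        then show ?thesis using 2 grading_outside[OF H] by (intro rmul_zero_mem[of t]) auto
      qed
      then show ?thesis using subgrp_zero[OF I] by simp
    next
      case True
      let ?f = "\<lambda>t::nat \<times> 'g \<times> 'b. fst (snd t)"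
      have "\<exists>N. N \<subseteq># mset ts \<and> a * prod_mset (image_mset ?f N) \<notin> X"
      proof (rule ccontr)
        assume "\<not> ?thesis"
        then have *: "a * prod_mset (image_mset ?f N) \<in> X" if "N \<subseteq># mset ts" for N
          using that by blast
        have "size (mset ts) < card {a * prod_mset (image_mset ?f N) |N. N \<subseteq># mset ts}"
          using True * by (intro subset_products_card) auto
        also have "\<dots> \<le> card X" using * finite_X by (intro card_mono) auto
        finally show False using len by simp
      qed
      then obtain N where N: "N \<subseteq># mset ts" "a * prod_mset (image_mset ?f N) \<notin> X" by blast
      obtain as where as: "mset as = N" using ex_mset by blast
      obtain bs where bs: "mset bs = mset ts - N" using ex_mset by blast
      have ms: "mset ts = mset (as @ bs)" using as bs N by simp
      then have "set as \<subseteq> triples H" using less.prems by (metis Un_subset_iff set_append set_mset_mset)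
      from rmul_degree[OF H _ this, of m a] have "rmul m as \<in> H (a * prod_mset (image_mset ?f N))"
        using m derived_funpow_subset[OF H] as by blast
      then have "rmul m as = 0" using grading_outside[OF H N(2)] by blast
      then have "rmul m (as @ bs) \<in> ?I" using subgrp_zero[OF I] by (simp add: rmul_zero)
      moreover have "rmul m (as @ comb p q # bs) \<in> ?I" if *: "mset (as @ p # q # bs) = mset ts" for as p q bs
      proof (rule less.hyps)
        have st: "set (as @ p # q # bs) = set ts" using * by (rule mset_eq_setD)
        show "length (as @ comb p q # bs) < length ts"
          using mset_eq_length[OF *] by simp
        show "m \<in> hspan ?M" using m by (rule hspanI)
        show "set (as @ comb p q # bs) \<subseteq> triples H"
          using st less.prems comb_triples[OF H, of p q] by auto
        have "weight (as @ comb p q # bs) = weight (as @ p # q # bs)"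
          by (simp add: weight_def comb_def)
        also have "\<dots> = weight ts"
          using * by (simp only: weight_mset)
        finally show "weight (as @ comb p q # bs) > (card X - 1) * c" using less.prems by simp
      qed
      ultimately show ?thesis using rmul_perm[OF I ms, of m] by blast
    qed
    have "hspan ?M \<subseteq> {m. rmul m ts \<in> ?I}"
      unfolding hspan_def[of ?M]
      by (intro add_span_minimal subgrp_vimage I rmul_add) (use hom in blast)
    then show ?thesis using less.prems by auto
  qed
qed

lemma lower_subset_derived:
  assumes H: "grading H" and X: "X \<noteq> {}"
  shows "n \<ge> class_bound (card X) k \<Longrightarrow> lower H n b \<subseteq> hspan ((derived ^^ k) H)"
proof (induction k arbitrary: n b)
  case 0
  then show ?case using lower_subset[OF H] by (auto intro: hspanI)
next
  case (Suc k)
  let ?c = "class_bound (card X) k" let ?I = "hspan ((derived ^^ Suc k) H)"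
  \<comment> \<open>The least weight that \<open>rmul_collect\<close> accepts.\<close>
  define N where "N = (card X - 1) * ?c + 1"
  \<comment> \<open>The last \<open>j\<close> factors of \<open>v\<close> are peeled off one at a
    time and prepended to \<open>ts\<close> as triples of weight one, until the remaining head lies
    in the \<open>?c\<close>-th term and hence in the \<open>k\<close>-th derived ring.\<close>
  have *: "rmul v ts \<in> ?I"
    if "v \<in> lower H (?c + j) b" "set ts \<subseteq> triples H" "weight ts + j \<ge> N" for v b ts j
    using that
  proof (induction j arbitrary: v b ts)
    case 0
    then show ?case using Suc.IH unfolding N_def by (intro rmul_collect[OF H]) auto
  next
    case (Suc j)
    have "lower H (Suc (?c + j)) b \<subseteq> {v. rmul v ts \<in> ?I}"
    proof (rule lower_Suc_minimal)
      show "subgrp {v. rmul v ts \<in> ?I}" by (intro subgrp_vimage subgrp_hspan rmul_add)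
      fix u x i j' assume a: "u \<in> lower H (?c + j) i" "x \<in> H j'"
      have "rmul u ((0, j', x) # ts) \<in> ?I"
        using a Suc.prems by (intro Suc.IH[of _ i]) (auto simp: triples_def weight_def)
      then show "br u x \<in> {v. rmul v ts \<in> ?I}" by simp
    qed
    then show ?case using Suc.prems by auto
  qed
  have "card X \<ge> 1" using X finite_X by (simp add: Suc_leI card_gt_0_iff)
  then have "?c + N = class_bound (card X) (Suc k)"
    unfolding N_def by (cases "card X") auto
  then have "lower H n b \<subseteq> lower H (?c + N) b"
    using Suc.prems by (intro lower_antimono[OF H]) simp
  also have "\<dots> \<subseteq> ?I" using *[of _ N b "[]"] by (auto simp: weight_def)
  finally show ?case .
qed

theorem lower_trivial:
  assumes "grading H" "X \<noteq> {}" "n \<ge> class_bound (card X) (2 ^ card X - 1)"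
  shows "lower H n b = {0}"
proof -
  have "hspan ((derived ^^ (2 ^ card X - 1)) H) \<subseteq> {0}"
    unfolding hspan_def derived_trivial[OF assms(1)]
    by (rule add_span_minimal[OF subgrp_singleton_zero]) auto
  then show ?thesis
    using lower_subset_derived[OF assms] subgrp_zero[OF subgrp_lower[OF assms(1)]] by blast
qed

end

section \<open>Roots of good polynomials\<close>

text \<open>The key of \<open>z\<close> is its representative strictly between \<open>[0, 0]\<close> and \<open>[2 * pi, 0]\<close> in
  the lexicographically ordered group of pairs \<open>[arg, ln norm]\<close>, the universal cover of the
  punctured plane; lists stand for pairs because the product type is ordered componentwise.\<close>

definition key_arg :: "complex \<Rightarrow> real" where
  "key_arg z = (if Arg2pi z = 0 \<and> norm z < 1 then 2 * pi else Arg2pi z)"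

definition circle_key :: "complex \<Rightarrow> real list" where
  "circle_key z = [key_arg z, ln (norm z)]"

lemma circle_key_less:
  "circle_key u < circle_key v \<longleftrightarrow>
    key_arg u < key_arg v \<or> key_arg u = key_arg v \<and> ln (norm u) < ln (norm v)"
  by (simp add: circle_key_def)

text \<open>The circle is cut open at 1, which is therefore the one nonzero number without a key
  strictly inside the interval.\<close>

lemma key_arg_bounds:
  assumes "z \<noteq> 0" "z \<noteq> 1"
  shows "0 < key_arg z \<or> key_arg z = 0 \<and> 0 < ln (norm z)"
    and "key_arg z < 2 * pi \<or> key_arg z = 2 * pi \<and> ln (norm z) < 0"
proof -
  have *: "norm z \<noteq> 1" if "Arg2pi z = 0"
  proof
    assume "norm z = 1"
    then have "z = 1" using Arg2pi_eq[of z] that by simp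
    then show False using assms by simp
  qed
  have "Arg2pi z \<ge> 0" "Arg2pi z < 2 * pi" by (auto simp: Arg2pi_ge_0 Arg2pi_lt_2pi)
  then show "0 < key_arg z \<or> key_arg z = 0 \<and> 0 < ln (norm z)"
    and "key_arg z < 2 * pi \<or> key_arg z = 2 * pi \<and> ln (norm z) < 0"
    using * assms ln_less_zero[of "norm z"] ln_gt_zero[of "norm z"]
    unfolding key_arg_def zero_less_norm_iff[symmetric] by (smt (verit))+
qed

lemma key_arg_exp:
  assumes "z \<noteq> 0"
  shows "z = of_real (exp (ln (norm z))) * exp (\<i> * of_real (key_arg z))"
  using Arg2pi_eq[of z] assms exp_two_pi_i by (auto simp: key_arg_def mult_ac)

lemma inj_on_circle_key: "inj_on circle_key (- {0})"
  by (rule inj_onI) (metis Compl_iff circle_key_def key_arg_exp list.inject singletonI)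

text \<open>Keys add up to a multiple of the period \<open>[2 * pi, 0]\<close>. Both keys lie
  strictly between zero and the period, so the key of the product is either the plain sum, above
  both, or the sum minus one period, below both.\<close>

lemma circle_key_mult:
  assumes "x \<noteq> 0" "x \<noteq> 1" "y \<noteq> 0" "y \<noteq> 1" "x * y \<noteq> 1"
  shows "(circle_key (x * y) < circle_key x \<and> circle_key (x * y) < circle_key y) \<or>
    (circle_key x < circle_key (x * y) \<and> circle_key y < circle_key (x * y))"
proof -
  define p q t where "p = key_arg x" and "q = key_arg y" and "t = key_arg (x * y)"
  define l m n where "l = ln (norm x)" and "m = ln (norm y)" and "n = ln (norm (x * y))"
  note defs = p_def q_def t_def l_def m_def n_def
  have xy: "x * y \<noteq> 0" using assms by simp
  have n: "n = l + m" using assms by (simp add: defs norm_mult ln_mult)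
  have "x * y = (of_real (exp l) * exp (\<i> * of_real p)) * (of_real (exp m) * exp (\<i> * of_real q))"
    using key_arg_exp[of x] key_arg_exp[of y] assms unfolding defs by simp
  also have "\<dots> = of_real (exp n) * exp (\<i> * of_real (p + q))"
    by (simp add: n exp_add ring_distribs)
  finally have "of_real (exp n) * exp (\<i> * of_real t) = of_real (exp n) * exp (\<i> * of_real (p + q))"
    using key_arg_exp[OF xy] unfolding defs by simp
  then have "exp (\<i> * of_real t) = exp (\<i> * of_real (p + q))" by simp
  then obtain k :: int where "\<i> * of_real t = \<i> * of_real (p + q) + of_int (2 * k) * (pi * \<i>)"
    by (auto simp: exp_eq)
  then have k: "t = p + q + real_of_int k * (2 * pi)"
    by (simp add: complex_eq_iff)
  have b: "0 < p \<or> p = 0 \<and> 0 < l" "p < 2 * pi \<or> p = 2 * pi \<and> l < 0"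
    "0 < q \<or> q = 0 \<and> 0 < m" "q < 2 * pi \<or> q = 2 * pi \<and> m < 0"
    "0 < t \<or> t = 0 \<and> 0 < n" "t < 2 * pi \<or> t = 2 * pi \<and> n < 0"
    using key_arg_bounds[of x] key_arg_bounds[of y] key_arg_bounds[of "x * y"] assms xy
    unfolding defs by auto
  have "real_of_int k * (2 * pi) < 2 * (2 * pi)" "-3 * (2 * pi) < real_of_int k * (2 * pi)"
    using k b pi_gt_zero by linarith+
  then have "real_of_int k < 2" "real_of_int k > -3"
    using pi_gt_zero by (simp_all only: mult_less_cancel_right)
  then have "k = 1 \<or> k = 0 \<or> k = -1 \<or> k = -2" by linarith
  \<comment> \<open>The outer two cases are impossible: they would force \<open>p = q = 0\<close>,
    \<open>t = 2 * pi\<close> or \<open>p = q = 2 * pi\<close>, \<open>t = 0\<close>, and then the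
    signs of the logarithms contradict \<open>n = l + m\<close>.\<close>
  then have "t = p + q + 2 * pi \<or> t = p + q \<or> t = p + q - 2 * pi \<or> t = p + q - 4 * pi"
    using k by auto
  then show ?thesis
    unfolding circle_key_less defs[symmetric] using b n by argo
qed

section \<open>Integer polynomials: primitive divisors and residue parts\<close>

lemma poly_of_int_pCons: "poly (map_poly of_int (pCons c p)) x = of_int c + x * poly (map_poly of_int p) (x::complex)"
  by (simp add: map_poly_pCons)

lemma poly_of_int_add: "poly (map_poly of_int (p + q)) (x::complex) = poly (map_poly of_int p) x + poly (map_poly of_int q) x"
  by (induction p q rule: poly_induct2) (simp_all add: poly_of_int_pCons algebra_simps)

lemma poly_of_int_smult: "poly (map_poly of_int (smult c p)) (x::complex) = of_int c * poly (map_poly of_int p) x"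
  by (induction p) (simp_all add: poly_of_int_pCons algebra_simps)

lemma poly_of_int_mult: "poly (map_poly of_int (p * q)) (x::complex) = poly (map_poly of_int p) x * poly (map_poly of_int q) x"
  by (induction p) (simp_all add: poly_of_int_pCons poly_of_int_add poly_of_int_smult algebra_simps)

lemma poly_of_int_of_int: "poly (map_poly of_int p) (of_int c :: complex) = of_int (poly p c)"
  by (induction p) (simp_all add: poly_of_int_pCons)

text \<open>Gauss's lemma: contents multiply, so the constant \<open>a\<close> divides the content
  of \<open>q\<close> and can be cancelled.\<close>

lemma primitive_dvd_of_dvd_smult:
  fixes f g q :: "int poly"
  assumes "Polynomial.content g = 1" "a \<noteq> 0" "smult a f = g * q"
  shows "g dvd f"
proof -
  have "Polynomial.content q = normalize a * Polynomial.content f"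
    using arg_cong[OF assms(3), of Polynomial.content] assms(1) by (simp add: content_mult)
  then have "a dvd Polynomial.content q" by simp
  then have "[:a:] dvd q" by (simp add: const_poly_dvd_iff_dvd_content)
  then obtain q' where "q = smult a q'" by (elim dvdE) simp
  then have "smult a f = smult a (g * q')" using assms by simp
  then have "f = g * q'" using assms(2) by (simp add: smult_cancel)
  then show ?thesis by simp
qed

text \<open>Badness asks for divisibility over the integers, so the minimal polynomial is made
  primitive. Pseudo-division leaves a remainder of smaller degree vanishing at \<open>z\<close>,
  hence zero, and Gauss's lemma disposes of the multiplier.\<close>

lemma exists_primitive_minimal_poly:
  fixes z :: complex and p :: "int poly"
  assumes "p \<noteq> 0" "poly (map_poly of_int p) z = 0"
  obtains s where "degree s > 0" "\<And>q. poly (map_poly of_int q) z = 0 \<Longrightarrow> s dvd q"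
proof -
  define P where "P n \<longleftrightarrow> (\<exists>q. q \<noteq> 0 \<and> poly (map_poly of_int q) z = 0 \<and> degree q = n)" for n
  have "P (degree p)" unfolding P_def using assms by blast
  then have "P (LEAST n. P n)" by (rule LeastI)
  then obtain q0 where q0: "q0 \<noteq> 0" "poly (map_poly of_int q0) z = 0" "degree q0 = (LEAST n. P n)"
    unfolding P_def by blast
  define s where "s = primitive_part q0"
  have "poly (map_poly of_int q0) z = of_int (Polynomial.content q0) * poly (map_poly of_int s) z"
    unfolding s_def by (simp flip: poly_of_int_smult)
  then have s0: "poly (map_poly of_int s) z = 0" using q0 by simp
  have s: "Polynomial.content s = 1" "s \<noteq> 0" "degree s = (LEAST n. P n)"
    using q0 unfolding s_def by simp_all
  have "degree s > 0"
  proof (rule ccontr)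
    assume "\<not> ?thesis"
    then obtain c where c: "s = [:c:]" by (auto elim: degree_eq_zeroE)
    then show False using s0 s(2) by (simp add: poly_of_int_pCons)
  qed
  moreover have "s dvd q" if "poly (map_poly of_int q) z = 0" for q
  proof -
    define m where "m = pseudo_mod q s"
    obtain a t where at: "a \<noteq> 0" "smult a q = s * t + m" and m: "m = 0 \<or> degree m < degree s"
      using pseudo_mod[OF s(2), of q] unfolding m_def by blast
    have "poly (map_poly of_int m) z = 0"
      using arg_cong[OF at(2), of "\<lambda>p. poly (map_poly of_int p) z"] that s0
      by (simp add: poly_of_int_add poly_of_int_mult poly_of_int_smult)
    then have "m = 0" using m not_less_Least[of "degree m" P] s(3) unfolding P_def by auto
    then show ?thesis using primitive_dvd_of_dvd_smult[OF s(1) at(1)] at(2) by simp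
  qed
  ultimately show ?thesis using that by blast
qed

text \<open>The exponents are sorted by their residue modulo \<open>n\<close>; entries of
  \<open>c j\<close> beyond the degree of \<open>r\<close> are zero, so the generous list length is
  harmless.\<close>

lemma poly_residue_decomposition:
  fixes r :: "int poly" and n :: nat
  assumes n: "n > 0"
  defines "c \<equiv> \<lambda>j. Poly (map (\<lambda>i. coeff r (i * n + j)) [0..<Suc (degree r)])"
  shows "r = (\<Sum>j<n. monom 1 j * pcompose (c j) (monom 1 n))"
proof (rule poly_eqI)
  fix k
  have co: "coeff (c j) i = coeff r (i * n + j)" for i j
  proof (cases "i \<le> degree r")
    case True
    then show ?thesis unfolding c_def coeff_Poly_eq nth_default_def by (simp del: upt_Suc)
  next
    case False
    moreover have "i * n + j \<ge> i" using n by (simp add: trans_le_add1)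
    ultimately have "coeff r (i * n + j) = 0" by (intro coeff_eq_0) linarith
    then show ?thesis unfolding c_def coeff_Poly_eq nth_default_def using False by (simp del: upt_Suc)
  qed
  have pc: "coeff (pcompose p (monom 1 n)) k = (if n dvd k then coeff p (k div n) else 0)" for p :: "int poly" and k
  proof (induction p arbitrary: k)
    case (pCons a p)
    then show ?case
      using n by (auto simp: pcompose_pCons coeff_monom_mult coeff_pCons le_div_geq dvd_minus_self not_less div_eq_0_iff split: nat.splits dest: dvd_imp_le)
  qed simp
  have "coeff (\<Sum>j<n. monom 1 j * pcompose (c j) (monom 1 n)) k
     = (\<Sum>j<n. if j \<le> k \<and> n dvd (k - j) then coeff r ((k - j) div n * n + j) else 0)"
    unfolding coeff_sum by (rule sum.cong) (auto simp: coeff_monom_mult pc co)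
  also have "\<dots> = (\<Sum>j<n. if j = k mod n then coeff r k else 0)"
  proof (rule sum.cong, rule refl)
    fix j assume "j \<in> {..<n}"
    then have "j \<le> k \<and> n dvd (k - j) \<longleftrightarrow> j = k mod n"
      by (metis dvd_minus_mod lessThan_iff mod_less mod_less_eq_dividend mod_eq_dvd_iff_nat)
    then show "(if j \<le> k \<and> n dvd (k - j) then coeff r ((k - j) div n * n + j) else 0) =
       (if j = k mod n then coeff r k else 0)"
      by (auto simp: dvd_div_mult_self)
  qed
  also have "\<dots> = coeff r k" using n by simp
  finally show "coeff r k = coeff (\<Sum>j<n. monom 1 j * pcompose (c j) (monom 1 n)) k" by simp
qed

lemma poly_of_int_pcompose:
  "poly (map_poly of_int (pcompose p q)) (x::complex) = poly (map_poly of_int p) (poly (map_poly of_int q) x)"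
  by (induction p) (simp_all add: pcompose_pCons poly_of_int_add poly_of_int_mult poly_of_int_pCons)

text \<open>If \<open>r\<close> vanished at 0 or 1, the polynomial to be divided would be zero, and
  \<open>s = t\<close> with \<open>u = 1\<close> would witness badness.\<close>

lemma good_poly_nonzero:
  assumes "good_poly r" shows "poly r 0 \<noteq> 0" "poly r 1 \<noteq> 0" "r \<noteq> 0"
proof -
  have "poly r 0 * poly r 1 \<noteq> 0"
  proof
    assume "poly r 0 * poly r 1 = 0"
    then have "smult (poly r 0 * poly r 1) r = 0" by (simp only: smult_0_left)
    then have "bad_poly r" unfolding bad_poly_def
      by (intro exI[of _ "1::nat"] exI[of _ "[:0, 1:]::int poly"]) (simp only: dvd_0_right, simp)
    then show False using assms by (simp add: good_poly_def)
  qed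
  then show "poly r 0 \<noteq> 0" "poly r 1 \<noteq> 0" "r \<noteq> 0" by auto
qed

text \<open>If all \<open>x * y ^ k\<close> are roots, then \<open>y\<close> is a root of unity, of order \<open>n\<close> say.  Summing over its
  powers shows that each of the \<open>n\<close> residue parts of \<open>r\<close> vanishes at \<open>x ^ n\<close>, so they
  have a common factor \<open>s\<close> and \<open>s(t ^ n)\<close> divides \<open>r\<close>.\<close>

lemma good_poly_roots_arith_free:
  fixes x y :: complex
  assumes good: "good_poly r" and x: "poly (map_poly of_int r) x = 0"
    and y: "poly (map_poly of_int r) y = 0"
  shows "\<exists>k::nat. poly (map_poly of_int r) (x * y ^ k) \<noteq> 0"
proof (rule ccontr)
  let ?p = "map_poly of_int r :: complex poly"
  assume "\<not> ?thesis"
  then have all: "poly ?p (x * y ^ k) = 0" for k by blast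
  note nz = good_poly_nonzero[OF good]
  have p0: "?p \<noteq> 0" using nz(3) by (simp add: map_poly_eq_0_iff)
  have px: "poly ?p 0 = of_int (poly r 0)" "poly ?p 1 = of_int (poly r 1)"
    using poly_of_int_of_int[of r 0] poly_of_int_of_int[of r 1] by simp_all
  have x0: "x \<noteq> 0" and y1: "y \<noteq> 1" and y0: "y \<noteq> 0" using x y px nz by auto
  have "\<not> inj (\<lambda>k. x * y ^ k)"
  proof
    assume "inj (\<lambda>k. x * y ^ k)"
    then have "infinite (range (\<lambda>k. x * y ^ k))" by (rule range_inj_infinite)
    moreover have "range (\<lambda>k. x * y ^ k) \<subseteq> {z. poly ?p z = 0}" using all by auto
    ultimately show False using poly_roots_finite[OF p0] finite_subset by blast
  qed
  then obtain i j where "i < j" "x * y ^ i = x * y ^ j"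
    unfolding inj_on_def by (metis linorder_neqE_nat)
  then have ij: "y ^ i = y ^ j" "i < j" using x0 by auto
  have "y ^ (j - i) = 1" using ij y0 by (simp add: power_diff)
  then have ex: "\<exists>n. 0 < n \<and> y ^ n = 1" using ij by (intro exI[of _ "j - i"]) simp
  define n where "n = (LEAST n. 0 < n \<and> y ^ n = 1)"
  have n: "0 < n" "y ^ n = 1" using LeastI_ex[OF ex] unfolding n_def by auto
  have nmin: "y ^ m \<noteq> 1" if "0 < m" "m < n" for m
    using not_less_Least[of m "\<lambda>n. 0 < n \<and> y ^ n = 1"] that unfolding n_def by blast
  have "n \<noteq> 1" using n y1 by auto
  define c where "c = (\<lambda>j. Poly (map (\<lambda>i. coeff r (i * n + j)) [0..<Suc (degree r)]))"
  have r: "r = (\<Sum>j<n. monom 1 j * pcompose (c j) (monom 1 n))"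
    unfolding c_def by (rule poly_residue_decomposition[OF n(1)])
  have pm: "poly (map_poly of_int (monom 1 m)) z = z ^ m" for z :: complex and m
    by (simp add: map_poly_monom poly_monom)
  define C where "C j = poly (map_poly of_int (c j)) (x ^ n)" for j
  have psum: "poly (map_poly of_int (\<Sum>j\<in>J. f j)) (z::complex) = (\<Sum>j\<in>J. poly (map_poly of_int (f j)) z)"
    if "finite J" for f :: "nat \<Rightarrow> int poly" and J z
    using that by (induction J rule: finite_induct) (simp_all add: poly_of_int_add)
  have val: "0 = (\<Sum>j<n. x ^ j * C j * y ^ (k * j))" for k
  proof -
    have "(y ^ k) ^ n = 1" by (metis mult.commute n(2) power_mult power_one)
    then have e: "(x * y ^ k) ^ n = x ^ n" by (simp only: power_mult_distrib mult_1_right)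
    have "poly ?p (x * y ^ k) = (\<Sum>j<n. (x * y ^ k) ^ j * poly (map_poly of_int (c j)) ((x * y ^ k) ^ n))"
      by (subst r, subst psum) (simp_all add: poly_of_int_mult pm poly_of_int_pcompose)
    also have "\<dots> = (\<Sum>j<n. (x * y ^ k) ^ j * C j)" by (simp only: e C_def)
    also have "\<dots> = (\<Sum>j<n. x ^ j * C j * y ^ (k * j))"
      by (rule sum.cong) (simp_all add: power_mult_distrib power_mult)
    finally show ?thesis using all[of k] by simp
  qed
  have C0: "C l = 0" if l: "l < n" for l
  proof -
    \<comment> \<open>Orthogonality of the characters of the cyclic group of order \<open>n\<close>,
      that is, Fourier inversion; \<open>n - l\<close> replaces the exponent
      \<open>-l\<close>.\<close>
    have orth: "(\<Sum>k<n. y ^ (k * j) * y ^ (k * (n - l))) = (if j = l then of_nat n else 0)" if "j < n" for j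
    proof -
      let ?w = "y ^ (j + (n - l))"
      have "(\<Sum>k<n. y ^ (k * j) * y ^ (k * (n - l))) = (\<Sum>k<n. ?w ^ k)"
        by (rule sum.cong) (simp_all add: algebra_simps flip: power_add power_mult)
      moreover have "?w = 1 \<longleftrightarrow> j = l"
      proof (cases "l \<le> j")
        case True
        then have "j + (n - l) = n + (j - l)" using l by simp
        then have "?w = y ^ (j - l)" by (simp add: power_add n(2))
        then show ?thesis using nmin[of "j - l"] True that by (cases "j = l") auto
      next
        case False
        then show ?thesis using nmin[of "j + (n - l)"] l by auto
      qed
      moreover have "?w ^ n = 1" by (metis mult.commute n(2) power_mult power_one)
      ultimately show ?thesis by (cases "j = l") (simp_all add: geometric_sum)
    qed
    have "0 = (\<Sum>k<n. (\<Sum>j<n. x ^ j * C j * y ^ (k * j)) * y ^ (k * (n - l)))"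
      using val by simp
    also have "\<dots> = (\<Sum>j<n. \<Sum>k<n. x ^ j * C j * (y ^ (k * j) * y ^ (k * (n - l))))"
      unfolding sum_distrib_right by (subst sum.swap) (simp add: mult_ac)
    also have "\<dots> = (\<Sum>j<n. x ^ j * C j * (if j = l then of_nat n else 0))"
      by (rule sum.cong) (simp_all add: orth flip: sum_distrib_left)
    also have "\<dots> = x ^ l * C l * of_nat n"
      using l by (simp add: if_distrib[of "\<lambda>z. _ * z"] cong: if_cong)
    finally show ?thesis using x0 n(1) by simp
  qed
  \<comment> \<open>A nonzero residue part certifies that \<open>x ^ n\<close> is algebraic, so that
    it has a minimal polynomial.\<close>
  obtain l where l: "l < n" "c l \<noteq> 0"
  proof -
    have "\<exists>l<n. c l \<noteq> 0"
    proof (rule ccontr)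
      assume "\<not> ?thesis"
      then have "r = 0" by (subst r) (simp add: sum.neutral)
      then show False using nz by simp
    qed
    then show ?thesis using that by blast
  qed
  obtain s where s: "degree s > 0" "\<And>q. poly (map_poly of_int q) (x ^ n) = 0 \<Longrightarrow> s dvd q"
    using exists_primitive_minimal_poly[OF l(2), of "x ^ n"] C0[OF l(1)] unfolding C_def by blast
  have "pcompose s (monom 1 n) dvd r"
  proof (subst r, rule dvd_sum)
    fix j assume "j \<in> {..<n}"
    then have "s dvd c j" using s(2) C0[of j] unfolding C_def by simp
    then obtain q where "c j = s * q" by (elim dvdE)
    then show "pcompose s (monom 1 n) dvd monom 1 j * pcompose (c j) (monom 1 n)"
      by (simp add: pcompose_mult)
  qed
  then have "pcompose s (monom 1 (n - 1 + 1)) dvd smult (poly r 0 * poly r 1) r"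
    using n(1) by (simp add: dvd_smult)
  \<comment> \<open>Badness demands \<open>u = n - 1 \<ge> 1\<close>; it holds because
    \<open>y \<noteq> 1\<close>, as \<open>r\<close> does not vanish at 1.\<close>
  moreover have "n - 1 \<ge> 1" using n(1) \<open>n \<noteq> 1\<close> by linarith
  ultimately have "bad_poly r" unfolding bad_poly_def using s(1) by blast
  then show False using good by (simp add: good_poly_def)
qed

section \<open>Rationality of symmetric products of roots\<close>

abbreviation cpoly :: "rat poly \<Rightarrow> complex poly" where
  "cpoly \<equiv> map_poly of_rat"

lemma cpoly_add: "cpoly (p + q) = cpoly p + cpoly q"
  by (rule poly_eqI) (simp add: coeff_map_poly of_rat_add)

lemma cpoly_mult: "cpoly (p * q) = cpoly p * cpoly q"
  by (rule poly_eqI) (simp add: coeff_map_poly coeff_mult of_rat_sum of_rat_mult)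

lemma cpoly_pderiv: "cpoly (pderiv p) = pderiv (cpoly p)"
  by (rule poly_eqI) (simp add: coeff_map_poly coeff_pderiv of_rat_mult of_rat_add)

lemma cpoly_const: "cpoly [:c:] = [:of_rat c:]"
  by (rule poly_eqI) (simp add: coeff_map_poly coeff_pCons split: nat.splits)

lemma cpoly_linear: "cpoly [:c, d:] = [:of_rat c, of_rat d:]"
  by (rule poly_eqI) (simp add: coeff_map_poly coeff_pCons split: nat.splits)

lemma degree_cpoly: "degree (cpoly p) = degree p"
  by (rule degree_map_poly) simp

lemma cpoly_eq_0_iff: "cpoly p = 0 \<longleftrightarrow> p = 0"
  by (simp add: map_poly_eq_0_iff)

lemma poly_cpoly_rat: "poly (cpoly p) (of_rat x) = of_rat (poly p x)"
  by (induction p) (simp_all add: map_poly_pCons of_rat_add of_rat_mult)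

lemma poly_eq_prod_proots:
  "poly p x = lead_coeff p * (\<Prod>z\<in>#proots p. x - z)" for p :: "complex poly"
proof -
  have "poly p x = poly (smult (lead_coeff p) (\<Prod>z\<in>#proots p. [:-z, 1:])) x"
    by (simp only: complex_poly_decompose_multiset)
  then show ?thesis by (simp add: poly_prod_mset)
qed

text \<open>The product is a resultant; it is rational because the Euclidean algorithm computes it:
  replace \<open>h\<close> by \<open>h mod f\<close> and exchange the roles of the two polynomials.\<close>

lemma prod_proots_rational:
  fixes f h :: "rat poly"
  assumes "f \<noteq> 0"
  shows "(\<Prod>x\<in>#proots (cpoly f). poly (cpoly h) x) \<in> \<rat>"
  using assms
proof (induction "degree f" arbitrary: f h rule: less_induct)
  case less
  define g where "g = h mod f"
  let ?F = "cpoly f" let ?G = "cpoly g"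
  have F0: "?F \<noteq> 0" using less.prems by (simp add: cpoly_eq_0_iff)
  have "h = h div f * f + g" by (simp add: g_def)
  then have h: "cpoly h = cpoly (h div f) * ?F + ?G" by (metis cpoly_add cpoly_mult)
  have "(\<Prod>x\<in>#proots ?F. poly (cpoly h) x) = (\<Prod>x\<in>#proots ?F. poly ?G x)"
    using F0 by (intro arg_cong[of _ _ prod_mset] image_mset_cong) (simp add: h)
  also have "\<dots> \<in> \<rat>"
  proof (cases "g = 0 \<or> degree f = 0")
    case True
    then show ?thesis
      using size_proots_complex[of ?F] by (auto simp: degree_cpoly)
  next
    case False
    then have deg: "degree g < degree f" unfolding g_def using less.prems degree_mod_less by blast
    define A B where "A = proots ?F" and "B = proots ?G"
    have neg: "(\<Prod>x\<in>#A. x - z) = (-1) ^ size A / lead_coeff ?F * poly ?F z" for z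
    proof -
      have "(\<Prod>x\<in>#A. x - z) = (\<Prod>x\<in>#A. (-1) * (z - x))" by simp
      also have "\<dots> = (-1) ^ size A * (\<Prod>x\<in>#A. z - x)"
        by (simp only: prod_mset.distrib prod_mset_constant)
      also have "\<dots> = (-1) ^ size A / lead_coeff ?F * poly ?F z"
        using F0 by (simp add: A_def poly_eq_prod_proots[of ?F z])
      finally show ?thesis .
    qed
    have "(\<Prod>x\<in>#A. poly ?G x) = (\<Prod>x\<in>#A. lead_coeff ?G * (\<Prod>z\<in>#B. x - z))"
      unfolding B_def by (simp only: poly_eq_prod_proots)
    also have "\<dots> = lead_coeff ?G ^ size A * (\<Prod>x\<in>#A. \<Prod>z\<in>#B. x - z)"
      by (simp only: prod_mset.distrib prod_mset_constant)
    also have "(\<Prod>x\<in>#A. \<Prod>z\<in>#B. x - z) = (\<Prod>z\<in>#B. \<Prod>x\<in>#A. x - z)"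
      by (rule prod_mset.swap)
    also have "\<dots> = ((-1) ^ size A / lead_coeff ?F) ^ size B * (\<Prod>z\<in>#B. poly ?F z)"
      by (simp only: neg prod_mset.distrib prod_mset_constant)
    also have "lead_coeff ?G ^ size A * \<dots> \<in> \<rat>"
      unfolding B_def using False
      by (intro Rats_mult Rats_power Rats_divide less.hyps[OF deg])
         (auto simp: coeff_map_poly degree_cpoly)
    finally show ?thesis by (simp add: A_def)
  qed
  finally show ?case .
qed

text \<open>Newton interpolation, one node at a time. The quotient of \<open>p - p(c)\<close> by
  \<open>X - c\<close> is known to be rational at rational points only away from \<open>c\<close>,
  which is why a finite exceptional set \<open>S\<close> is carried along.\<close>

lemma cpoly_of_rational_values:
  fixes p :: "complex poly"
  assumes "finite S" "\<And>x. x \<in> \<rat> \<Longrightarrow> x \<notin> S \<Longrightarrow> poly p x \<in> \<rat>"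
  shows "\<exists>q. p = cpoly q"
  using assms
proof (induction "degree p" arbitrary: p S rule: less_induct)
  case less
  have "infinite (range (of_nat :: nat \<Rightarrow> complex))"
    by (rule range_inj_infinite) (simp add: inj_on_def)
  then obtain n where n: "(of_nat n :: complex) \<notin> S"
    using less.prems(1) by (meson finite_subset image_subsetI)
  define c where "c = (of_nat n :: complex)"
  have pc: "poly p c \<in> \<rat>" using n less.prems(2) unfolding c_def by simp
  then obtain e where e: "poly p c = of_rat e" by (auto elim: Rats_cases)
  show ?case
  proof (cases "degree p = 0")
    case True
    then have "p = cpoly [:e:]" using e by (auto simp: cpoly_const elim: degree_eq_zeroE)
    then show ?thesis by blast
  next
    case False
    define s where "s = synthetic_div p c"
    have p: "p = [:-c, 1:] * s + [:poly p c:]"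
      unfolding s_def by (rule synthetic_div_correct'[symmetric])
    have "\<exists>q. s = cpoly q"
    proof (rule less.hyps)
      show "degree s < degree p" using False by (simp add: s_def degree_synthetic_div)
      show "finite (insert c S)" using less.prems(1) by simp
      fix x :: complex assume x: "x \<in> \<rat>" "x \<notin> insert c S"
      have "poly p x = (x - c) * poly s x + poly p c"
        by (subst p) (simp add: algebra_simps)
      then have "poly s x = (poly p x - poly p c) / (x - c)" using x by (simp add: field_simps)
      then show "poly s x \<in> \<rat>" using x pc less.prems(2) by (auto simp: c_def)
    qed
    then obtain q where "s = cpoly q" by blast
    then have "p = cpoly ([:- of_nat n, 1:] * q + [:e:])"
      using p e by (simp only: cpoly_add cpoly_mult cpoly_linear cpoly_const) (simp add: c_def of_rat_minus)
    then show ?thesis by blast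
  qed
qed

text \<open>The products in question run over distinct roots, whereas
  \<open>prod_proots_rational\<close> counts multiplicities. Dividing by the gcd with the derivative
  removes them without leaving the rationals.\<close>

lemma exists_squarefree_part:
  fixes r :: "rat poly"
  assumes "degree r > 0"
  obtains f where "rsquarefree (cpoly f)" "\<And>z. poly (cpoly f) z = 0 \<longleftrightarrow> poly (cpoly r) z = 0"
proof -
  define d where "d = gcd r (pderiv r)"
  obtain u v where uv: "u * r + v * pderiv r = d"
    unfolding d_def using bezout_coefficients_fst_snd by blast
  obtain q where q: "r = q * d" unfolding d_def by (metis dvd_div_mult_self gcd_dvd1)
  obtain e where e: "pderiv r = e * d" unfolding d_def by (metis dvd_div_mult_self gcd_dvd2)
  have "pderiv (cpoly r) \<noteq> 0"
    using assms by (simp add: pderiv_eq_0_iff degree_cpoly)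
  then have "rsquarefree (cpoly q) \<and> (\<forall>z. poly (cpoly q) z = 0 \<longleftrightarrow> poly (cpoly r) z = 0)"
  proof (rule poly_squarefree_decomp)
    show "cpoly r = cpoly q * cpoly d" using q by (metis cpoly_mult)
    show "pderiv (cpoly r) = cpoly e * cpoly d" using e by (metis cpoly_mult cpoly_pderiv)
    show "cpoly d = cpoly u * cpoly r + cpoly v * pderiv (cpoly r)"
      using uv by (metis cpoly_add cpoly_mult cpoly_pderiv)
  qed
  then show ?thesis using that by blast
qed

text \<open>Adding a parameter \<open>e\<close> to every factor turns the product over all pairs into a polynomial in
  \<open>e\<close> with rational values; the factors with \<open>F x y = 0\<close> contribute a power of \<open>e\<close> only.\<close>

lemma prod_pairs_rational:
  fixes f :: "rat poly" and F :: "complex \<Rightarrow> complex \<Rightarrow> complex"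
  assumes sqf: "rsquarefree (cpoly f)"
    and left: "\<And>x. x \<in> \<rat> \<Longrightarrow> \<exists>q. \<forall>y. F x y = poly (cpoly q) y"
    and right: "\<And>y. \<exists>q. \<forall>x. F x y = poly q x"
  defines "R \<equiv> {z. poly (cpoly f) z = 0}"
  shows "(\<Prod>(x, y)\<in>{(x, y). x \<in> R \<and> y \<in> R \<and> F x y \<noteq> 0}. F x y) \<in> \<rat>"
proof -
  have f0: "f \<noteq> 0" using sqf by (auto simp: rsquarefree_def)
  then have F0: "cpoly f \<noteq> 0" by (simp add: cpoly_eq_0_iff)
  have finR: "finite R" unfolding R_def by (rule poly_roots_finite[OF F0])
  have "proots (cpoly f) = mset_set R"
  proof (rule multiset_eqI)
    fix x
    have "order x (cpoly f) = 0 \<or> order x (cpoly f) = 1" using sqf by (auto simp: rsquarefree_def)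
    then show "count (proots (cpoly f)) x = count (mset_set R) x"
      using finR F0 order_root[of "cpoly f" x] by (auto simp: R_def count_mset_set')
  qed
  then have rat: "(\<Prod>x\<in>R. poly (cpoly h) x) \<in> \<rat>" for h
    using prod_proots_rational[OF f0, of h] by (simp add: prod_unfold_prod_mset)
  obtain Q where Q: "F x y = poly (Q y) x" for x y using right by metis
  \<comment> \<open>An iterated resultant: the product over \<open>y\<close> is a polynomial
    \<open>h\<close> in \<open>x\<close>, rational because its values at rational \<open>x\<close>
    are, and then the product over \<open>x\<close> is rational again.\<close>
  have all: "(\<Prod>(x, y)\<in>R \<times> R. F x y + e) \<in> \<rat>" if e: "e \<in> \<rat>" for e
  proof -
    obtain e' where e': "e = of_rat e'" using e by (auto elim: Rats_cases)
    define h where "h = (\<Prod>y\<in>R. Q y + [:e:])"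
    have h: "poly h x = (\<Prod>y\<in>R. F x y + e)" for x by (simp add: h_def poly_prod Q)
    have "\<exists>q. h = cpoly q"
    proof (rule cpoly_of_rational_values[of "{}"])
      fix x :: complex assume "x \<in> \<rat>"
      then obtain q where q: "F x y = poly (cpoly q) y" for y using left by blast
      have "poly h x = (\<Prod>y\<in>R. poly (cpoly (q + [:e':])) y)"
        by (simp add: h q cpoly_add cpoly_const e')
      then show "poly h x \<in> \<rat>" using rat by simp
    qed simp
    then obtain q where "h = cpoly q" by blast
    then have "(\<Prod>x\<in>R. \<Prod>y\<in>R. F x y + e) \<in> \<rat>" using rat[of q] by (simp flip: h)
    then show ?thesis by (simp add: prod.cartesian_product)
  qed
  define P where "P = {(x, y). x \<in> R \<and> y \<in> R \<and> F x y \<noteq> 0}"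
  have P: "P \<subseteq> R \<times> R" unfolding P_def by auto
  define G where "G = (\<Prod>(x, y)\<in>P. [:F x y, 1:])"
  have G: "poly G e = (\<Prod>(x, y)\<in>P. F x y + e)" for e
    unfolding G_def by (simp add: poly_prod split_beta)
  have "\<exists>q. G = cpoly q"
  \<comment> \<open>The vanishing factors are divided out as a power of \<open>e\<close>, which is
    possible only for \<open>e \<noteq> 0\<close>; rationality of the polynomial then brings back
    the value at 0.\<close>
  proof (rule cpoly_of_rational_values[of "{0}"])
    fix e :: complex assume e: "e \<in> \<rat>" "e \<notin> {0}"
    have "(\<Prod>(x, y)\<in>R \<times> R. F x y + e) = (\<Prod>(x, y)\<in>R \<times> R - P. F x y + e) * (\<Prod>(x, y)\<in>P. F x y + e)"
      using finR P by (intro prod.subset_diff) auto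
    also have "(\<Prod>(x, y)\<in>R \<times> R - P. F x y + e) = (\<Prod>(x, y)\<in>R \<times> R - P. e)"
      by (rule prod.cong) (auto simp: P_def)
    also have "\<dots> = e ^ card (R \<times> R - P)" by (simp add: split_beta)
    finally have "poly G e = (\<Prod>(x, y)\<in>R \<times> R. F x y + e) / e ^ card (R \<times> R - P)"
      using e by (simp add: G)
    then show "poly G e \<in> \<rat>" using all e by simp
  qed simp
  then obtain q where "G = cpoly q" by blast
  then have "poly G 0 = of_rat (poly q 0)" using poly_cpoly_rat[of q 0] by simp
  then show ?thesis using G[of 0] by (simp add: P_def)
qed

section \<open>Finitely generated subrings of the complex numbers\<close>

lemma zsmult_zero_left [simp]: "zsmult 0 x = 0"
  by (simp add: zsmult_def)

lemma zsmult_plus_one: "zsmult (k + 1) x = zsmult k x + x"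
proof (cases "0 \<le> k")
  case True
  then show ?thesis by (simp add: zsmult_def nat_add_distrib add.commute)
next
  case False
  have neg: "zsmult (- int m) x = - ((+) x ^^ m) 0" for m
    by (cases "m = 0") (simp_all add: zsmult_def)
  obtain m where "nat (- k) = Suc m" using False by (cases "nat (- k)") auto
  then have "k = - int (Suc m)" "k + 1 = - int m" by linarith+
  then have "zsmult k x = - ((+) x ^^ Suc m) 0" "zsmult (k + 1) x = - ((+) x ^^ m) 0"
    by (simp_all only: neg)
  then show ?thesis by simp
qed

lemma zsmult_add_left: "zsmult (k + l) x = zsmult k x + zsmult l x"
proof (induction l rule: int_induct[of _ 0])
  case (step1 i)
  then show ?case using zsmult_plus_one[of "k + i" x] zsmult_plus_one[of i x] by (simp add: add_ac)
next
  case (step2 i)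
  then show ?case using zsmult_plus_one[of "k + (i - 1)" x] zsmult_plus_one[of "i - 1" x]
    by (simp add: algebra_simps)
qed simp

lemma zsmult_one [simp]: "zsmult 1 x = x"
  using zsmult_plus_one[of 0 x] by simp

lemma zsmult_minus_left: "zsmult (- k) x = - zsmult k x"
  using zsmult_add_left[of k "- k" x] by (simp add: minus_unique)

lemma zsmult_additive:
  assumes "\<And>x y. f (x + y) = f x + f y"
  shows "f (zsmult k x) = zsmult k (f x)"
proof -
  have f0: "f 0 = 0" using assms[of 0 0] by simp
  show ?thesis
  proof (induction k rule: int_induct[of _ 0])
    case (step1 i)
    then show ?case by (simp add: zsmult_plus_one assms)
  next
    case (step2 i)
    then show ?case using zsmult_plus_one[of "i - 1" x] zsmult_plus_one[of "i - 1" "f x"]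
      by (simp add: assms)
  qed (simp add: f0)
qed

lemma zsmult_add_right: "zsmult k (x + y) = zsmult k x + zsmult k y"
proof (induction k rule: int_induct[of _ 0])
  case (step1 i)
  then show ?case unfolding zsmult_plus_one by (simp add: add_ac)
next
  case (step2 i)
  then show ?case using zsmult_plus_one[of "i - 1" "x + y"] zsmult_plus_one[of "i - 1" x]
      zsmult_plus_one[of "i - 1" y] by (simp add: add_ac)
qed simp

lemma zsmult_mult: "zsmult (k * l) x = zsmult k (zsmult l x)"
proof (induction k rule: int_induct[of _ 0])
  case (step1 i)
  then show ?case by (simp add: zsmult_plus_one distrib_right zsmult_add_left)
next
  case (step2 i)
  then show ?case using zsmult_plus_one[of "i - 1" "zsmult l x"]
    by (simp add: left_diff_distrib zsmult_add_left[of "i * l" "- l", simplified] zsmult_minus_left)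
qed simp

lemma zsmult_zero_right [simp]: "zsmult k 0 = 0"
  using zsmult_add_right[of k 0 0] by simp

lemma subgrp_zsmult: "subgrp S \<Longrightarrow> x \<in> S \<Longrightarrow> zsmult k x \<in> S"
proof (induction k rule: int_induct[of _ 0])
  case (step1 i)
  then show ?case by (simp add: zsmult_plus_one subgrp_add)
next
  case (step2 i)
  then show ?case using zsmult_plus_one[of "i - 1" x] subgrp_diff[of S "zsmult i x" x] by simp
qed (simp add: subgrp_zero)

lemma zsmult_of_int: "zsmult k x = of_int k * x" for x :: "'a::ring_1"
proof (induction k rule: int_induct[of _ 0])
  case (step1 i)
  then show ?case by (simp add: zsmult_plus_one distrib_right)
next
  case (step2 i)
  then show ?case using zsmult_plus_one[of "i - 1" x] by (simp add: left_diff_distrib)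
qed simp

lemma subgrp_of_int_mult: "subgrp S \<Longrightarrow> x \<in> S \<Longrightarrow> of_int k * x \<in> S" for x :: "'a::ring_1"
  using subgrp_zsmult[of S x k] by (simp add: zsmult_of_int)

section \<open>Additive bases and integral extensions\<close>

lemma add_span_altdef:
  fixes B :: "'a::ring_1 set"
  assumes "finite B"
  shows "add_span B = {\<Sum>b\<in>B. of_int (c b) * b | c. True}"
proof
  show "add_span B \<subseteq> {\<Sum>b\<in>B. of_int (c b) * b | c. True}"
  proof (rule add_span_minimal)
    show "subgrp {\<Sum>b\<in>B. of_int (c b) * b | c. True}"
      unfolding subgrp_def
    proof (intro conjI ballI)
      show "0 \<in> {\<Sum>b\<in>B. of_int (c b) * b | c. True}"
        by (intro CollectI exI[of _ "\<lambda>_. 0"]) simp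
      fix x y assume "x \<in> {\<Sum>b\<in>B. of_int (c b) * b | c. True}" "y \<in> {\<Sum>b\<in>B. of_int (c b) * b | c. True}"
      then obtain c d where "x = (\<Sum>b\<in>B. of_int (c b) * b)" "y = (\<Sum>b\<in>B. of_int (d b) * b)" by auto
      then show "x - y \<in> {\<Sum>b\<in>B. of_int (c b) * b | c. True}"
        by (intro CollectI exI[of _ "\<lambda>b. c b - d b"]) (simp add: left_diff_distrib sum_subtractf)
    qed
    show "B \<subseteq> {\<Sum>b\<in>B. of_int (c b) * b | c. True}"
    proof
      fix x assume "x \<in> B"
      then have "x = (\<Sum>b\<in>B. of_int (if b = x then 1 else 0) * b)"
        using assms by (simp add: if_distrib[of of_int] if_distrib[of "\<lambda>z. z * _"] cong: if_cong)
      then show "x \<in> {\<Sum>b\<in>B. of_int (c b) * b | c. True}" by (intro CollectI exI conjI TrueI)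
    qed
  qed
  show "{\<Sum>b\<in>B. of_int (c b) * b | c. True} \<subseteq> add_span B"
    by (auto intro!: subgrp_sum[OF subgrp_add_span] subgrp_of_int_mult[OF subgrp_add_span] intro: add_span.base)
qed

definition int_independent :: "complex set \<Rightarrow> bool" where
  "int_independent B \<longleftrightarrow> (\<forall>c::complex \<Rightarrow> int. (\<Sum>b\<in>B. of_int (c b) * b) = 0 \<longrightarrow> (\<forall>b\<in>B. c b = 0))"

text \<open>Take a generating set of least size and, if it is dependent, a relation with the least sum of
  absolute values; a step of the Euclidean algorithm on two coefficients makes it smaller.\<close>

lemma exists_int_basis:
  fixes B0 :: "complex set"
  assumes "finite B0"
  obtains B where "finite B" "add_span B = add_span B0" "int_independent B"
proof -
  define Q where "Q B \<longleftrightarrow> finite B \<and> add_span B = add_span B0" for B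
  obtain B1 where B1: "Q B1" "\<And>B. Q B \<Longrightarrow> card B1 \<le> card B"
    using ex_has_least_nat[of Q B0 card] assms by (auto simp: Q_def)
  define P where "P Bc \<longleftrightarrow> Q (fst Bc) \<and> card (fst Bc) = card B1 \<and>
     (\<Sum>b\<in>fst Bc. of_int (snd Bc b) * b) = 0 \<and> (\<exists>b\<in>fst Bc. snd Bc b \<noteq> 0)"
    for Bc :: "complex set \<times> (complex \<Rightarrow> int)"
  define ht where "ht Bc = (\<Sum>b\<in>fst Bc. nat \<bar>snd Bc b\<bar>)" for Bc :: "complex set \<times> (complex \<Rightarrow> int)"
  have "int_independent B1"
  proof (rule ccontr)
    assume "\<not> ?thesis"
    then obtain c0 where "P (B1, c0)" using B1 by (auto simp: int_independent_def P_def)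
    then obtain Bc where Bc: "P Bc" "\<And>Bc'. P Bc' \<Longrightarrow> ht Bc \<le> ht Bc'"
      using ex_has_least_nat[of P "(B1, c0)" ht] by blast
    obtain B c where [simp]: "Bc = (B, c)" by (cases Bc)
    have B: "finite B" "add_span B = add_span B0" "card B = card B1"
      and rel: "(\<Sum>b\<in>B. of_int (c b) * b) = 0" using Bc(1) by (auto simp: P_def Q_def)
    obtain k where k: "k \<in> B" "c k \<noteq> 0" using Bc(1) by (auto simp: P_def)
    show False
    proof (cases "\<exists>k'\<in>B. k' \<noteq> k \<and> c k' \<noteq> 0")
      case False
      have "(\<Sum>b\<in>B. of_int (c b) * b) = of_int (c k) * k + (\<Sum>b\<in>B - {k}. of_int (c b) * b)"
        using B k by (simp add: sum.remove)
      also have "(\<Sum>b\<in>B - {k}. of_int (c b) * b) = 0" using False by (intro sum.neutral) auto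
      finally have "k = 0" using rel k by simp
      have "add_span B \<subseteq> add_span (B - {k})"
        by (rule add_span_minimal[OF subgrp_add_span])
           (use \<open>k = 0\<close> in \<open>auto intro: add_span.intros\<close>)
      moreover have "add_span (B - {k}) \<subseteq> add_span B" by (rule add_span_mono) auto
      ultimately have "Q (B - {k})" using B by (auto simp: Q_def)
      then have "card B1 \<le> card (B - {k})" by (rule B1(2))
      then show False using B k card_Diff1_less[of B k] by simp
    next
      case True
      then obtain i j where ij: "i \<in> B" "j \<in> B" "i \<noteq> j" "c i \<noteq> 0" "c j \<noteq> 0" "\<bar>c j\<bar> \<le> \<bar>c i\<bar>"
        using k by (metis linear)
      \<comment> \<open>The sign for which subtracting \<open>e * c j\<close> shrinks
        \<open>c i\<close>. Replacing \<open>j\<close> by \<open>j + e * i\<close> preserves both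
        the span and the relation.\<close>
      define e where "e = sgn (c i) * sgn (c j)"
      have e: "\<bar>c i - e * c j\<bar> < \<bar>c i\<bar>"
        using ij by (auto simp: e_def sgn_if)
      define j' where "j' = j + of_int e * i"
      define B' where "B' = insert j' (B - {j})"
      have iB': "i \<in> B'" using ij by (auto simp: B'_def)
      have "add_span B' \<subseteq> add_span B"
      proof (rule add_span_minimal[OF subgrp_add_span])
        have "j' \<in> add_span B" unfolding j'_def
          by (intro subgrp_add[OF subgrp_add_span] subgrp_of_int_mult[OF subgrp_add_span] add_span.base ij)
        then show "B' \<subseteq> add_span B" unfolding B'_def by (auto intro: add_span.base)
      qed
      moreover have "add_span B \<subseteq> add_span B'"
      proof (rule add_span_minimal[OF subgrp_add_span])
        have "j' - of_int e * i \<in> add_span B'"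
          using iB' by (intro subgrp_diff[OF subgrp_add_span] subgrp_of_int_mult[OF subgrp_add_span] add_span.base)
            (simp_all add: B'_def)
        then have "j \<in> add_span B'" by (simp add: j'_def)
        then show "B \<subseteq> add_span B'" unfolding B'_def by (auto intro: add_span.base)
      qed
      ultimately have QB': "Q B'" using B by (auto simp: Q_def B'_def)
      \<comment> \<open>If the new generator were already present, there would be a generating set
        with fewer elements.\<close>
      have j': "j' \<notin> B - {j}"
      proof
        assume "j' \<in> B - {j}"
        then have "card B' = card B - 1" using ij B by (simp add: B'_def insert_absorb)
        moreover have "card B > 0" using B(1) ij(2) card_gt_0_iff by blast
        ultimately show False using B1(2)[OF QB'] B(3) by simp
      qed
      then have "j' \<noteq> i" using ij by auto
      have "card B > 0" using B(1) ij(2) card_gt_0_iff by blast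
      then have cB': "card B' = card B1" using j' B ij by (simp add: B'_def)
      define c' where "c' = c(i := c i - e * c j, j' := c j)"
      define D where "D = B - {i} - {j}"
      have split: "(\<Sum>b\<in>B. f b) = f i + f j + (\<Sum>b\<in>D. f b)" for f :: "complex \<Rightarrow> 'x::comm_monoid_add"
        using B ij by (simp add: D_def sum.remove[of B i] sum.remove[of "B - {i}" j] add_ac)
      have "B' = insert i (insert j' D)" using ij by (auto simp: B'_def D_def)
      then have split': "(\<Sum>b\<in>B'. f b) = f i + f j' + (\<Sum>b\<in>D. f b)" for f :: "complex \<Rightarrow> 'x::comm_monoid_add"
        using B ij j' \<open>j' \<noteq> i\<close> by (simp add: D_def add_ac)
      have c': "c' i = c i - e * c j" "c' j' = c j" "\<And>b. b \<in> D \<Longrightarrow> c' b = c b"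
        using \<open>j' \<noteq> i\<close> j' by (auto simp: c'_def D_def)
      have "(\<Sum>b\<in>B'. of_int (c' b) * b) = (\<Sum>b\<in>B. of_int (c b) * b)"
        unfolding split split' by (simp add: c' cong: sum.cong) (simp add: j'_def algebra_simps)
      moreover have "c' j' \<noteq> 0" "j' \<in> B'" using c' ij by (auto simp: B'_def)
      ultimately have "P (B', c')" using QB' cB' rel by (auto simp: P_def)
      then have "ht Bc \<le> ht (B', c')" by (rule Bc(2))
      moreover have "ht (B', c') < ht Bc"
        unfolding ht_def by (simp add: split split' c' cong: sum.cong) (use e in linarith)
      ultimately show False by simp
    qed
  qed
  then show ?thesis using that B1(1) by (auto simp: Q_def)
qed

text \<open>Finitely generated as an additive group, not merely as a ring: this is what makes a
  finite additive basis available.\<close>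

definition fg_subring :: "complex set \<Rightarrow> bool" where
  "fg_subring R \<longleftrightarrow> 1 \<in> R \<and> (\<forall>x\<in>R. \<forall>y\<in>R. x * y \<in> R) \<and> (\<exists>B. finite B \<and> R = add_span B)"

text \<open>Integrality of \<open>al\<close> reduces all its powers to those below \<open>d\<close>,
  so the products of generators with these finitely many powers span a ring.\<close>

lemma fg_subring_adjoin:
  assumes R: "fg_subring R" and d: "d > 0" and al: "al ^ d \<in> add_span ((\<lambda>k. al ^ k) ` {..<d})"
  obtains R' where "fg_subring R'" "R \<subseteq> R'" "al \<in> R'"
proof -
  obtain B where B: "finite B" "R = add_span B" using R by (auto simp: fg_subring_def)
  define S where "S = add_span ((\<lambda>k. al ^ k) ` {..<d})"
  define R' where "R' = add_span ((\<lambda>(b, k). b * al ^ k) ` (B \<times> {..<d}))"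
  have S: "al ^ m \<in> S" for m
  proof (induction m)
    case 0
    then show ?case unfolding S_def using d by (intro add_span.base) force
  next
    case (Suc m)
    have "S \<subseteq> {x. al * x \<in> S}"
      unfolding S_def
    proof (intro add_span_minimal subgrp_vimage subgrp_add_span)
      show "(\<lambda>k. al ^ k) ` {..<d} \<subseteq> {x. al * x \<in> add_span ((\<lambda>k. al ^ k) ` {..<d})}"
      proof safe
        fix k assume "k < d"
        show "al * al ^ k \<in> add_span ((\<lambda>k. al ^ k) ` {..<d})"
        proof (cases "Suc k = d")
          case True
          then show ?thesis using al by auto
        next
          case False
          then show ?thesis using \<open>k < d\<close> by (intro add_span.base) (metis Suc_lessI image_eqI lessThan_iff power_Suc)
        qed
      qed
    qed (simp add: distrib_left)
    then show ?case using Suc by auto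
  qed
  have RS: "x * y \<in> R'" if "x \<in> R" "y \<in> S" for x y
    using that unfolding B S_def
    by (rule biadditive_span_closed[of R' "(*)", rotated -2])
       (auto simp: R'_def distrib_left distrib_right intro!: subgrp_add_span add_span.base)
  have "fg_subring R'"
    unfolding fg_subring_def
  proof (intro conjI ballI)
    show "1 \<in> R'" using RS[of 1 1] S[of 0] R by (auto simp: fg_subring_def)
    show "\<exists>B. finite B \<and> R' = add_span B" unfolding R'_def
      using B by (intro exI[of _ "(\<lambda>(b, k). b * al ^ k) ` (B \<times> {..<d})"]) simp
    fix x y assume "x \<in> R'" "y \<in> R'"
    then show "x * y \<in> R'" unfolding R'_def
    proof (rule biadditive_span_closed[of "add_span _" "(*)", rotated -2])
      fix u v assume "u \<in> (\<lambda>(b, k). b * al ^ k) ` (B \<times> {..<d})" "v \<in> (\<lambda>(b, k). b * al ^ k) ` (B \<times> {..<d})"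
      then obtain b k b' k' where uv: "u = b * al ^ k" "v = b' * al ^ k'" "b \<in> B" "b' \<in> B" by auto
      have "b * b' \<in> R" using uv R B by (auto simp: fg_subring_def intro: add_span.base)
      then have "(b * b') * al ^ (k + k') \<in> R'" by (rule RS[OF _ S])
      then show "u * v \<in> add_span ((\<lambda>(b, k). b * al ^ k) ` (B \<times> {..<d}))"
        by (simp add: uv R'_def power_add mult_ac)
    qed (auto simp: distrib_left distrib_right subgrp_add_span)
  qed
  moreover have "R \<subseteq> R'" using RS[OF _ S[of 0]] by auto
  moreover have "al \<in> R'" using RS[of 1, OF _ S[of 1]] R by (auto simp: fg_subring_def)
  ultimately show ?thesis using that by blast
qed

lemma exists_fg_subring:
  assumes "finite As" "d > 0" "\<And>al. al \<in> As \<Longrightarrow> al ^ d \<in> add_span ((\<lambda>k. al ^ k) ` {..<d})"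
  obtains R where "fg_subring R" "As \<subseteq> R"
proof -
  have "\<exists>R. fg_subring R \<and> As \<subseteq> R"
    using assms(1,3)
  proof (induction As rule: finite_induct)
    case empty
    have "x * y \<in> add_span {1}" if "x \<in> add_span {1}" "y \<in> add_span {1}" for x y :: complex
      using that by (rule biadditive_span_closed[of "add_span _" "(*)", rotated -2])
        (auto simp: distrib_left distrib_right subgrp_add_span intro: add_span.base)
    then have "fg_subring (add_span {1})"
      unfolding fg_subring_def by (auto intro!: add_span.base exI[of _ "{1}"])
    then show ?case by blast
  next
    case (insert al As)
    then obtain R where "fg_subring R" "As \<subseteq> R" by auto
    then show ?case
      using fg_subring_adjoin[OF _ assms(2) insert.prems[of al], of R] by (metis insertI1 insert_subset order.trans)
  qed
  then show ?thesis using that by blast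
qed

section \<open>Extension of scalars\<close>

lemma additive_sum:
  fixes f :: "'b::ab_group_add \<Rightarrow> 'c::ab_group_add"
  assumes "\<And>x y. f (x + y) = f x + f y"
  shows "f (\<Sum>i\<in>I. h i) = (\<Sum>i\<in>I. f (h i))"
proof -
  have "f 0 = 0" using assms[of 0 0] by simp
  then show ?thesis by (induction I rule: infinite_finite_induct) (simp_all add: assms)
qed

lemma sum_rotate:
  "(\<Sum>b\<in>B. \<Sum>c\<in>C. \<Sum>a\<in>A. F a b c) = (\<Sum>a\<in>A. \<Sum>b\<in>B. \<Sum>c\<in>C. F a b c)"
proof -
  have "(\<Sum>c\<in>C. \<Sum>a\<in>A. F a b c) = (\<Sum>a\<in>A. \<Sum>c\<in>C. F a b c)" for b by (rule sum.swap)
  then show ?thesis by (simp only:) (rule sum.swap)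
qed

lemma sum_fun_apply: "(\<Sum>i\<in>I. f i) x = (\<Sum>i\<in>I. f i x)" for f :: "'i \<Rightarrow> 'x \<Rightarrow> 'a::comm_monoid_add"
  by (induction I rule: infinite_finite_induct) simp_all

section \<open>Coordinates and tensors over an additive basis\<close>

locale int_basis_ring =
  fixes B :: "complex set"
  assumes finite_B: "finite B"
    and independent: "int_independent B"
    and one_mem: "1 \<in> add_span B"
    and mult_mem: "x \<in> add_span B \<Longrightarrow> y \<in> add_span B \<Longrightarrow> x * y \<in> add_span B"
begin

abbreviation "R \<equiv> add_span B"

lemma basis_mem: "b \<in> B \<Longrightarrow> b \<in> R"
  by (rule add_span.base)

lemma add_mem: "x \<in> R \<Longrightarrow> y \<in> R \<Longrightarrow> x + y \<in> R"
  and diff_mem: "x \<in> R \<Longrightarrow> y \<in> R \<Longrightarrow> x - y \<in> R"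
  by (auto intro: subgrp_add subgrp_diff subgrp_add_span)

lemma sum_mem: "(\<And>i. i \<in> I \<Longrightarrow> f i \<in> R) \<Longrightarrow> sum f I \<in> R"
  by (rule subgrp_sum[OF subgrp_add_span])

lemma of_int_mem: "of_int k \<in> R"
  using subgrp_of_int_mult[OF subgrp_add_span one_mem, of k] by simp

lemma prod_mem: "(\<And>i. i \<in> I \<Longrightarrow> f i \<in> R) \<Longrightarrow> prod f I \<in> R"
  by (induction I rule: infinite_finite_induct) (auto intro: one_mem mult_mem)

lemma power_mem: "x \<in> R \<Longrightarrow> x ^ n \<in> R"
  by (induction n) (auto intro: one_mem mult_mem)

definition co :: "complex \<Rightarrow> complex \<Rightarrow> int" where
  "co x = (SOME c. x = (\<Sum>b\<in>B. of_int (c b) * b))"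

lemma co_sum: "x \<in> R \<Longrightarrow> (\<Sum>b\<in>B. of_int (co x b) * b) = x"
  unfolding co_def using someI_ex[of "\<lambda>c. x = (\<Sum>b\<in>B. of_int (c b) * b)"]
  by (auto simp: add_span_altdef[OF finite_B])

lemma co_unique:
  assumes "x = (\<Sum>b\<in>B. of_int (c b) * b)" "b \<in> B" shows "co x b = c b"
proof -
  have "x \<in> R" using assms(1) by (auto simp: add_span_altdef[OF finite_B])
  then have "(\<Sum>b\<in>B. of_int (co x b - c b) * b) = 0"
    using co_sum[of x] assms(1) by (simp add: left_diff_distrib sum_subtractf)
  then have "co x b - c b = 0"
    using independent[unfolded int_independent_def, rule_format, of "\<lambda>b. co x b - c b"] assms(2) by blast
  then show ?thesis by simp
qed

lemma co_add: "x \<in> R \<Longrightarrow> y \<in> R \<Longrightarrow> b \<in> B \<Longrightarrow> co (x + y) b = co x b + co y b"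
  using co_sum[of x] co_sum[of y]
  by (intro co_unique) (simp_all add: distrib_right sum.distrib)

lemma co_of_int_mult: "x \<in> R \<Longrightarrow> b \<in> B \<Longrightarrow> co (of_int k * x) b = k * co x b"
proof (rule co_unique)
  assume "x \<in> R"
  then have "of_int k * x = of_int k * (\<Sum>b\<in>B. of_int (co x b) * b)" by (simp add: co_sum)
  then show "of_int k * x = (\<Sum>b\<in>B. of_int (k * co x b) * b)"
    by (simp add: sum_distrib_left mult_ac)
qed

lemma co_basis: "b \<in> B \<Longrightarrow> c \<in> B \<Longrightarrow> co b c = (if c = b then 1 else 0)"
  using finite_B
  by (intro co_unique[where c = "\<lambda>c. if c = b then 1 else 0"])
     (simp_all add: if_distrib[of of_int] if_distrib[of "\<lambda>z. z * _"] cong: if_cong)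

text \<open>All powers of \<open>1 / q\<close> would lie in the ring, so every \<open>q ^ k\<close>
  would divide each coordinate of 1. Taking \<open>k\<close> to be the absolute value of a nonzero
  coordinate contradicts \<open>k < 2 ^ k\<close>.\<close>

lemma inverse_of_int_mem:
  assumes "q > 0" "1 / of_int q \<in> R" shows "q = 1"
proof (rule ccontr)
  assume "q \<noteq> 1"
  then have q: "q \<ge> 2" using assms by simp
  have "co 1 b = 0" if "b \<in> B" for b
  proof (rule ccontr)
    assume nz: "co 1 b \<noteq> 0"
    define k where "k = nat \<bar>co 1 b\<bar>"
    have "(1 / of_int q) ^ k \<in> R" using assms(2) by (rule power_mem)
    then have "co (of_int (q ^ k) * (1 / of_int q) ^ k) b = q ^ k * co ((1 / of_int q) ^ k) b"
      using that by (rule co_of_int_mult)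
    moreover have "of_int (q ^ k) * (1 / of_int q) ^ k = (1::complex)"
      using q by (simp add: power_one_over)
    ultimately have "q ^ k dvd co 1 b" by simp
    then have "q ^ k \<le> \<bar>co 1 b\<bar>" using nz by (metis dvd_imp_le_int abs_of_pos assms(1) zero_less_power)
    moreover have "2 ^ k \<le> q ^ k" using q by (intro power_mono) auto
    moreover have "\<bar>co 1 b\<bar> < 2 ^ k" unfolding k_def using of_nat_less_two_power[of "nat \<bar>co 1 b\<bar>", where 'a = int] by simp
    ultimately show False by simp
  qed
  then show False using co_sum[OF one_mem] by simp
qed

text \<open>A Bezout relation between numerator and denominator turns the fraction into
  \<open>1 / q\<close>.\<close>

lemma rational_mem_Ints:
  assumes "z \<in> R" "z \<in> \<rat>" shows "z \<in> \<int>"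
proof -
  obtain p q :: int where pq: "q > 0" "coprime p q" "z = of_int p / of_int q"
    using assms(2) by (metis Rats_cases')
  obtain u v where uv: "u * p + v * q = 1" using pq(2) by (metis bezout_int coprime_imp_gcd_eq_1)
  have "of_int u * z + of_int v \<in> R" using assms(1) by (intro add_mem mult_mem of_int_mem)
  moreover have "of_int u * z + of_int v = of_int (u * p + v * q) / (of_int q :: complex)"
  proof -
    have "of_int q \<noteq> (0 :: complex)" using pq(1) by simp
    then show ?thesis by (simp add: pq(3) add_divide_distrib)
  qed
  ultimately have "1 / of_int q \<in> R" by (simp add: uv)
  then have "q = 1" using inverse_of_int_mem pq(1) by blast
  then show ?thesis using pq by simp
qed

text \<open>The extension of scalars from the integers to \<open>R\<close>: a function \<open>V\<close> supported on the basis
  stands for the sum of the pure tensors \<open>tens (V b) b\<close>.\<close>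

definition tens :: "'a::ab_group_add \<Rightarrow> complex \<Rightarrow> complex \<Rightarrow> 'a" where
  "tens v x = (\<lambda>b. if b \<in> B then zsmult (co x b) v else 0)"

definition car :: "(complex \<Rightarrow> 'a::ab_group_add) set" where
  "car = {V. \<forall>b. b \<notin> B \<longrightarrow> V b = 0}"

definition sc :: "complex \<Rightarrow> (complex \<Rightarrow> 'a::ab_group_add) \<Rightarrow> complex \<Rightarrow> 'a" where
  "sc x V = (\<Sum>b\<in>B. tens (V b) (x * b))"

lemma subgrp_car: "subgrp car"
  by (auto simp: car_def subgrp_def)

lemma tens_car: "tens v x \<in> car"
  by (auto simp: tens_def car_def)

lemma sc_car: "sc x V \<in> car"
  unfolding sc_def by (rule subgrp_sum[OF subgrp_car tens_car])

lemma tens_add_left: "tens (v + w) x = tens v x + tens w x"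
  by (auto simp: tens_def zsmult_add_right)

lemma tens_add_right: "x \<in> R \<Longrightarrow> y \<in> R \<Longrightarrow> tens v (x + y) = tens v x + tens v y"
  by (auto simp: tens_def co_add zsmult_add_left)

lemma tens_zero_left [simp]: "tens 0 x = 0"
  by (auto simp: tens_def)

lemma tens_zero_right [simp]: "tens v 0 = 0"
  using tens_add_right[of 0 0 v] of_int_mem[of 0] by simp

lemma tens_diff_left: "tens (v - w) x = tens v x - tens w x"
  using tens_add_left[of "v - w" w x] by (simp add: algebra_simps)

lemma tens_sum_right:
  "(\<And>i. i \<in> I \<Longrightarrow> f i \<in> R) \<Longrightarrow> tens v (\<Sum>i\<in>I. f i) = (\<Sum>i\<in>I. tens v (f i))"
  by (induction I rule: infinite_finite_induct) (auto simp: tens_add_right sum_mem)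

lemma tens_zsmult: "x \<in> R \<Longrightarrow> tens (zsmult k v) x = tens v (of_int k * x)"
  by (rule ext) (simp add: tens_def co_of_int_mult mult.commute[of k "co x _"] zsmult_mult)

text \<open>Integers move across the tensor sign, which reassembles \<open>x\<close> from its
  coordinates; nearly all identities in the extension reduce to this.\<close>

lemma tens_coordinates:
  assumes "x \<in> R" "y \<in> R" shows "(\<Sum>b\<in>B. tens (zsmult (co x b) v) (y * b)) = tens v (y * x)"
proof -
  have "(\<Sum>b\<in>B. tens (zsmult (co x b) v) (y * b)) = (\<Sum>b\<in>B. tens v (of_int (co x b) * (y * b)))"
    using assms by (intro sum.cong) (simp_all add: tens_zsmult mult_mem basis_mem)
  also have "\<dots> = tens v (\<Sum>b\<in>B. of_int (co x b) * (y * b))"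
    using assms by (intro tens_sum_right[symmetric]) (simp add: mult_mem of_int_mem basis_mem)
  also have "(\<Sum>b\<in>B. of_int (co x b) * (y * b)) = y * (\<Sum>b\<in>B. of_int (co x b) * b)"
    by (simp add: sum_distrib_left mult_ac)
  finally show ?thesis using assms by (simp add: co_sum)
qed

lemma car_eq_sum_tens: "V \<in> car \<Longrightarrow> (\<Sum>b\<in>B. tens (V b) b) = V"
proof
  fix x assume V: "V \<in> car"
  show "(\<Sum>b\<in>B. tens (V b) b) x = V x"
  proof (cases "x \<in> B")
    case True
    then have "(\<Sum>b\<in>B. tens (V b) b) x = (\<Sum>b\<in>B. if b = x then V x else 0)"
      unfolding sum_fun_apply by (intro sum.cong) (simp_all add: tens_def co_basis)
    then show ?thesis using True finite_B by simp
  next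
    case False
    then show ?thesis using V by (simp add: sum_fun_apply tens_def car_def)
  qed
qed

lemma tens_apply: "b \<in> B \<Longrightarrow> tens v x b = zsmult (co x b) v"
  by (simp add: tens_def)

lemma sc_tens: "x \<in> R \<Longrightarrow> y \<in> R \<Longrightarrow> sc x (tens v y) = tens v (x * y)"
  unfolding sc_def using tens_coordinates[of y x v] by (simp add: tens_apply cong: sum.cong)

lemma sc_add_right: "sc x (V + W) = sc x V + sc x W"
  by (simp add: sc_def tens_add_left sum.distrib)

lemma sc_zero_right [simp]: "sc x 0 = 0"
  by (simp add: sc_def)

lemma sc_diff_right: "sc x (V - W) = sc x V - sc x W"
  using sc_add_right[of x "V - W" W] by (simp add: algebra_simps)

lemma sc_sum_right: "sc x (\<Sum>i\<in>I. f i) = (\<Sum>i\<in>I. sc x (f i))"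
  by (rule additive_sum[of "sc x"]) (rule sc_add_right)

lemma sc_add_left: "x \<in> R \<Longrightarrow> y \<in> R \<Longrightarrow> sc (x + y) V = sc x V + sc y V"
  by (simp add: sc_def distrib_right tens_add_right mult_mem basis_mem sum.distrib cong: sum.cong)

lemma sc_zero_left [simp]: "sc 0 V = 0"
  by (simp add: sc_def)

lemma sc_diff_left: "x \<in> R \<Longrightarrow> y \<in> R \<Longrightarrow> sc (x - y) V = sc x V - sc y V"
  using sc_add_left[of "x - y" y V] diff_mem[of x y] by (simp add: algebra_simps)

lemma sc_mult: "x \<in> R \<Longrightarrow> y \<in> R \<Longrightarrow> sc (x * y) V = sc x (sc y V)"
  unfolding sc_def[of "x * y"] sc_def[of y] sc_sum_right
  by (intro sum.cong) (simp_all add: sc_tens mult_mem basis_mem mult.assoc)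

lemma sc_commute: "x \<in> R \<Longrightarrow> y \<in> R \<Longrightarrow> sc x (sc y V) = sc y (sc x V)"
  by (simp add: mult.commute flip: sc_mult)

lemma sc_of_int: "V \<in> car \<Longrightarrow> sc (of_int k) V = (\<lambda>b. zsmult k (V b))"
proof -
  assume V: "V \<in> car"
  have "sc (of_int k) V = (\<Sum>b\<in>B. tens (zsmult k (V b)) b)"
    unfolding sc_def by (intro sum.cong) (simp_all add: tens_zsmult basis_mem)
  also have "\<dots> = (\<lambda>b. zsmult k (V b))"
    using V by (intro car_eq_sum_tens) (auto simp: car_def)
  finally show ?thesis .
qed

lemma sc_one: "V \<in> car \<Longrightarrow> sc 1 V = V"
  using sc_of_int[of V 1] by simp

lemma sc_map:
  assumes "\<And>x y. g (x + y) = g x + g y"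
  shows "sc x (g \<circ> V) = g \<circ> sc x V"
proof -
  have g0: "g 0 = 0" using assms[of 0 0] by simp
  show ?thesis
  proof
    fix b
    show "sc x (g \<circ> V) b = (g \<circ> sc x V) b"
      by (cases "b \<in> B")
         (simp_all add: sc_def sum_fun_apply additive_sum[of g, OF assms] tens_def zsmult_additive[of g, OF assms] g0)
  qed
qed

text \<open>The element \<open>v\<close> may have finite order, so a coordinate of 1 cannot simply
  be cancelled. Instead the order \<open>k\<close> of \<open>v\<close> divides every coordinate of
  1, so \<open>1 / k\<close> lies in the ring and \<open>k = 1\<close>.\<close>

lemma tens_one_inject:
  assumes "tens v 1 = 0" shows "v = 0"
proof (rule ccontr)
  assume v: "v \<noteq> 0"
  have co0: "zsmult (co 1 b) v = 0" if "b \<in> B" for b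
    using fun_cong[OF assms, of b] that by (simp add: tens_def)
  have "\<exists>b\<in>B. co 1 b \<noteq> 0"
  proof (rule ccontr)
    assume "\<not> ?thesis"
    then show False using co_sum[OF one_mem] by simp
  qed
  then obtain b where b: "b \<in> B" "co 1 b \<noteq> 0" by blast
  have "zsmult (int (nat \<bar>co 1 b\<bar>)) v = 0"
    using co0[OF b(1)] by (auto simp: abs_if zsmult_minus_left)
  then have ex: "\<exists>k. 0 < k \<and> zsmult (int k) v = 0" using b(2) by (intro exI[of _ "nat \<bar>co 1 b\<bar>"]) auto
  define k where "k = (LEAST k. 0 < k \<and> zsmult (int k) v = 0)"
  have k: "0 < k" "zsmult (int k) v = 0" using LeastI_ex[OF ex] unfolding k_def by auto
  have kmin: "\<not> (0 < j \<and> zsmult (int j) v = 0)" if "j < k" for j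
    using that unfolding k_def by (rule not_less_Least)
  have dvd: "int k dvd l" if l: "zsmult l v = 0" for l
  proof -
    have "zsmult l v = zsmult (l mod int k) v + zsmult (l div int k * int k) v"
      by (metis zsmult_add_left mod_mult_div_eq mult.commute)
    then have "zsmult (int (nat (l mod int k))) v = 0" using l k by (simp add: zsmult_mult)
    moreover have "nat (l mod int k) < k" using k by (simp add: nat_less_iff)
    ultimately have "nat (l mod int k) = 0" using kmin[of "nat (l mod int k)"] by simp
    moreover have "l mod int k \<ge> 0" using k by simp
    ultimately have "l mod int k = 0" by linarith
    then show ?thesis by (rule mod_0_imp_dvd)
  qed
  have "(\<Sum>b\<in>B. of_int (co 1 b div int k) * b) = (1 :: complex) / of_int (int k)"
  proof -
    have "of_int (int k) * (\<Sum>b\<in>B. of_int (co 1 b div int k) * b) = (\<Sum>b\<in>B. of_int (co 1 b) * b)"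
      unfolding sum_distrib_left
    proof (rule sum.cong)
      fix b assume "b \<in> B"
      then have "int k dvd co 1 b" by (intro dvd co0)
      then have "int k * (co 1 b div int k) = co 1 b" by (rule dvd_mult_div_cancel)
      then show "of_int (int k) * (of_int (co 1 b div int k) * b) = of_int (co 1 b) * b"
        by (metis mult.assoc of_int_mult)
    qed simp
    then show ?thesis using k co_sum[OF one_mem] by (simp add: field_simps)
  qed
  moreover have "(\<Sum>b\<in>B. of_int (co 1 b div int k) * b) \<in> R"
    by (rule sum_mem) (simp add: mult_mem of_int_mem basis_mem)
  ultimately have "1 / of_int (int k) \<in> R" by simp
  then have "int k = 1" using inverse_of_int_mem[of "int k"] k by simp
  then show False using k v by simp
qed

end

locale leibniz_extension = int_basis_ring B + leibniz_ring br
  for B :: "complex set" and br :: "'a::ab_group_add \<Rightarrow> 'a \<Rightarrow> 'a"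
begin

definition brx :: "(complex \<Rightarrow> 'a) \<Rightarrow> (complex \<Rightarrow> 'a) \<Rightarrow> complex \<Rightarrow> 'a" where
  "brx V W = (\<Sum>b\<in>B. \<Sum>c\<in>B. tens (br (V b) (W c)) (b * c))"

lemma brx_car: "brx V W \<in> car"
  unfolding brx_def by (intro subgrp_sum[OF subgrp_car] tens_car)

lemma brx_add_left: "brx (U + V) W = brx U W + brx V W"
  by (simp add: brx_def br_add_left tens_add_left sum.distrib)

lemma brx_add_right: "brx U (V + W) = brx U V + brx U W"
  by (simp add: brx_def br_add_right tens_add_left sum.distrib)

lemma brx_sum_left: "brx (\<Sum>i\<in>I. f i) W = (\<Sum>i\<in>I. brx (f i) W)"
  by (rule additive_sum[of "\<lambda>V. brx V W"]) (rule brx_add_left)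

lemma brx_sum_right: "brx V (\<Sum>i\<in>I. f i) = (\<Sum>i\<in>I. brx V (f i))"
  by (rule additive_sum[of "brx V"]) (rule brx_add_right)

lemma brx_tens_right:
  assumes "y \<in> R" shows "brx V (tens w y) = (\<Sum>b\<in>B. tens (br (V b) w) (b * y))"
  unfolding brx_def
proof (rule sum.cong)
  fix b assume b: "b \<in> B"
  have "(\<Sum>c\<in>B. tens (br (V b) (tens w y c)) (b * c)) =
      (\<Sum>c\<in>B. tens (zsmult (co y c) (br (V b) w)) (b * c))"
    by (intro sum.cong) (simp_all add: tens_apply zsmult_additive[of "br (V b)", OF br_add_right])
  then show "(\<Sum>c\<in>B. tens (br (V b) (tens w y c)) (b * c)) = tens (br (V b) w) (b * y)"
    using tens_coordinates[OF assms basis_mem[OF b]] by simp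
qed simp

lemma brx_tens_left:
  assumes "x \<in> R" shows "brx (tens v x) W = (\<Sum>c\<in>B. tens (br v (W c)) (x * c))"
  unfolding brx_def
proof (subst sum.swap, rule sum.cong)
  fix c assume c: "c \<in> B"
  have "(\<Sum>b\<in>B. tens (br (tens v x b) (W c)) (b * c)) =
      (\<Sum>b\<in>B. tens (zsmult (co x b) (br v (W c))) (c * b))"
    by (intro sum.cong)
       (simp_all add: tens_apply zsmult_additive[of "\<lambda>v. br v (W c)", OF br_add_left] mult.commute)
  then show "(\<Sum>b\<in>B. tens (br (tens v x b) (W c)) (b * c)) = tens (br v (W c)) (x * c)"
    using tens_coordinates[OF assms basis_mem[OF c]] by (simp add: mult.commute)
qed simp

lemma brx_tens: "x \<in> R \<Longrightarrow> y \<in> R \<Longrightarrow> brx (tens v x) (tens w y) = tens (br v w) (x * y)"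
proof -
  assume x: "x \<in> R" and y: "y \<in> R"
  have "brx (tens v x) (tens w y) = (\<Sum>c\<in>B. tens (zsmult (co y c) (br v w)) (x * c))"
    unfolding brx_tens_left[OF x]
    by (intro sum.cong) (simp_all add: tens_apply zsmult_additive[of "br v", OF br_add_right])
  then show ?thesis using tens_coordinates[OF y x] by simp
qed

lemma brx_sc_left:
  assumes "x \<in> R" shows "brx (sc x V) W = sc x (brx V W)"
  unfolding sc_def[of x V] brx_sum_left brx_def[of V] sc_sum_right
  using assms by (intro sum.cong) (simp_all add: brx_tens_left sc_tens mult_mem basis_mem mult.assoc cong: sum.cong)

lemma brx_sc_right:
  assumes "x \<in> R" shows "brx V (sc x W) = sc x (brx V W)"
proof -
  have "brx V (sc x W) = (\<Sum>c\<in>B. \<Sum>b\<in>B. tens (br (V b) (W c)) (x * (b * c)))"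
    unfolding sc_def[of x W] brx_sum_right
    using assms by (intro sum.cong) (simp_all add: brx_tens_right mult_mem basis_mem mult.left_commute)
  also have "\<dots> = (\<Sum>b\<in>B. \<Sum>c\<in>B. tens (br (V b) (W c)) (x * (b * c)))" by (rule sum.swap)
  also have "\<dots> = sc x (brx V W)"
    unfolding brx_def sc_sum_right
    using assms by (intro sum.cong) (simp_all add: sc_tens mult_mem basis_mem)
  finally show ?thesis .
qed

text \<open>Each term of the identity is expanded into a triple sum of pure tensors, where
  commutativity of the scalars leaves only the identity in the original ring.\<close>

lemma leibniz_ring_brx: "leibniz_ring brx"
proof
  fix U V W :: "complex \<Rightarrow> 'a"
  have "brx U (brx V W) = (\<Sum>b\<in>B. \<Sum>c\<in>B. \<Sum>a\<in>B. tens (br (U a) (br (V b) (W c))) (a * (b * c)))"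
    unfolding brx_def[of V] brx_sum_right
    by (intro sum.cong) (simp_all add: brx_tens_right mult_mem basis_mem)
  also have "\<dots> = (\<Sum>b\<in>B. \<Sum>c\<in>B. \<Sum>a\<in>B. tens (br (br (U a) (V b)) (W c)) (a * b * c)) -
      (\<Sum>b\<in>B. \<Sum>c\<in>B. \<Sum>a\<in>B. tens (br (br (U a) (W c)) (V b)) (a * c * b))"
    by (simp add: leibniz tens_diff_left sum_subtractf mult_ac)
  also have "(\<Sum>b\<in>B. \<Sum>c\<in>B. \<Sum>a\<in>B. tens (br (br (U a) (V b)) (W c)) (a * b * c)) =
      (\<Sum>a\<in>B. \<Sum>b\<in>B. \<Sum>c\<in>B. tens (br (br (U a) (V b)) (W c)) (a * b * c))"
    by (rule sum_rotate)
  also have "\<dots> = brx (brx U V) W"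
    unfolding brx_def[of U] brx_sum_left
    by (intro sum.cong) (simp_all add: brx_tens_left mult_mem basis_mem)
  also have "(\<Sum>b\<in>B. \<Sum>c\<in>B. \<Sum>a\<in>B. tens (br (br (U a) (W c)) (V b)) (a * c * b)) =
      (\<Sum>a\<in>B. \<Sum>c\<in>B. \<Sum>b\<in>B. tens (br (br (U a) (W c)) (V b)) (a * c * b))"
    by (subst sum.swap) (rule sum_rotate)
  also have "\<dots> = brx (brx U W) V"
    unfolding brx_def[of U] brx_sum_left
    by (intro sum.cong) (simp_all add: brx_tens_left mult_mem basis_mem)
  finally show "brx U (brx V W) = brx (brx U V) W - brx (brx U W) V" .
qed (rule brx_add_left brx_add_right)+

lemma brx_map:
  assumes "\<And>x y. g (x + y) = g x + g y" "\<And>x y. g (br x y) = br (g x) (g y)"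
  shows "g \<circ> brx V W = brx (g \<circ> V) (g \<circ> W)"
proof -
  have g0: "g 0 = 0" using assms(1)[of 0 0] by simp
  show ?thesis
  proof
    fix b
    show "(g \<circ> brx V W) b = brx (g \<circ> V) (g \<circ> W) b"
      by (cases "b \<in> B")
         (simp_all add: brx_def sum_fun_apply additive_sum[of g, OF assms(1)] tens_def
           zsmult_additive[of g, OF assms(1)] g0 assms(2))
  qed
qed

end

section \<open>The grading by generalised eigenspaces\<close>

declare plus_fun_apply [simp del] zero_fun_apply [simp del] minus_apply [simp del]

lemma funpow_commute:
  assumes "\<And>V. f (h V) = h (f V)" shows "f ((h ^^ n) V) = (h ^^ n) (f V)"
  by (induction n) (simp_all add: assms)

text \<open>The locale collects what arithmetic must supply. Regularity, injective action on the
  extension, takes the place of invertibility. The factor \<open>a ^ (2 * degree r)\<close> clears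
  denominators, since it is \<open>a * a * (x * y)\<close> that is a product of elements of the
  ring.\<close>

locale eigenspace_grading = leibniz_extension B br
  for B :: "complex set" and br :: "'a::ab_group_add \<Rightarrow> 'a \<Rightarrow> 'a" +
  fixes g :: "'a \<Rightarrow> 'a" and r :: "int poly"
    and a :: complex and p :: "complex poly" and Z :: "complex set" and regular :: "complex \<Rightarrow> bool"
  defines "a \<equiv> of_int (lead_coeff r)"
    and "p \<equiv> map_poly of_int r"
    and "Z \<equiv> {z. poly p z = 0}"
    and "regular \<equiv> \<lambda>x. x \<in> add_span B \<and> (\<forall>V :: complex \<Rightarrow> 'a. V \<in> car \<longrightarrow> sc x V = 0 \<longrightarrow> V = 0)"
  assumes g_add: "g (u + v) = g u + g v"
    and g_br: "g (br u v) = br (g u) (g v)"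
    and annihilated: "(\<Sum>i\<le>degree r. zsmult (coeff r i) ((g ^^ i) v)) = 0"
    and degree_pos: "degree r > 0"
    and root_mem: "z \<in> Z \<Longrightarrow> a * z \<in> add_span B"
    and regular_lead: "regular a"
    and regular_diff: "x \<in> Z \<Longrightarrow> y \<in> Z \<Longrightarrow> x \<noteq> y \<Longrightarrow> regular (a * x - a * y)"
    and regular_value: "x \<in> Z \<Longrightarrow> y \<in> Z \<Longrightarrow> x * y \<notin> Z \<Longrightarrow> regular (a ^ (2 * degree r) * poly p (x * y))"
    and roots_free: "x \<in> Z \<Longrightarrow> y \<in> Z \<Longrightarrow> \<exists>k::nat. x * y ^ k \<notin> Z"
    and zero_one: "0 \<notin> Z" "1 \<notin> Z"
begin

sublocale ext: leibniz_ring brx by (rule leibniz_ring_brx)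

lemma regular_mem: "regular x \<Longrightarrow> x \<in> R"
  and regularD: "regular x \<Longrightarrow> V \<in> car \<Longrightarrow> sc x V = 0 \<Longrightarrow> V = 0" for V :: "complex \<Rightarrow> 'a"
  unfolding regular_def by blast+

lemma regularI: "x \<in> R \<Longrightarrow> (\<And>V :: complex \<Rightarrow> 'a. V \<in> car \<Longrightarrow> sc x V = 0 \<Longrightarrow> V = 0) \<Longrightarrow> regular x"
  unfolding regular_def by blast

lemma regular_mult:
  assumes "regular x" "regular y" shows "regular (x * y)"
proof (rule regularI)
  show "x * y \<in> R" by (intro mult_mem regular_mem assms)
  fix V :: "complex \<Rightarrow> 'a" assume V: "V \<in> car" "sc (x * y) V = 0"
  then have "sc x (sc y V) = 0" by (simp only: sc_mult[OF regular_mem regular_mem, OF assms])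
  then have "sc y V = 0" by (rule regularD[OF assms(1) sc_car])
  then show "V = 0" by (rule regularD[OF assms(2) V(1)])
qed

lemma regular_one: "regular 1"
proof (rule regularI[OF one_mem])
  fix V :: "complex \<Rightarrow> 'a" assume "V \<in> car" "sc 1 V = 0"
  then show "V = 0" by (simp only: sc_one)
qed

lemma regular_prod: "(\<And>i. i \<in> I \<Longrightarrow> regular (f i)) \<Longrightarrow> regular (prod f I)"
  by (induction I rule: infinite_finite_induct) (auto intro: regular_one regular_mult)

lemma regular_power: "regular x \<Longrightarrow> regular (x ^ n)"
  by (induction n) (auto intro: regular_one regular_mult)

lemma a_mem: "a \<in> R"
  unfolding a_def by (rule of_int_mem)

lemma g_zero: "g 0 = 0"
  using g_add[of 0 0] by simp

lemma sc_sum_left: "finite I \<Longrightarrow> (\<And>i. i \<in> I \<Longrightarrow> f i \<in> R) \<Longrightarrow> sc (\<Sum>i\<in>I. f i) V = (\<Sum>i\<in>I. sc (f i) V)"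
  by (induction I rule: finite_induct) (simp_all add: sc_add_left sum_mem)

definition gx :: "(complex \<Rightarrow> 'a) \<Rightarrow> complex \<Rightarrow> 'a" where
  "gx V = g \<circ> V"

lemma gx_add: "gx (V + W) = gx V + gx W"
  by (auto simp: gx_def g_add plus_fun_apply)

lemma gx_car: "V \<in> car \<Longrightarrow> gx V \<in> car"
  by (auto simp: gx_def car_def g_zero)

lemma gx_sc: "gx (sc x V) = sc x (gx V)"
  unfolding gx_def using sc_map[of g x V] g_add by simp

lemma gx_brx: "gx (brx V W) = brx (gx V) (gx W)"
  unfolding gx_def using brx_map[of g V W] g_add g_br by simp

lemma gx_zero [simp]: "gx 0 = 0"
  using gx_add[of 0 0] by simp

lemma gx_diff: "gx (V - W) = gx V - gx W"
  using gx_add[of "V - W" W] by (simp add: algebra_simps)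

lemma gx_sum: "gx (\<Sum>i\<in>I. f i) = (\<Sum>i\<in>I. gx (f i))"
  by (rule additive_sum[of gx]) (rule gx_add)

lemma gx_funpow_car: "V \<in> car \<Longrightarrow> (gx ^^ n) V \<in> car"
  by (induction n) (auto intro: gx_car)

lemma gx_annihilated:
  assumes "V \<in> car" shows "(\<Sum>i\<le>degree r. sc (of_int (coeff r i)) ((gx ^^ i) V)) = 0"
proof
  fix b
  have "(gx ^^ i) V b = (g ^^ i) (V b)" for i by (induction i) (simp_all add: gx_def)
  then show "(\<Sum>i\<le>degree r. sc (of_int (coeff r i)) ((gx ^^ i) V)) b = 0 b"
    using annihilated[of "V b"] assms by (simp add: sum_fun_apply sc_of_int gx_funpow_car zero_fun_apply)
qed

text \<open>The operator \<open>c * g - m\<close>. The scale \<open>c\<close> is \<open>a\<close> on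
  eigenspaces and \<open>a * a\<close> on products of two eigenvectors.\<close>

definition opr :: "complex \<Rightarrow> complex \<Rightarrow> (complex \<Rightarrow> 'a) \<Rightarrow> complex \<Rightarrow> 'a" where
  "opr c m V = sc c (gx V) - sc m V"

lemma opr_car: "opr c m V \<in> car"
  unfolding opr_def by (intro subgrp_diff[OF subgrp_car] sc_car)

lemma opr_funpow_car: "V \<in> car \<Longrightarrow> (opr c m ^^ n) V \<in> car"
  by (induction n) (auto intro: opr_car)

lemma opr_add: "opr c m (V + W) = opr c m V + opr c m W"
  by (simp add: opr_def gx_add sc_add_right)

lemma opr_funpow_add: "(opr c m ^^ n) (V + W) = (opr c m ^^ n) V + (opr c m ^^ n) W"
  by (induction n) (simp_all add: opr_add)

lemma opr_funpow_diff: "(opr c m ^^ n) (V - W) = (opr c m ^^ n) V - (opr c m ^^ n) W"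
  using opr_funpow_add[where V = "V - W" and W = W] by (simp add: algebra_simps)

lemma opr_funpow_zero [simp]: "(opr c m ^^ n) 0 = 0"
  using opr_funpow_diff[where V = 0 and W = 0] by simp

lemma opr_sc: "x \<in> R \<Longrightarrow> c \<in> R \<Longrightarrow> m \<in> R \<Longrightarrow> opr c m (sc x V) = sc x (opr c m V)"
  by (simp add: opr_def gx_sc sc_diff_right sc_commute[of x])

lemma opr_gx: "opr c m (gx V) = gx (opr c m V)"
  by (simp add: opr_def gx_sc gx_diff)

lemma opr_opr: "c \<in> R \<Longrightarrow> m \<in> R \<Longrightarrow> c' \<in> R \<Longrightarrow> m' \<in> R \<Longrightarrow> opr c m (opr c' m' V) = opr c' m' (opr c m V)"
proof -
  assume "c \<in> R" "m \<in> R" "c' \<in> R" "m' \<in> R"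
  then have "opr c m (opr c' m' V) = sc c' (gx (opr c m V)) - sc m' (opr c m V)"
    unfolding opr_def[of c' m' V] opr_def[of c m "_ - _"]
    by (simp add: gx_diff sc_diff_right opr_def gx_sc sc_commute[of c] sc_commute[of m])
  then show ?thesis by (simp add: opr_def[of c' m'])
qed

lemma funpow_opr_sc:
  "x \<in> R \<Longrightarrow> c \<in> R \<Longrightarrow> m \<in> R \<Longrightarrow> (opr c m ^^ n) (sc x V) = sc x ((opr c m ^^ n) V)"
  by (rule funpow_commute[symmetric]) (simp add: opr_sc)

lemma funpow_opr_gx: "(opr c m ^^ n) (gx V) = gx ((opr c m ^^ n) V)"
  by (rule funpow_commute[symmetric]) (simp add: opr_gx)

lemma opr_brx:
  assumes "x \<in> R" "y \<in> R"
  shows "opr (a * a) (x * y) (brx V W) = brx (opr a x V) (sc a (gx W)) + brx (sc x V) (opr a y W)"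
  using assms a_mem
  by (simp add: opr_def ext.br_diff_left ext.br_diff_right gx_brx sc_mult brx_sc_left brx_sc_right sc_commute[of y])

text \<open>By \<open>opr_brx\<close>, each application lowers the nilpotency order of one argument.
  The other argument is only altered by scalars and \<open>gx\<close>, which commute with the
  operators and so do not raise its order.\<close>

lemma opr_brx_nilpotent:
  assumes xy: "x \<in> R" "y \<in> R"
    and "(opr a x ^^ M) V = 0" "(opr a y ^^ N) W = 0"
  shows "(opr (a * a) (x * y) ^^ (M + N)) (brx V W) = 0"
  using assms(3,4)
proof (induction "M + N" arbitrary: M N V W)
  case 0
  then show ?case by simp
next
  case (Suc n)
  show ?case
  proof (cases "M = 0 \<or> N = 0")
    case True
    then show ?thesis using Suc.prems by auto
  next
    case False
    then obtain M' N' where MN: "M = Suc M'" "N = Suc N'" by (meson not0_implies_Suc)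
    let ?o = "opr (a * a) (x * y)"
    have "(?o ^^ (M' + N)) (brx (opr a x V) (sc a (gx W))) = 0"
    proof (rule Suc.hyps)
      show "(opr a x ^^ M') (opr a x V) = 0"
        using Suc.prems(1) unfolding MN by (simp only: funpow_Suc_right o_def)
      show "(opr a y ^^ N) (sc a (gx W)) = 0"
        using Suc.prems(2) xy a_mem by (simp add: funpow_opr_sc funpow_opr_gx)
    qed (use Suc.hyps(2) MN in simp)
    moreover have "(?o ^^ (M + N')) (brx (sc x V) (opr a y W)) = 0"
    proof (rule Suc.hyps)
      show "(opr a y ^^ N') (opr a y W) = 0"
        using Suc.prems(2) unfolding MN by (simp only: funpow_Suc_right o_def)
      show "(opr a x ^^ M) (sc x V) = 0"
        using Suc.prems(1) xy a_mem by (simp add: funpow_opr_sc)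
    qed (use Suc.hyps(2) MN in simp)
    moreover have "M + N = Suc (M' + N)" "M + N' = M' + N" using MN by auto
    ultimately show ?thesis
      using opr_brx[OF xy, of V W] by (simp only: funpow_Suc_right o_def opr_funpow_add add_0)
  qed
qed

text \<open>A vector killed by the operator is an eigenvector for \<open>mu\<close>, on which the
  annihilating polynomial acts as \<open>a ^ (2 * degree r) * poly p mu\<close>. As this is regular,
  the vector is zero, and \<open>N\<close> descends to 0.\<close>

lemma opr_eigen_zero:
  assumes W: "W \<in> car" and m: "m = a * a * mu" "m \<in> R"
    and reg: "regular (a ^ (2 * degree r) * poly p mu)"
    and "(opr (a * a) m ^^ N) W = 0"
  shows "W = 0"
  using assms(5)
proof (induction N)
  case 0
  then show ?case by simp
next
  case (Suc N)
  define U where "U = (opr (a * a) m ^^ N) W"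
  define d where "d = degree r"
  have U: "U \<in> car" unfolding U_def by (rule opr_funpow_car[OF W])
  have aa: "a * a \<in> R" using a_mem by (intro mult_mem)
  have "opr (a * a) m U = 0" using Suc.prems by (simp add: U_def)
  then have e: "sc (a * a) (gx U) = sc m U" by (simp add: opr_def)
  have pw: "sc ((a * a) ^ i) ((gx ^^ i) U) = sc (m ^ i) U" for i
  proof (induction i)
    case 0
    then show ?case by simp
  next
    case (Suc i)
    have "sc ((a * a) ^ Suc i) ((gx ^^ Suc i) U) = sc (a * a) (gx (sc ((a * a) ^ i) ((gx ^^ i) U)))"
      by (simp only: gx_sc power_Suc sc_mult[OF aa power_mem[OF aa]] funpow.simps o_def)
    also have "\<dots> = sc (m ^ i) (sc (a * a) (gx U))"
      by (simp only: Suc gx_sc sc_commute[OF aa power_mem[OF m(2)]])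
    also have "\<dots> = sc (m ^ Suc i) U" by (simp only: e power_Suc2 sc_mult[OF power_mem[OF m(2)] m(2)])
    finally show ?case .
  qed
  \<comment> \<open>Only \<open>m = a * a * mu\<close> is known to lie in the ring, not
    \<open>mu\<close>; so the powers of \<open>a\<close> are regrouped until each scalar is visibly
    in \<open>R\<close>.\<close>
  have trm: "sc ((a * a) ^ d) (sc (of_int (coeff r i)) ((gx ^^ i) U)) =
      sc ((a * a) ^ d * (of_int (coeff r i) * mu ^ i)) U" if "i \<le> d" for i
  proof -
    let ?c = "of_int (coeff r i) * (a * a) ^ (d - i)"
    have c: "?c \<in> R" by (rule mult_mem[OF of_int_mem power_mem[OF aa]])
    have "(a * a) ^ d * of_int (coeff r i) = ?c * (a * a) ^ i"
      using that by (simp add: mult_ac flip: power_add)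
    then have "sc ((a * a) ^ d) (sc (of_int (coeff r i)) ((gx ^^ i) U)) = sc ?c (sc ((a * a) ^ i) ((gx ^^ i) U))"
      by (simp only: sc_mult[OF c power_mem[OF aa], symmetric] sc_mult[OF power_mem[OF aa] of_int_mem, symmetric])
    also have "\<dots> = sc (?c * m ^ i) U"
      by (simp only: pw sc_mult[OF c power_mem[OF m(2)]])
    also have "(of_int (coeff r i) * (a * a) ^ (d - i)) * m ^ i = (a * a) ^ d * (of_int (coeff r i) * mu ^ i)"
      using that by (simp add: m(1) power_mult_distrib mult_ac flip: power_add)
    finally show ?thesis .
  qed
  have mem: "(a * a) ^ d * (of_int (coeff r i) * mu ^ i) \<in> R" if "i \<le> d" for i
  proof -
    have "(of_int (coeff r i) * (a * a) ^ (d - i)) * m ^ i = (a * a) ^ d * (of_int (coeff r i) * mu ^ i)"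
      using that by (simp add: m(1) power_mult_distrib mult_ac flip: power_add)
    moreover have "(of_int (coeff r i) * (a * a) ^ (d - i)) * m ^ i \<in> R"
      by (rule mult_mem[OF mult_mem[OF of_int_mem power_mem[OF aa]] power_mem[OF m(2)]])
    ultimately show ?thesis by (simp only:)
  qed
  have "0 = sc ((a * a) ^ d) (\<Sum>i\<le>d. sc (of_int (coeff r i)) ((gx ^^ i) U))"
    using gx_annihilated[OF U] by (simp add: d_def)
  also have "\<dots> = (\<Sum>i\<le>d. sc ((a * a) ^ d * (of_int (coeff r i) * mu ^ i)) U)"
    unfolding sc_sum_right by (intro sum.cong) (simp_all add: trm)
  also have "\<dots> = sc (\<Sum>i\<le>d. (a * a) ^ d * (of_int (coeff r i) * mu ^ i)) U"
    by (rule sc_sum_left[symmetric]) (use mem in auto)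
  also have "(\<Sum>i\<le>d. (a * a) ^ d * (of_int (coeff r i) * mu ^ i)) = a ^ (2 * degree r) * poly p mu"
    by (simp add: p_def poly_altdef degree_map_poly coeff_map_poly d_def sum_distrib_left power2_eq_square power_mult)
  finally have "sc (a ^ (2 * degree r) * poly p mu) U = 0" by (rule sym)
  then have "U = 0" by (rule regularD[OF reg U])
  then show ?case using Suc.IH by (simp add: U_def)
qed

definition eig :: "complex \<Rightarrow> (complex \<Rightarrow> 'a) set" where
  "eig x = (if x \<in> Z then {V \<in> car. \<exists>N. (opr a (a * x) ^^ N) V = 0} else {0})"

lemma funpow_opr_mono: "(opr c m ^^ M) V = 0 \<Longrightarrow> M \<le> N \<Longrightarrow> (opr c m ^^ N) V = 0"
  using funpow_add[of "N - M" M "opr c m"] by simp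

lemma subgrp_eig: "subgrp (eig x)"
proof (cases "x \<in> Z")
  case True
  show ?thesis unfolding subgrp_def
  proof (intro conjI ballI)
    show "0 \<in> eig x" using True subgrp_zero[OF subgrp_car] by (auto simp: eig_def)
    fix V W assume "V \<in> eig x" "W \<in> eig x"
    then obtain M N where "V \<in> car" "W \<in> car" "(opr a (a * x) ^^ M) V = 0" "(opr a (a * x) ^^ N) W = 0"
      using True unfolding eig_def by (simp only: if_True) blast
    note VW = this
    have "(opr a (a * x) ^^ max M N) V = 0" "(opr a (a * x) ^^ max M N) W = 0"
      by (rule funpow_opr_mono[OF VW(3)], simp, rule funpow_opr_mono[OF VW(4)], simp)
    then have "(opr a (a * x) ^^ max M N) (V - W) = 0" unfolding opr_funpow_diff by simp
    moreover have "V - W \<in> car" by (rule subgrp_diff[OF subgrp_car VW(1,2)])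
    ultimately show "V - W \<in> eig x" using True unfolding eig_def by (simp only: if_True) blast
  qed
next
  case False
  then show ?thesis by (simp add: eig_def subgrp_singleton_zero)
qed

lemma eig_sc: "c \<in> R \<Longrightarrow> V \<in> eig x \<Longrightarrow> sc c V \<in> eig x"
proof (cases "x \<in> Z")
  case True
  assume c: "c \<in> R" and "V \<in> eig x"
  then obtain N where "(opr a (a * x) ^^ N) V = 0" using True unfolding eig_def by auto
  then have "(opr a (a * x) ^^ N) (sc c V) = 0"
    using funpow_opr_sc[OF c a_mem root_mem[OF True]] by simp
  then show ?thesis using True sc_car unfolding eig_def by auto
qed (simp add: eig_def)

text \<open>If \<open>x * y\<close> is a root, the operator at scale \<open>a * a\<close> is
  \<open>a\<close> times the one defining \<open>eig (x * y)\<close>, and \<open>a\<close> is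
  cancelled; otherwise the bracket vanishes by \<open>opr_eigen_zero\<close>.\<close>

lemma eig_brx:
  assumes "V \<in> eig x" "W \<in> eig y"
  shows "brx V W \<in> eig (x * y)"
proof (cases "x \<in> Z \<and> y \<in> Z")
  case True
  then obtain M N where MN: "(opr a (a * x) ^^ M) V = 0" "(opr a (a * y) ^^ N) W = 0"
    using assms by (auto simp: eig_def)
  define m where "m = (a * x) * (a * y)"
  have mem: "a * x \<in> R" "a * y \<in> R" "m \<in> R" using True by (auto simp: m_def intro: root_mem mult_mem)
  have nil: "(opr (a * a) m ^^ (M + N)) (brx V W) = 0"
    unfolding m_def by (rule opr_brx_nilpotent[OF mem(1,2) MN])
  have m: "m = a * a * (x * y)" by (simp add: m_def)
  show ?thesis
  proof (cases "x * y \<in> Z")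
    case xy: True
    have o: "opr (a * a) m U = sc a (opr a (a * (x * y)) U)" for U
      unfolding m using a_mem root_mem[OF xy]
      by (simp add: opr_def sc_diff_right flip: sc_mult) (simp add: mult.assoc)
    have "(opr (a * a) m ^^ n) U = sc (a ^ n) ((opr a (a * (x * y)) ^^ n) U)" if "U \<in> car" for n U
    proof (induction n)
      case 0
      then show ?case using that by (simp add: sc_one)
    next
      case (Suc n)
      then show ?case
        using a_mem root_mem[OF xy] by (simp add: o opr_sc sc_mult power_mem)
    qed
    then have "sc (a ^ (M + N)) ((opr a (a * (x * y)) ^^ (M + N)) (brx V W)) = 0"
      using nil brx_car by metis
    moreover have "(opr a (a * (x * y)) ^^ (M + N)) (brx V W) \<in> car"
      by (intro opr_funpow_car brx_car)
    ultimately have "(opr a (a * (x * y)) ^^ (M + N)) (brx V W) = 0"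
      using regularD[OF regular_power[OF regular_lead]] by blast
    then show ?thesis using xy brx_car by (auto simp: eig_def)
  next
    case False
    then have "brx V W = 0"
      using opr_eigen_zero[OF brx_car m mem(3) regular_value nil] True by blast
    then show ?thesis using False by (simp add: eig_def)
  qed
next
  case False
  then have "V = 0 \<or> W = 0" using assms by (auto simp: eig_def)
  then have "brx V W = 0" by auto
  then show ?thesis using subgrp_zero[OF subgrp_eig] by simp
qed

lemma p_nonzero: "p \<noteq> 0"
  using degree_pos by (auto simp: p_def map_poly_eq_0_iff)

lemma degree_p: "degree p = degree r" and lead_p: "lead_coeff p = a"
  by (simp_all add: p_def a_def degree_map_poly coeff_map_poly)

lemma finite_Z: "finite Z"
  unfolding Z_def by (rule poly_roots_finite[OF p_nonzero])

sublocale graded: graded_leibniz_ring brx Z circle_key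
proof
  show "finite Z" by (rule finite_Z)
  show "inj_on circle_key Z" by (rule inj_on_subset[OF inj_on_circle_key]) (use zero_one in auto)
  show "\<exists>k::nat. x * y ^ k \<notin> Z" if "x \<in> Z" "y \<in> Z" for x y using that by (rule roots_free)
  show "(circle_key (x * y) < circle_key x \<and> circle_key (x * y) < circle_key y) \<or>
    (circle_key x < circle_key (x * y) \<and> circle_key y < circle_key (x * y))"
    if "x \<in> Z" "y \<in> Z" "x * y \<in> Z" for x y
    using that zero_one by (intro circle_key_mult) auto
qed

lemma grading_eig: "graded.grading eig"
  unfolding graded.grading_def
proof (intro conjI allI impI)
  show "eig x = {0}" if "x \<notin> Z" for x using that by (simp add: eig_def)
qed (rule subgrp_eig eig_brx, assumption?)+

section \<open>The extension as a sum of eigenspaces, up to a regular factor\<close>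

definition ev :: "complex poly \<Rightarrow> (complex \<Rightarrow> 'a) \<Rightarrow> complex \<Rightarrow> 'a" where
  "ev q V = (\<Sum>i\<le>degree q. sc (coeff q i) ((gx ^^ i) V))"

lemma ev_bound: "degree q \<le> n \<Longrightarrow> ev q V = (\<Sum>i\<le>n. sc (coeff q i) ((gx ^^ i) V))"
  unfolding ev_def by (rule sum.mono_neutral_left) (auto simp: coeff_eq_0)

lemma ev_opr:
  assumes q: "\<And>i. coeff q i \<in> R" and "c \<in> R" "m \<in> R"
  shows "ev ([:-m, c:] * q) V = opr c m (ev q V)"
proof -
  define n where "n = degree q"
  have cf: "coeff ([:-m, c:] * q) i = (case i of 0 \<Rightarrow> 0 | Suc j \<Rightarrow> c * coeff q j) - m * coeff q i" for i
    by (cases i) (simp_all add: algebra_simps)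
  have "degree ([:-m, c:] * q) \<le> Suc n"
    using degree_mult_le[of "[:-m, c:]" q] by (simp add: n_def split: if_splits)
  then have "ev ([:-m, c:] * q) V = (\<Sum>i\<le>Suc n. sc (coeff ([:-m, c:] * q) i) ((gx ^^ i) V))"
    by (rule ev_bound)
  also have "\<dots> = (\<Sum>i\<le>Suc n. sc (case i of 0 \<Rightarrow> 0 | Suc j \<Rightarrow> c * coeff q j) ((gx ^^ i) V)) -
      (\<Sum>i\<le>Suc n. sc (m * coeff q i) ((gx ^^ i) V))"
    unfolding cf sum_subtractf[symmetric] using assms of_int_mem[of 0]
    by (intro sum.cong sc_diff_left refl) (auto intro: mult_mem split: nat.splits)
  also have "(\<Sum>i\<le>Suc n. sc (case i of 0 \<Rightarrow> 0 | Suc j \<Rightarrow> c * coeff q j) ((gx ^^ i) V)) =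
      (\<Sum>j\<le>n. sc (c * coeff q j) ((gx ^^ Suc j) V))"
    by (subst sum.atMost_Suc_shift) simp
  also have "\<dots> = sc c (gx (ev q V))"
    unfolding ev_def n_def[symmetric] gx_sum sc_sum_right gx_sc using assms
    by (intro sum.cong) (simp_all add: sc_mult)
  also have "(\<Sum>i\<le>Suc n. sc (m * coeff q i) ((gx ^^ i) V)) = sc m (ev q V)"
    using assms by (subst ev_bound[of q "Suc n"]) (simp_all add: n_def sc_sum_right sc_add_right sc_mult cong: sum.cong)
  finally show ?thesis by (simp add: opr_def)
qed

definition opl :: "complex list \<Rightarrow> (complex \<Rightarrow> 'a) \<Rightarrow> complex \<Rightarrow> 'a" where
  "opl zs V = foldr (\<lambda>z. opr a (a * z)) zs V"

lemma opl_simps [simp]: "opl [] V = V" "opl (z # zs) V = opr a (a * z) (opl zs V)"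
  by (simp_all add: opl_def)

lemma opl_eq_ev:
  assumes "V \<in> car" "set zs \<subseteq> Z"
  shows "(\<forall>i. coeff (\<Prod>z\<leftarrow>zs. [:- (a * z), a:]) i \<in> R) \<and> opl zs V = ev (\<Prod>z\<leftarrow>zs. [:- (a * z), a:]) V"
  using assms(2)
proof (induction zs)
  case Nil
  then show ?case using assms(1) one_mem of_int_mem[of 0] by (auto simp: ev_def sc_one coeff_1)
next
  case (Cons z zs)
  let ?q = "\<Prod>z\<leftarrow>zs. [:- (a * z), a:]"
  have IH: "coeff ?q i \<in> R" "opl zs V = ev ?q V" for i using Cons by auto
  have az: "a * z \<in> R" using Cons.prems root_mem by auto
  have "coeff ([:- (a * z), a:] * ?q) i \<in> R" for i
  proof -
    have "coeff ([:- (a * z), a:] * ?q) i = (case i of 0 \<Rightarrow> 0 | Suc j \<Rightarrow> a * coeff ?q j) - (a * z) * coeff ?q i"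
      by (cases i) simp_all
    also have "\<dots> \<in> R"
      using of_int_mem[of 0] IH(1) a_mem
      by (intro diff_mem mult_mem[OF az IH(1)]) (auto intro: mult_mem split: nat.splits)
    finally show ?thesis .
  qed
  moreover have "opl (z # zs) V = ev ([:- (a * z), a:] * ?q) V"
    using ev_opr[OF IH(1) a_mem az] IH(2) by simp
  ultimately show ?case by simp
qed

text \<open>Taken over the roots with multiplicity, the product of the \<open>a * X - a * z\<close>
  is \<open>a ^ (degree r - 1) * p\<close>: one of the factors \<open>a\<close> is the leading
  coefficient of \<open>p\<close>.\<close>

lemma opl_roots_zero:
  obtains zs where "set zs \<subseteq> Z" "\<And>V. V \<in> car \<Longrightarrow> opl zs V = 0"
proof -
  obtain zs where zs: "mset zs = proots p" using ex_mset by blast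
  have "set zs = set_mset (proots p)" using zs by (metis set_mset_mset)
  then have Z: "set zs = Z" using p_nonzero by (simp add: Z_def)
  have "length zs = size (proots p)" by (metis zs size_mset)
  then have len: "length zs = degree r" by (simp add: size_proots_complex degree_p)
  have "(\<Prod>z\<leftarrow>zs. [:- (a * z), a:]) = smult (a ^ length zs) (\<Prod>z\<leftarrow>zs. [:- z, 1:])"
  proof (induction zs)
    case (Cons z zs)
    have "[:- (a * z), a:] = smult a [:- z, 1:]" by simp
    then show ?case
      by (simp only: list.map prod_list.Cons Cons mult_smult_left mult_smult_right smult_smult length_Cons power_Suc2)
  qed simp
  also have "(\<Prod>z\<leftarrow>zs. [:- z, 1:]) = (\<Prod>z\<in>#proots p. [:- z, 1:])"
    by (simp flip: zs mset_map add: prod_mset_prod_list)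
  also have "smult (a ^ length zs) \<dots> = smult (a ^ (degree r - 1)) p"
  proof -
    have "a ^ length zs = a ^ (degree r - 1) * a"
      using degree_pos by (simp add: len flip: power_Suc2)
    then show ?thesis
      using complex_poly_decompose_multiset[of p] by (simp add: lead_p flip: smult_smult)
  qed
  finally have q: "(\<Prod>z\<leftarrow>zs. [:- (a * z), a:]) = smult (a ^ (degree r - 1)) p" .
  have "opl zs V = 0" if "V \<in> car" for V
  proof -
    have "opl zs V = ev (smult (a ^ (degree r - 1)) p) V"
      using opl_eq_ev[OF that, of zs] Z q by simp
    also have "\<dots> = (\<Sum>i\<le>degree r. sc (a ^ (degree r - 1) * of_int (coeff r i)) ((gx ^^ i) V))"
      by (subst ev_bound[of _ "degree r"]) (simp_all add: degree_p p_def coeff_map_poly degree_map_poly)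
    also have "\<dots> = sc (a ^ (degree r - 1)) (\<Sum>i\<le>degree r. sc (of_int (coeff r i)) ((gx ^^ i) V))"
      unfolding sc_sum_right using a_mem
      by (intro sum.cong) (simp_all add: sc_mult power_mem of_int_mem)
    finally show ?thesis using gx_annihilated[OF that] by simp
  qed
  then show ?thesis using that Z by blast
qed

lemma opl_remove1:
  assumes "z \<in> set zs" "set zs \<subseteq> Z"
  shows "opl zs V = opl (remove1 z zs) (opr a (a * z) V)"
  using assms
proof (induction zs)
  case (Cons y zs)
  have commute: "opl zs (opr a (a * y) V) = opr a (a * y) (opl zs V)" if "set zs \<subseteq> Z" "y \<in> Z" for zs y
    using that by (induction zs) (auto simp: opr_opr a_mem root_mem)
  show ?case
  proof (cases "y = z")
    case True
    then show ?thesis using Cons.prems by (simp add: commute)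
  next
    case False
    then show ?thesis using Cons by auto
  qed
qed simp

definition disc :: complex where
  "disc = (\<Prod>(x, y)\<in>{(x, y). x \<in> Z \<and> y \<in> Z \<and> x \<noteq> y}. a * x - a * y)"

lemma finite_pairs: "finite {(x, y). x \<in> Z \<and> y \<in> Z \<and> x \<noteq> y}"
  by (rule finite_subset[of _ "Z \<times> Z"]) (auto simp: finite_Z)

lemma regular_disc: "regular disc"
  unfolding disc_def by (rule regular_prod) (auto intro: regular_diff)

lemma disc_factor:
  assumes "x \<in> Z" "y \<in> Z" "x \<noteq> y"
  obtains e where "e \<in> R" "disc = e * (a * x - a * y)"
proof -
  let ?P = "{(x, y). x \<in> Z \<and> y \<in> Z \<and> x \<noteq> y}"
  have "disc = (\<Prod>(x, y)\<in>?P - {(x, y)}. a * x - a * y) * (a * x - a * y)"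
    unfolding disc_def using prod.remove[OF finite_pairs, of "(x, y)" "\<lambda>(x, y). a * x - a * y"] assms by (simp add: mult.commute)
  moreover have "(\<Prod>(x, y)\<in>?P - {(x, y)}. a * x - a * y) \<in> R"
    by (rule prod_mem) (auto intro!: diff_mem root_mem)
  ultimately show ?thesis by (rule that[rotated])
qed

lemma hspan_eig_sc: "c \<in> R \<Longrightarrow> V \<in> graded.hspan eig \<Longrightarrow> sc c V \<in> graded.hspan eig"
proof -
  assume c: "c \<in> R" and V: "V \<in> graded.hspan eig"
  have "graded.hspan eig \<subseteq> {V. sc c V \<in> graded.hspan eig}"
  proof (subst (1) graded.hspan_def, intro add_span_minimal subgrp_vimage graded.subgrp_hspan sc_add_right)
    show "(\<Union>x. eig x) \<subseteq> {V. sc c V \<in> graded.hspan eig}"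
      using graded.hspanI[of _ eig] eig_sc[OF c] by auto
  qed
  then show ?thesis using V by blast
qed

text \<open>For two different roots in the list, \<open>(a * z - a * y) * V\<close> is the
  difference of the images of \<open>V\<close> under the operators for \<open>y\<close> and
  \<open>z\<close>. Each image is killed by a list shorter by one, and \<open>disc\<close> is a
  multiple of \<open>a * z - a * y\<close>, so every removal costs one factor
  \<open>disc\<close>.\<close>

lemma disc_power_hspan:
  assumes "V \<in> car" "set zs \<subseteq> Z" "opl zs V = 0"
  shows "sc (disc ^ length zs) V \<in> graded.hspan eig"
  using assms
proof (induction "length zs" arbitrary: zs V)
  case 0
  then show ?case using subgrp_zero[OF graded.subgrp_hspan] by simp
next
  case (Suc n)
  have disc: "disc \<in> R" by (rule regular_mem[OF regular_disc])
  obtain z where z: "z \<in> set zs" using Suc.hyps(2) by (cases zs) auto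
  show ?case
  \<comment> \<open>Without a second root, \<open>opl zs\<close> is a power of a single operator, so
    \<open>V\<close> is a generalised eigenvector.\<close>
  proof (cases "\<exists>y\<in>set zs. y \<noteq> z")
    case False
    have "opl zs V = (opr a (a * z) ^^ length zs) V"
      using False by (induction zs) auto
    then have "V \<in> eig z" using Suc.prems z by (auto simp: eig_def)
    then show ?thesis by (intro graded.hspanI[of _ eig z] eig_sc power_mem disc)
  next
    case True
    then obtain y where y: "y \<in> set zs" "y \<noteq> z" by blast
    have IH: "sc (disc ^ n) (opr a (a * x) V) \<in> graded.hspan eig" if "x \<in> set zs" for x
    proof -
      have "length (remove1 x zs) = n" using that Suc.hyps(2) by (simp add: length_remove1)
      moreover have "set (remove1 x zs) \<subseteq> Z" using Suc.prems(2) set_remove1_subset[of x zs] by blast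
      ultimately show ?thesis
        using Suc.hyps(1)[of "remove1 x zs" "opr a (a * x) V"] opr_car opl_remove1[OF that Suc.prems(2), of V] Suc.prems(3)
        by simp
    qed
    obtain e where e: "e \<in> R" "disc = e * (a * z - a * y)"
      using disc_factor[of z y] y z Suc.prems(2) by blast
    have mem: "a * z \<in> R" "a * y \<in> R" using y z Suc.prems(2) by (auto intro: root_mem)
    have "sc (a * z - a * y) V = opr a (a * y) V - opr a (a * z) V"
      using mem by (simp add: opr_def sc_diff_left)
    then have "sc e (sc (disc ^ n) (sc (a * z - a * y) V)) =
        sc e (sc (disc ^ n) (opr a (a * y) V) - sc (disc ^ n) (opr a (a * z) V))"
      by (simp add: sc_diff_right)
    also have "\<dots> \<in> graded.hspan eig"
      by (intro hspan_eig_sc e subgrp_diff[OF graded.subgrp_hspan] IH y z)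
    also have "sc e (sc (disc ^ n) (sc (a * z - a * y) V)) = sc (disc ^ length zs) V"
    proof -
      have "disc ^ length zs = e * (disc ^ n * (a * z - a * y))"
        using e(2) by (simp add: mult_ac flip: Suc.hyps(2))
      then show ?thesis using e(1) mem disc by (simp add: sc_mult mult_mem diff_mem power_mem)
    qed
    finally show ?thesis .
  qed
qed

theorem nilpotent: "lcs br (Suc (degree r ^ (2 ^ degree r))) = {0}"
proof -
  obtain zs where zs: "set zs \<subseteq> Z" "\<And>V. V \<in> car \<Longrightarrow> opl zs V = 0" by (rule opl_roots_zero) (rule that)
  define D where "D = disc ^ length zs"
  have regD: "regular D" unfolding D_def by (intro regular_power regular_disc)
  then have D: "D \<in> R" by (rule regular_mem)
  define S where "S n = add_span (\<Union>b. graded.lower eig n b)" for n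
  have S: "subgrp (S n)" for n unfolding S_def by (rule subgrp_add_span)
  \<comment> \<open>Each of the \<open>n + 1\<close> factors of a commutator needs its own
    \<open>D\<close>. The indices differ by one because \<open>lower\<close> starts at 0 and
    \<open>lcs\<close> at 1.\<close>
  have lcs: "sc (D ^ Suc n) (tens u 1) \<in> S n" if "u \<in> lcs br (Suc n)" for u n
    using that
  proof (induction n arbitrary: u)
    case 0
    have "sc D (tens u 1) \<in> graded.hspan eig"
      unfolding D_def by (intro disc_power_hspan zs tens_car)
    then show ?case by (simp add: S_def graded.hspan_def)
  next
    case (Suc n)
    have "lcs br (Suc (Suc n)) \<subseteq> {u. sc (D ^ Suc (Suc n)) (tens u 1) \<in> S (Suc n)}"
      unfolding lcs.simps
    proof (intro add_span_minimal subgrp_vimage S)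
      show "{br x y |x y. x \<in> lcs br (Suc n)} \<subseteq> {u. sc (D ^ Suc (Suc n)) (tens u 1) \<in> S (Suc n)}"
      proof safe
        fix x y assume x: "x \<in> lcs br (Suc n)"
        have "sc (D ^ Suc (Suc n)) (tens (br x y) 1) = brx (sc (D ^ Suc n) (tens x 1)) (sc D (tens y 1))"
          unfolding brx_sc_left[OF power_mem[OF D]] brx_sc_right[OF D] brx_tens[OF one_mem one_mem]
            power_Suc2[of D "Suc n"] sc_mult[OF power_mem[OF D] D]
          by (simp only: mult_1_right sc_commute[OF power_mem[OF D] D])
        also have "\<dots> \<in> S (Suc n)"
        proof (rule ext.br_span_closed[OF S])
          show "sc (D ^ Suc n) (tens x 1) \<in> add_span (\<Union>b. graded.lower eig n b)"
            using Suc.IH[OF x] by (simp add: S_def)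
          show "sc D (tens y 1) \<in> add_span (\<Union>b. eig b)"
            using disc_power_hspan[OF tens_car zs(1) zs(2)[OF tens_car]] by (simp add: D_def graded.hspan_def)
          fix U V assume "U \<in> (\<Union>b. graded.lower eig n b)" "V \<in> (\<Union>b. eig b)"
          then obtain b c where "U \<in> graded.lower eig n b" "V \<in> eig c" by blast
          then have "brx U V \<in> graded.lower eig (Suc n) (b * c)" by (rule graded.lower_SucI)
          then show "brx U V \<in> S (Suc n)"
            unfolding S_def by (intro add_span.base) blast
        qed
        finally show "sc (D ^ Suc (Suc n)) (tens (br x y) 1) \<in> S (Suc n)" .
      qed
    qed (simp add: tens_add_left sc_add_right)
    then show ?case using Suc.prems by blast
  qed
  have "\<not> constant (poly p)" using degree_pos by (simp add: constant_degree degree_p)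
  then have Z: "Z \<noteq> {}" using fundamental_theorem_of_algebra by (auto simp: Z_def)
  have "card Z \<le> degree r" using card_poly_roots_bound[OF p_nonzero] by (simp add: Z_def degree_p)
  then have bound: "class_bound (card Z) (2 ^ card Z - 1) \<le> degree r ^ (2 ^ degree r)"
    using Z finite_Z by (intro class_bound_le) (auto simp: Suc_le_eq card_gt_0_iff)
  have "u = 0" if "u \<in> lcs br (Suc (degree r ^ (2 ^ degree r)))" for u
  proof -
    have "S (degree r ^ (2 ^ degree r)) \<subseteq> {0}"
      unfolding S_def graded.lower_trivial[OF grading_eig Z bound]
      by (rule add_span_minimal[OF subgrp_singleton_zero]) auto
    then have "sc (D ^ Suc (degree r ^ (2 ^ degree r))) (tens u 1) = 0" using lcs[OF that] by blast
    then have "tens u 1 = 0" by (rule regularD[OF regular_power[OF regD] tens_car])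
    then show ?thesis by (rule tens_one_inject)
  qed
  moreover have "0 \<in> lcs br (Suc n)" for n by (cases n) (auto intro: add_span.zero)
  ultimately show ?thesis by blast
qed

end

section \<open>Nilpotency\<close>

lemma cpoly_pcompose: "cpoly (pcompose p q) = pcompose (cpoly p) (cpoly q)"
  by (induction p) (simp_all add: pcompose_pCons map_poly_pCons cpoly_add cpoly_mult cpoly_const)

lemma cpoly_of_int: "cpoly (map_poly of_int r) = map_poly of_int r"
  by (rule poly_eqI) (simp add: coeff_map_poly)

text \<open>Multiplying the equation for \<open>z\<close> by the power \<open>degree r - 1\<close>
  of the leading coefficient gives a monic integer equation for \<open>w\<close>.\<close>

lemma lead_mult_root_integral:
  fixes r :: "int poly" and z :: complex
  assumes d: "degree r > 0" and z: "poly (map_poly of_int r) z = 0"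
  defines "w \<equiv> of_int (lead_coeff r) * z"
  shows "w ^ degree r \<in> add_span ((\<lambda>k. w ^ k) ` {..<degree r})"
proof -
  define n where "n = degree r"
  define a where "a = lead_coeff r"
  have term_eq: "of_int (a ^ (n - 1)) * (of_int (coeff r i) * z ^ i) = of_int (coeff r i * a ^ (n - 1 - i)) * w ^ i"
    if "i < n" for i
  proof -
    have "n - 1 = (n - 1 - i) + i" using that by simp
    then have "of_int (a ^ (n - 1)) = (of_int (a ^ (n - 1 - i)) * of_int a ^ i :: complex)"
      by (metis of_int_mult of_int_power power_add)
    then show ?thesis by (simp only: w_def a_def[symmetric] power_mult_distrib of_int_mult mult_ac)
  qed
  have "w ^ n = of_int (a ^ (n - 1)) * (of_int (coeff r n) * z ^ n)"
    using d power_Suc2[of "of_int a :: complex" "n - 1"]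
    by (simp add: w_def a_def n_def power_mult_distrib)
  moreover have "0 = of_int (a ^ (n - 1)) * poly (map_poly of_int r) z" using z by simp
  moreover have "poly (map_poly of_int r) z = (\<Sum>i<n. of_int (coeff r i) * z ^ i) + of_int (coeff r n) * z ^ n"
    by (simp add: poly_altdef degree_map_poly coeff_map_poly n_def lessThan_Suc_atMost[symmetric])
  ultimately have "w ^ n = - (\<Sum>i<n. of_int (a ^ (n - 1)) * (of_int (coeff r i) * z ^ i))"
    by (simp add: distrib_left sum_distrib_left eq_neg_iff_add_eq_0 add.commute)
  also have "\<dots> = - (\<Sum>i<n. of_int (coeff r i * a ^ (n - 1 - i)) * w ^ i)"
    by (intro arg_cong[of _ _ uminus] sum.cong refl term_eq) simp
  also have "\<dots> \<in> add_span ((\<lambda>k. w ^ k) ` {..<n})"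
    by (intro subgrp_uminus subgrp_sum subgrp_of_int_mult subgrp_add_span add_span.base) auto
  finally show ?thesis by (simp add: n_def)
qed

text \<open>The exponent of the leading coefficient in \<open>Discr_star r * Prod_star r\<close> exceeds by one
  what is needed to clear the denominators of all factors.\<close>

lemma exponent_bound:
  fixes d l m :: nat
  assumes "l + m \<le> d + 1" "1 \<le> m" "k \<le> l * (l - 1)" "n \<le> l * l"
  shows "m * k + 2 * d * n \<le> 2 * d ^ 2 + 2 * d ^ 3"
proof -
  obtain f where f: "d = l + f" using le_Suc_ex[of l d] assms by auto
  have "k \<le> l * l" using assms(3) by (meson diff_le_self le_trans mult_le_mono2)
  then have "m * k \<le> (1 + f) * (l * l)" using assms(1) f by (intro mult_le_mono) auto
  moreover have "2 * d * n \<le> 2 * (l + f) * (l * l)"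
    unfolding f using assms by (intro mult_le_mono2)
  moreover have "(1 + f) * (l * l) + 2 * (l + f) * (l * l) \<le> 2 * d ^ 2 + 2 * d ^ 3"
    unfolding f power2_eq_square power3_eq_cube by (simp add: algebra_simps)
  ultimately show ?thesis by linarith
qed

lemma roots_pair_products_rational:
  fixes r :: "int poly"
  assumes "degree r > 0"
  defines "p \<equiv> map_poly of_int r :: complex poly"
  defines "Z \<equiv> {z. poly p z = 0}"
  shows "(\<Prod>(x, y)\<in>{(x, y). x \<in> Z \<and> y \<in> Z \<and> x \<noteq> y}. x - y) \<in> \<rat>"
    and "(\<Prod>(x, y)\<in>{(x, y). x \<in> Z \<and> y \<in> Z \<and> poly p (x * y) \<noteq> 0}. poly p (x * y)) \<in> \<rat>"
proof -
  define q where "q = (map_poly of_int r :: rat poly)"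
  have q: "cpoly q = p" unfolding q_def p_def by (rule cpoly_of_int)
  have "degree q > 0" using assms by (simp add: q_def degree_map_poly)
  then obtain f where f: "rsquarefree (cpoly f)" "\<And>z. poly (cpoly f) z = 0 \<longleftrightarrow> poly p z = 0"
    using exists_squarefree_part[of q] unfolding q by blast
  have Z: "{z. poly (cpoly f) z = 0} = Z" unfolding Z_def f(2) ..
  have "(\<Prod>(x, y)\<in>{(x, y). x \<in> Z \<and> y \<in> Z \<and> x - y \<noteq> 0}. x - y) \<in> \<rat>"
    unfolding Z[symmetric]
  proof (rule prod_pairs_rational[OF f(1)])
    fix x :: complex assume "x \<in> \<rat>"
    then obtain x' where "x = of_rat x'" by (auto elim: Rats_cases)
    then have "x - y = poly (cpoly [:x', -1:]) y" for y by (simp add: cpoly_linear of_rat_minus)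
    then show "\<exists>q. \<forall>y. x - y = poly (cpoly q) y" by blast
  next
    fix y :: complex
    have "x - y = poly [:-y, 1:] x" for x by simp
    then show "\<exists>q. \<forall>x. x - y = poly q x" by blast
  qed
  then show "(\<Prod>(x, y)\<in>{(x, y). x \<in> Z \<and> y \<in> Z \<and> x \<noteq> y}. x - y) \<in> \<rat>" by simp
  show "(\<Prod>(x, y)\<in>{(x, y). x \<in> Z \<and> y \<in> Z \<and> poly p (x * y) \<noteq> 0}. poly p (x * y)) \<in> \<rat>"
    unfolding Z[symmetric]
  proof (rule prod_pairs_rational[OF f(1)])
    fix x :: complex assume "x \<in> \<rat>"
    then obtain x' where "x = of_rat x'" by (auto elim: Rats_cases)
    then have "poly p (x * y) = poly (cpoly (pcompose q [:0, x':])) y" for y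
      by (simp add: cpoly_pcompose q poly_pcompose cpoly_linear mult.commute)
    then show "\<exists>q. \<forall>y. poly p (x * y) = poly (cpoly q) y" by blast
  next
    fix y :: complex
    have "poly p (x * y) = poly (pcompose p [:0, y:]) x" for x by (simp add: poly_pcompose)
    then show "\<exists>q. \<forall>x. poly p (x * y) = poly q x" by blast
  qed
qed

lemma card_roots_add_order_le:
  fixes p :: "complex poly"
  assumes "p \<noteq> 0" "poly p z = 0"
  shows "card {x. poly p x = 0} + order z p \<le> degree p + 1"
proof -
  let ?Z = "{x. poly p x = 0}"
  have fin: "finite ?Z" by (rule poly_roots_finite[OF assms(1)])
  have "degree p = (\<Sum>x\<in>?Z. order x p)"
    using size_proots_complex[of p] assms(1) by (simp add: size_multiset_overloaded_eq)
  also have "\<dots> = order z p + (\<Sum>x\<in>?Z - {z}. order x p)"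
    using fin assms by (intro sum.remove) auto
  finally have "degree p = order z p + (\<Sum>x\<in>?Z - {z}. order x p)" .
  moreover have "(\<Sum>x\<in>?Z - {z}. 1) \<le> (\<Sum>x\<in>?Z - {z}. order x p)"
    using assms(1) by (intro sum_mono) (auto simp: order_root Suc_le_eq)
  moreover have "card ?Z > 0" using fin assms by (auto simp: card_gt_0_iff)
  ultimately show ?thesis using fin assms by simp
qed

theorem theorem1p12:
  fixes br :: "'a::ab_group_add \<Rightarrow> 'a \<Rightarrow> 'a"
    and g :: "'a \<Rightarrow> 'a"
    and r :: "int poly"
  assumes "lie_ring br"
    and "lie_ring_endo br g"
    and "good_poly r"
    and "\<forall>v. (\<Sum>i\<le>degree r. zsmult (coeff r i) ((g ^^ i) v)) = 0"
    and "\<forall>n::int. complex_of_int n = Discr_star r * Prod_star r \<longrightarrow> \<not> has_torsion n TYPE('a)"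
  shows "nilpotent_class_le br (degree r ^ (2 ^ degree r))"
proof (cases "degree r = 0")
  case True
  \<comment> \<open>A constant \<open>r\<close> annihilates the ring, which therefore is zero; this
    fits the bound \<open>0 ^ (2 ^ 0) = 0\<close>.\<close>
  have "complex_of_int (coeff r 0) = Discr_star r * Prod_star r"
    using True by (simp add: Discr_star_def Prod_star_def)
  then have "\<not> has_torsion (coeff r 0) TYPE('a)" using assms(5) by blast
  then have "v = 0" for v :: 'a using assms(4) True by (auto simp: has_torsion_def)
  then show ?thesis using True by (auto simp: nilpotent_class_le_def)
next
  case False
  define d where "d = degree r"
  define a where "a = (of_int (lead_coeff r) :: complex)"
  define p where "p = (map_poly of_int r :: complex poly)"
  define Z where "Z = {z. poly p z = 0}"
  define m where "m = Max ((\<lambda>z. order z p) ` Z)"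
  define P1 where "P1 = {(x, y). x \<in> Z \<and> y \<in> Z \<and> x \<noteq> y}"
  define P2 where "P2 = {(x, y). x \<in> Z \<and> y \<in> Z \<and> poly p (x * y) \<noteq> 0}"
  have d: "d > 0" using False by (simp add: d_def)
  have deg_p: "degree p = d" by (simp add: p_def d_def degree_map_poly)
  have p0: "p \<noteq> 0" using d deg_p by auto
  have finZ: "finite Z" unfolding Z_def by (rule poly_roots_finite[OF p0])
  have Zne: "Z \<noteq> {}"
    using fundamental_theorem_of_algebra[of p] d by (auto simp: Z_def constant_degree deg_p)
  have "P1 \<subseteq> Z \<times> Z" "P2 \<subseteq> Z \<times> Z" by (auto simp: P1_def P2_def)
  then have fin: "finite P1" "finite P2" using finZ by (auto intro: finite_subset)
  have "m \<in> (\<lambda>z. order z p) ` Z" unfolding m_def using finZ Zne by (intro Max_in) auto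
  then obtain z0 where z0: "z0 \<in> Z" "m = order z0 p" by blast
  have m1: "m \<ge> 1" using z0 p0 by (auto simp: Z_def order_root Suc_le_eq)
  \<comment> \<open>Since \<open>m\<close> is positive, the \<open>m\<close>-th power really
    contains every difference of roots as a factor.\<close>
  then obtain k where k: "m = Suc k" by (cases m) auto
  have lm: "card Z + m \<le> d + 1"
    using card_roots_add_order_le[OF p0, of z0] z0 by (simp add: Z_def deg_p)
  have "P1 = Z \<times> Z - (\<lambda>x. (x, x)) ` Z" by (auto simp: P1_def)
  then have "card P1 = card (Z \<times> Z) - card ((\<lambda>x. (x, x)) ` Z)"
    using finZ by (simp only:) (intro card_Diff_subset, auto)
  then have k1: "card P1 \<le> card Z * (card Z - 1)"
    by (simp add: card_image inj_on_def card_cartesian_product right_diff_distrib')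
  have k2: "card P2 \<le> card Z * card Z"
    using card_mono[OF _ \<open>P2 \<subseteq> Z \<times> Z\<close>] finZ by (simp add: card_cartesian_product)
  \<comment> \<open>What is left of the powers of \<open>a\<close> after \<open>m\<close> for each
    pair in \<open>P1\<close> and \<open>2 * d\<close> for each pair in \<open>P2\<close> have been
    spent on clearing denominators.\<close>
  define E where "E = 2 * d ^ 2 + 2 * d ^ 3 - (m * card P1 + 2 * d * card P2)"
  have E: "2 * d ^ 2 + 2 * d ^ 3 = E + (m * card P1 + 2 * d * card P2)"
    unfolding E_def using exponent_bound[OF lm m1 k1 k2] by simp
  \<comment> \<open>The powers of \<open>a\<close> are distributed so that every factor lies in the
    ring; the one \<open>a\<close> held back, see \<open>DP\<close>, will make \<open>a\<close>
    itself regular.\<close>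
  define N0 where "N0 = a ^ E * of_nat (fact (m - 1)) * (\<Prod>(x, y)\<in>P1. a * x - a * y) ^ m *
      (\<Prod>(x, y)\<in>P2. a ^ (2 * d) * poly p (x * y))"
  have N0: "N0 = a ^ (2 * d ^ 2 + 2 * d ^ 3) * of_nat (fact (m - 1)) * (\<Prod>(x, y)\<in>P1. x - y) ^ m *
      (\<Prod>(x, y)\<in>P2. poly p (x * y))"
  proof -
    have "(\<Prod>(x, y)\<in>P1. a * x - a * y) = (\<Prod>u\<in>P1. a * (case u of (x, y) \<Rightarrow> x - y))"
      by (rule prod.cong) (auto simp: algebra_simps)
    then have 1: "(\<Prod>(x, y)\<in>P1. a * x - a * y) = a ^ card P1 * (\<Prod>(x, y)\<in>P1. x - y)"
      by (simp add: prod.distrib)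
    have "(\<Prod>(x, y)\<in>P2. a ^ (2 * d) * poly p (x * y)) = (\<Prod>u\<in>P2. a ^ (2 * d) * (case u of (x, y) \<Rightarrow> poly p (x * y)))"
      by (rule prod.cong) auto
    then have 2: "(\<Prod>(x, y)\<in>P2. a ^ (2 * d) * poly p (x * y)) = (a ^ (2 * d)) ^ card P2 * (\<Prod>(x, y)\<in>P2. poly p (x * y))"
      by (simp add: prod.distrib)
    show ?thesis unfolding N0_def 1 2 E power_add power_mult_distrib
      by (simp add: mult_ac flip: power_mult)
  qed
  have a_coeff: "of_int (coeff r d) = a" by (simp add: a_def d_def)
  have DP: "Discr_star r * Prod_star r = a * N0"
    using False unfolding N0 Discr_star_def Prod_star_def Let_def p_def[symmetric] Z_def[symmetric] m_def[symmetric]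
      d_def[symmetric] a_def[symmetric] P1_def[symmetric] P2_def[symmetric]
    by (simp add: Z_def P1_def P2_def m_def power_add prod_power_distrib split_beta mult_ac a_coeff)
  have rat: "N0 \<in> \<rat>"
    unfolding N0 using roots_pair_products_rational[of r] False
    unfolding p_def[symmetric] Z_def[symmetric] P1_def[symmetric] P2_def[symmetric]
    by (intro Rats_mult Rats_power Rats_of_nat) (simp_all add: a_def)
  obtain R' where R': "fg_subring R'" "(\<lambda>z. a * z) ` Z \<subseteq> R'"
  proof (rule exists_fg_subring[of "(\<lambda>z. a * z) ` Z" d])
    fix w assume "w \<in> (\<lambda>z. a * z) ` Z"
    then show "w ^ d \<in> add_span ((\<lambda>k. w ^ k) ` {..<d})"
      using lead_mult_root_integral[of r] d by (auto simp: Z_def p_def d_def a_def)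
  qed (use finZ d in auto)
  obtain B0 where B0: "finite B0" "R' = add_span B0" using R'(1) by (auto simp: fg_subring_def)
  obtain B where B: "finite B" "add_span B = add_span B0" "int_independent B"
    by (rule exists_int_basis[OF B0(1)])
  interpret R: int_basis_ring B
    using B R'(1) B0 by unfold_locales (auto simp: fg_subring_def)
  have root_mem: "a * z \<in> R.R" if "z \<in> Z" for z using that R'(2) B0 B by auto
  have a_mem: "a \<in> R.R" unfolding a_def by (rule R.of_int_mem)
  have f1_mem: "a * x - a * y \<in> R.R" if "(x, y) \<in> P1" for x y
    using that by (intro R.diff_mem root_mem) (auto simp: P1_def)
  have f2_mem: "a ^ (2 * d) * poly p (x * y) \<in> R.R" if "(x, y) \<in> P2" for x y
  proof -
    have "poly p (x * y) = (\<Sum>i\<le>d. of_int (coeff r i) * (x * y) ^ i)"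
      unfolding poly_altdef deg_p by (simp add: p_def coeff_map_poly)
    then have "a ^ (2 * d) * poly p (x * y) = (\<Sum>i\<le>d. a ^ (2 * d) * (of_int (coeff r i) * (x * y) ^ i))"
      by (simp add: sum_distrib_left)
    also have "\<dots> = (\<Sum>i\<le>d. of_int (coeff r i) * a ^ (2 * (d - i)) * ((a * x) * (a * y)) ^ i)"
    proof (rule sum.cong)
      fix i assume "i \<in> {..d}"
      then have "2 * d = 2 * (d - i) + (i + i)" by simp
      then have "a ^ (2 * d) = a ^ (2 * (d - i)) * (a ^ i * a ^ i)" by (simp only: power_add)
      then show "a ^ (2 * d) * (of_int (coeff r i) * (x * y) ^ i) =
          of_int (coeff r i) * a ^ (2 * (d - i)) * ((a * x) * (a * y)) ^ i"
        by (simp only: power_mult_distrib mult_ac)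
    qed simp
    also have "\<dots> \<in> R.R"
      using that by (intro R.sum_mem R.mult_mem R.of_int_mem R.power_mem a_mem root_mem)
        (auto simp: P2_def)
    finally show ?thesis .
  qed
  have pr1_mem: "(\<Prod>(x, y)\<in>S. a * x - a * y) \<in> R.R" if "S \<subseteq> P1" for S
    using that f1_mem by (intro R.prod_mem) auto
  have pr2_mem: "(\<Prod>(x, y)\<in>S. a ^ (2 * d) * poly p (x * y)) \<in> R.R" if "S \<subseteq> P2" for S
    using that f2_mem by (intro R.prod_mem) auto
  have c_mem: "a ^ E * of_nat (fact (m - 1)) \<in> R.R"
    using R.of_int_mem[of "int (fact (m - 1))"] by (intro R.mult_mem R.power_mem a_mem) simp
  have "N0 \<in> R.R"
    unfolding N0_def by (intro R.mult_mem[OF R.mult_mem[OF c_mem R.power_mem]] pr1_mem pr2_mem) auto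
  then have "N0 \<in> \<int>" using rat by (rule R.rational_mem_Ints)
  then obtain n0 where n0: "N0 = of_int n0" by (auto elim: Ints_cases)
  have "complex_of_int (lead_coeff r * n0) = Discr_star r * Prod_star r"
    unfolding DP n0 a_def by simp
  then have "\<not> has_torsion (lead_coeff r * n0) TYPE('a)" using assms(5) by blast
  then have tf: "v = 0" if "zsmult (lead_coeff r * n0) v = 0" for v :: 'a
    using that by (auto simp: has_torsion_def)
  have tf0: "v = 0" if "zsmult n0 v = 0" for v :: 'a
    by (rule tf) (simp add: zsmult_mult that)
  have tfa: "v = 0" if "zsmult (lead_coeff r) v = 0" for v :: 'a
    by (rule tf) (simp add: mult.commute[of "lead_coeff r"] zsmult_mult that)
  interpret L: leibniz_ring br
  proof
    have lr: "br (x + y) z = br x z + br y z" "br x (y + z) = br x y + br x z" "br x x = 0"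
      "br x (br y z) + br y (br z x) + br z (br x y) = 0" for x y z
      using assms(1) by (auto simp: lie_ring_def)
    have anti: "br x y = - br y x" for x y
    proof -
      have "br (x + y) (x + y) = br x y + br y x" by (simp only: lr(1,2)) (simp add: lr(3))
      then show ?thesis using lr(3)[of "x + y"] by (simp add: eq_neg_iff_add_eq_0)
    qed
    fix u v w
    show "br (u + v) w = br u w + br v w" "br u (v + w) = br u v + br u w" by (rule lr)+
    have neg: "br x (- y) = - br x y" for x y
      using lr(2)[of x y "- y"] lr(2)[of x 0 0] by (simp add: eq_neg_iff_add_eq_0 add.commute)
    have "br u (br v w) + br v (br w u) + br w (br u v) = 0" by (rule lr)
    moreover have "br v (br w u) = br (br u w) v" by (metis anti neg minus_minus)
    moreover have "br w (br u v) = - br (br u v) w" by (rule anti)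
    ultimately show "br u (br v w) = br (br u v) w - br (br u w) v"
      by (simp add: algebra_simps eq_neg_iff_add_eq_0)
  qed
  define regular where "regular = (\<lambda>x. x \<in> R.R \<and> (\<forall>V :: complex \<Rightarrow> 'a. V \<in> R.car \<longrightarrow> R.sc x V = 0 \<longrightarrow> V = 0))"
  have regular_fold: "(x \<in> R.R \<and> (\<forall>V :: complex \<Rightarrow> 'a. V \<in> R.car \<longrightarrow> R.sc x V = 0 \<longrightarrow> V = 0)) = regular x" for x
    unfolding regular_def ..
  \<comment> \<open>If a divisor \<open>x\<close> of \<open>N0\<close> kills \<open>V\<close>, so
    does the integer \<open>n0\<close>, which acts coordinatewise and without torsion.\<close>
  have regular_dvd: "regular x" if "x \<in> R.R" "y \<in> R.R" "N0 = x * y" for x y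
    unfolding regular_def
  proof (intro conjI allI impI that(1))
    fix V :: "complex \<Rightarrow> 'a" assume V: "V \<in> R.car" "R.sc x V = 0"
    have "R.sc (of_int n0) V = R.sc y (R.sc x V)"
      using R.sc_mult[OF that(2,1)] that(3) n0 by (simp add: mult.commute)
    then have "(\<lambda>b. zsmult n0 (V b)) = 0" using V R.sc_of_int[OF V(1)] by simp
    then have "zsmult n0 (V b) = 0" for b by (metis zero_fun_apply)
    then show "V = 0" using tf0 by (auto simp: fun_eq_iff zero_fun_apply)
  qed
  interpret eigenspace_grading B br g r a p Z regular
  proof (unfold_locales, unfold a_def[symmetric] p_def[symmetric], unfold Z_def[symmetric], unfold regular_fold)
    show "g (u + v) = g u + g v" "g (br u v) = br (g u) (g v)" for u v
      using assms(2) by (auto simp: lie_ring_endo_def)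
    show "(\<Sum>i\<le>degree r. zsmult (coeff r i) ((g ^^ i) v)) = 0" for v using assms(4) by blast
    show "degree r > 0" using False by simp
    show "a * z \<in> add_span B" if "z \<in> Z" for z using that by (rule root_mem)
    show "regular a"
      unfolding regular_def
    proof (intro conjI allI impI a_mem)
      fix V :: "complex \<Rightarrow> 'a" assume V: "V \<in> R.car" "R.sc a V = 0"
      then have "(\<lambda>b. zsmult (lead_coeff r) (V b)) = 0" using R.sc_of_int[OF V(1)] by (simp add: a_def)
      then have "zsmult (lead_coeff r) (V b) = 0" for b by (metis zero_fun_apply)
      then show "V = 0" using tfa by (auto simp: fun_eq_iff zero_fun_apply)
    qed
    show "regular (a * x - a * y)" if "x \<in> Z" "y \<in> Z" "x \<noteq> y" for x y
    proof (rule regular_dvd)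
      have xy: "(x, y) \<in> P1" using that by (simp add: P1_def)
      then show "a * x - a * y \<in> R.R" by (rule f1_mem)
      define t where "t = (\<Prod>(x, y)\<in>P1 - {(x, y)}. a * x - a * y)"
      have "(\<Prod>(x, y)\<in>P1. a * x - a * y) = (a * x - a * y) * t"
        unfolding t_def using prod.remove[OF fin(1) xy, of "\<lambda>(x, y). a * x - a * y"] by simp
      then show "N0 = (a * x - a * y) * (t * (\<Prod>(x, y)\<in>P1. a * x - a * y) ^ k * (a ^ E * of_nat (fact (m - 1))) *
          (\<Prod>(x, y)\<in>P2. a ^ (2 * d) * poly p (x * y)))"
        unfolding N0_def k power_Suc by (simp only: mult_ac)
      show "t * (\<Prod>(x, y)\<in>P1. a * x - a * y) ^ k * (a ^ E * of_nat (fact (m - 1))) *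
          (\<Prod>(x, y)\<in>P2. a ^ (2 * d) * poly p (x * y)) \<in> R.R"
        unfolding t_def
        by (intro R.mult_mem[OF R.mult_mem[OF R.mult_mem[OF _ R.power_mem] c_mem]] pr1_mem pr2_mem) auto
    qed
    show "regular (a ^ (2 * degree r) * poly p (x * y))" if "x \<in> Z" "y \<in> Z" "x * y \<notin> Z" for x y
      unfolding d_def[symmetric]
    proof (rule regular_dvd)
      have xy: "(x, y) \<in> P2" using that by (simp add: P2_def Z_def)
      then show "a ^ (2 * d) * poly p (x * y) \<in> R.R" by (rule f2_mem)
      define t where "t = (\<Prod>(x, y)\<in>P2 - {(x, y)}. a ^ (2 * d) * poly p (x * y))"
      have "(\<Prod>(x, y)\<in>P2. a ^ (2 * d) * poly p (x * y)) = (a ^ (2 * d) * poly p (x * y)) * t"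
        unfolding t_def using prod.remove[OF fin(2) xy, of "\<lambda>(x, y). a ^ (2 * d) * poly p (x * y)"] by simp
      then show "N0 = (a ^ (2 * d) * poly p (x * y)) * (a ^ E * of_nat (fact (m - 1)) * (\<Prod>(x, y)\<in>P1. a * x - a * y) ^ m * t)"
        unfolding N0_def by (simp only: mult_ac)
      show "a ^ E * of_nat (fact (m - 1)) * (\<Prod>(x, y)\<in>P1. a * x - a * y) ^ m * t \<in> R.R"
        unfolding t_def by (intro R.mult_mem[OF R.mult_mem[OF c_mem R.power_mem]] pr1_mem pr2_mem) auto
    qed
    show "\<exists>k::nat. x * y ^ k \<notin> Z" if "x \<in> Z" "y \<in> Z" for x y
      using good_poly_roots_arith_free[OF assms(3)] that by (auto simp: Z_def p_def)
    show "0 \<notin> Z" "1 \<notin> Z"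
      using good_poly_nonzero[OF assms(3)] poly_of_int_of_int[of r 0] poly_of_int_of_int[of r 1]
      by (auto simp: Z_def p_def)
  qed (simp_all add: a_def p_def Z_def regular_def)
  show ?thesis using nilpotent by (simp add: nilpotent_class_le_def)
qed

end
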